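(* Let $n\ge1$, $s\in(0,1)$, let $\Omega\subset\mathbb{R}^n$ be a bounded Lipschitz domain, and let $\Omega_h$, $h\ge1$, be a sequence of uniformly Lipschitz domains such that $$\overline\Omega\subset\Omega_h\subseteq\{x\in\mathbb{R}^n: d(x,\Omega)<\tfrac1h\}.$$ Let $B_R$ be an open ball containing $\overline\Omega_h$ for all $h$. Let $u_h\in\widetilde H^s(\Omega_h)$ be a sequence that is bounded in $\widetilde H^s(\Omega_h)$ (that is, $\sup_h\langle(-\Delta_{\Omega_h})^s u_h,u_h\rangle<\infty$) and such that $u_h\to u$ in $L^2(B_R)$. Then $u\in\widetilde H^s(\Omega)$ and $$\langle(-\Delta_\Omega)^s u,u\rangle\le\liminf_{h\to\infty}\langle(-\Delta_{\Omega_h})^s u_h,u_h\rangle.$$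
   Context: For a bounded Lipschitz domain $A\subset\mathbb{R}^n$, $-\Delta_A$ is the self-adjoint Dirichlet Laplacian in $L^2(A)$ with quadratic form $\|\nabla u\|_2^2$, $u\in H^1_0(A)$; $\lambda_j$ ($j\ge1$) are its eigenvalues in non-decreasing order, repeated according to multiplicity, and $\varphi_j\in H^1_0(A)$ are corresponding eigenfunctions forming an orthonormal basis of $L^2(A)$. $\widetilde H^s(A)=\{u\in H^s(\mathbb{R}^n): u\equiv0\text{ on }\mathbb{R}^n\setminus\overline A\}$, with $H^s(\mathbb R^n)$ the usual Sobolev space. The spectral (Navier) fractional Laplacian on $A$ is $(-\Delta_A)^su=\sum_j\lambda_j^s\big(\int_A u\varphi_j\big)\varphi_j$; its quadratic form has domain $\widetilde H^s(A)$, $\langle(-\Delta_A)^su,u\rangle=\sum_j\lambda_j^s\big(\int_A u\varphi_j\big)^2=\|u\|^2_{\widetilde H^s(A)}$. Functions in $\widetilde H^s(\Omega)$ and $\widetilde H^s(\Omega_h)$ are regarded as elements of $\widetilde H^s(B_R)$ (extension by zero). "Uniformly Lipschitz" means that the Lipschitz character of the boundary is uniform in $h$. *)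

theory Defs
  imports "HOL-Analysis.Analysis"
begin

text \<open>
  The space \<open>\<real>\<^sup>n\<close> is an arbitrary type of class \<open>euclidean_space\<close>, with \<open>n = DIM('a)\<close>.
  Elements of \<open>L\<^sup>2\<close> are represented by Lebesgue measurable functions that are total on the type;
  only the values on the set in question matter, and only up to null sets.
\<close>

subsection \<open>Lipschitz domains\<close>

definition domain :: "'a::euclidean_space set \<Rightarrow> bool" where
  "domain A \<longleftrightarrow> open A \<and> connected A \<and> A \<noteq> {}"

text \<open>
  The pair \<open>(L, r)\<close> is the Lipschitz character of the boundary: in the ball of radius \<open>r\<close> around
  any boundary point, \<open>A\<close> is, in suitable orthonormal coordinates with last axis \<open>e\<close>, the region
  strictly above the graph of an \<open>L\<close>-Lipschitz function on the hyperplane orthogonal to \<open>e\<close>.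
\<close>

definition lipschitz_boundary :: "real \<Rightarrow> real \<Rightarrow> 'a::euclidean_space set \<Rightarrow> bool" where
  "lipschitz_boundary L r A \<longleftrightarrow>
     (\<forall>p\<in>frontier A. \<exists>e \<gamma>. norm e = 1 \<and> L-lipschitz_on {y. y \<bullet> e = 0} \<gamma> \<and>
        A \<inter> ball p r = {x \<in> ball p r. \<gamma> (x - (x \<bullet> e) *\<^sub>R e) < x \<bullet> e})"

definition bounded_lipschitz_domain :: "'a::euclidean_space set \<Rightarrow> bool" where
  "bounded_lipschitz_domain A \<longleftrightarrow>
     domain A \<and> bounded A \<and> (\<exists>L. \<exists>r>0. lipschitz_boundary L r A)"

definition uniformly_lipschitz_domains :: "'i set \<Rightarrow> ('i \<Rightarrow> 'a::euclidean_space set) \<Rightarrow> bool" where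
  "uniformly_lipschitz_domains I A \<longleftrightarrow>
     (\<forall>i\<in>I. domain (A i) \<and> bounded (A i)) \<and>
     (\<exists>L. \<exists>r>0. \<forall>i\<in>I. lipschitz_boundary L r (A i))"

subsection \<open>Square integrable functions\<close>

definition L2_on :: "'a::euclidean_space set \<Rightarrow> ('a \<Rightarrow> 'b::euclidean_space) \<Rightarrow> bool" where
  "L2_on A f \<longleftrightarrow> f \<in> borel_measurable (lebesgue_on A) \<and>
     integrable (lebesgue_on A) (\<lambda>x. (norm (f x))\<^sup>2)"

definition L2_inner ::
    "'a::euclidean_space set \<Rightarrow> ('a \<Rightarrow> 'b::euclidean_space) \<Rightarrow> ('a \<Rightarrow> 'b) \<Rightarrow> real" where
  "L2_inner A f g = (LINT x|lebesgue_on A. f x \<bullet> g x)"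

text \<open>Only meaningful if all the functions involved satisfy \<open>L2_on A\<close>.\<close>

definition L2_converges ::
    "'a::euclidean_space set \<Rightarrow> (nat \<Rightarrow> 'a \<Rightarrow> 'b::euclidean_space) \<Rightarrow> ('a \<Rightarrow> 'b) \<Rightarrow> bool" where
  "L2_converges A f g \<longleftrightarrow>
     (\<lambda>k. LINT x|lebesgue_on A. (norm (f k x - g x))\<^sup>2) \<longlonglongrightarrow> 0"

definition zero_extension :: "'a set \<Rightarrow> ('a \<Rightarrow> real) \<Rightarrow> 'a \<Rightarrow> real" where
  "zero_extension A u = (\<lambda>x. if x \<in> A then u x else 0)"

subsection \<open>Test functions, weak gradients and the space \<open>H\<^sup>1\<^sub>0\<close>\<close>

definition partial :: "'a::euclidean_space \<Rightarrow> ('a \<Rightarrow> real) \<Rightarrow> 'a \<Rightarrow> real" where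
  "partial i f = (\<lambda>x. frechet_derivative f (at x) i)"

definition grad :: "('a::euclidean_space \<Rightarrow> real) \<Rightarrow> 'a \<Rightarrow> 'a" where
  "grad f = (\<lambda>x. \<Sum>i\<in>Basis. partial i f x *\<^sub>R i)"

primrec C_class :: "nat \<Rightarrow> ('a::euclidean_space \<Rightarrow> real) \<Rightarrow> bool" where
  "C_class 0 f \<longleftrightarrow> continuous_on UNIV f"
| "C_class (Suc k) f \<longleftrightarrow>
     (\<forall>x. f differentiable (at x)) \<and> (\<forall>i\<in>Basis. C_class k (partial i f))"

definition test_function :: "'a::euclidean_space set \<Rightarrow> ('a \<Rightarrow> real) \<Rightarrow> bool" where
  "test_function A f \<longleftrightarrow> (\<forall>k. C_class k f) \<and> (\<exists>K. compact K \<and> K \<subseteq> A \<and> (\<forall>x. x \<notin> K \<longrightarrow> f x = 0))"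

text \<open>\<open>has_weak_gradient A u g\<close> says that \<open>u\<close> belongs to \<open>H\<^sup>1(A)\<close> and \<open>\<nabla>u = g\<close>.\<close>

definition has_weak_gradient ::
    "'a::euclidean_space set \<Rightarrow> ('a \<Rightarrow> real) \<Rightarrow> ('a \<Rightarrow> 'a) \<Rightarrow> bool" where
  "has_weak_gradient A u g \<longleftrightarrow> L2_on A u \<and> L2_on A g \<and>
     (\<forall>\<psi>. test_function A \<psi> \<longrightarrow> (\<forall>i\<in>Basis.
        L2_inner A u (partial i \<psi>) = - L2_inner A (\<lambda>x. g x \<bullet> i) \<psi>))"

text \<open>\<open>H\<^sup>1\<^sub>0(A)\<close> is the closure of the test functions in \<open>H\<^sup>1(A)\<close>.\<close>

definition H10 :: "'a::euclidean_space set \<Rightarrow> ('a \<Rightarrow> real) set" where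
  "H10 A = {u. \<exists>g. has_weak_gradient A u g \<and>
     (\<exists>\<psi>. (\<forall>k. test_function A (\<psi> k)) \<and>
        L2_converges A \<psi> u \<and> L2_converges A (\<lambda>k. grad (\<psi> k)) g)}"

subsection \<open>The Dirichlet Laplacian and its spectral decomposition\<close>

text \<open>
  \<open>dirichlet_laplacian A u f\<close> says that \<open>u\<close> is in the domain of \<open>-\<Delta>\<^sub>A\<close> and \<open>-\<Delta>\<^sub>A u = f\<close>, where
  \<open>-\<Delta>\<^sub>A\<close> is the self-adjoint operator in \<open>L\<^sup>2(A)\<close> associated with the closed quadratic form
  \<open>\<parallel>\<nabla>u\<parallel>\<^sup>2\<close> on \<open>H\<^sup>1\<^sub>0(A)\<close>.
\<close>

definition dirichlet_laplacian ::
    "'a::euclidean_space set \<Rightarrow> ('a \<Rightarrow> real) \<Rightarrow> ('a \<Rightarrow> real) \<Rightarrow> bool" where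
  "dirichlet_laplacian A u f \<longleftrightarrow> u \<in> H10 A \<and> L2_on A f \<and>
     (\<exists>g. has_weak_gradient A u g \<and>
        (\<forall>v w. v \<in> H10 A \<and> has_weak_gradient A v w \<longrightarrow> L2_inner A g w = L2_inner A f v))"

definition L2_orthonormal_basis ::
    "'a::euclidean_space set \<Rightarrow> (nat \<Rightarrow> 'a \<Rightarrow> real) \<Rightarrow> bool" where
  "L2_orthonormal_basis A \<phi> \<longleftrightarrow>
     (\<forall>j. L2_on A (\<phi> j)) \<and>
     (\<forall>i j. L2_inner A (\<phi> i) (\<phi> j) = (if i = j then 1 else 0)) \<and>
     (\<forall>u::'a \<Rightarrow> real. L2_on A u \<longrightarrow>
        L2_converges A (\<lambda>N x. \<Sum>j<N. L2_inner A u (\<phi> j) * \<phi> j x) u)"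

text \<open>
  The eigenvalues in non-decreasing order, repeated according to multiplicity, together with an
  orthonormal basis of eigenfunctions. Indices start at \<open>0\<close> instead of \<open>1\<close>. That every eigenvalue
  is listed with its full multiplicity follows from the completeness of \<open>\<phi>\<close>.
\<close>

definition dirichlet_eigensystem ::
    "'a::euclidean_space set \<Rightarrow> (nat \<Rightarrow> real) \<Rightarrow> (nat \<Rightarrow> 'a \<Rightarrow> real) \<Rightarrow> bool" where
  "dirichlet_eigensystem A lam \<phi> \<longleftrightarrow> incseq lam \<and> L2_orthonormal_basis A \<phi> \<and>
     (\<forall>j. dirichlet_laplacian A (\<phi> j) (\<lambda>x. lam j * \<phi> j x))"

subsection \<open>Fractional Sobolev spaces and the spectral fractional Laplacian\<close>

text \<open>
  \<open>H\<^sup>s(\<real>\<^sup>n)\<close> for \<open>0 < s < 1\<close>, as the space of \<open>L\<^sup>2\<close> functions with finite Gagliardo seminorm.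
\<close>

definition Hs :: "real \<Rightarrow> ('a::euclidean_space \<Rightarrow> real) set" where
  "Hs s = {u. L2_on UNIV u \<and>
     (\<integral>\<^sup>+ x. \<integral>\<^sup>+ y. ennreal ((u x - u y)\<^sup>2 / norm (x - y) powr (real DIM('a) + 2 * s))
        \<partial>lebesgue \<partial>lebesgue) < \<infinity>}"

definition Hs_tilde :: "real \<Rightarrow> 'a::euclidean_space set \<Rightarrow> ('a \<Rightarrow> real) set" where
  "Hs_tilde s A = {u \<in> Hs s. AE x in lebesgue. x \<notin> closure A \<longrightarrow> u x = 0}"

text \<open>
  The quadratic form \<open>\<langle>(-\<Delta>\<^sub>A)\<^sup>s u, u\<rangle>\<close> of the spectral (Navier) fractional Laplacian, computed from
  an eigensystem of \<open>-\<Delta>\<^sub>A\<close>; it takes the value \<open>\<infinity>\<close> outside the form domain.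
\<close>

definition navier_form ::
    "real \<Rightarrow> 'a::euclidean_space set \<Rightarrow> (nat \<Rightarrow> real) \<Rightarrow> (nat \<Rightarrow> 'a \<Rightarrow> real) \<Rightarrow> ('a \<Rightarrow> real) \<Rightarrow> ennreal"
  where
  "navier_form s A lam \<phi> u = (\<Sum>j. ennreal (lam j powr s * (L2_inner A u (\<phi> j))\<^sup>2))"

end

theory Submission
  imports Defs
begin

text \<open>
  Writing \<open>\<lambda>\<^sup>s\<close> as a multiple of the integral of \<open>t\<^sup>s\<^sup>-\<^sup>2 (t\<lambda> / (t + \<lambda>))\<close> over \<open>t > 0\<close> turns the
  spectral form into an integral of \<open>K\<^sub>t(w) = inf \<parallel>\<nabla>v\<parallel>\<^sup>2 + t \<parallel>w - v\<parallel>\<^sup>2\<close>, the infimum being over test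
  functions \<open>v\<close>. By Fatou's lemma it suffices that \<open>K\<^sub>t\<close> is lower semicontinuous for each \<open>t\<close>. This
  needs no compactness: by a partition of unity and small shifts along the graph directions, a
  test function \<open>\<psi>\<close> on the \<open>\<delta>\<close>-neighbourhood of \<open>\<Omega>\<close> becomes a test function on \<open>\<Omega>\<close>, at \<open>L\<^sup>2\<close> distance
  \<open>O(\<delta>) \<parallel>\<nabla>\<psi>\<parallel>\<close> from \<open>\<psi>\<close> and with gradient norm at most \<open>(1 + O(\<delta>)) \<parallel>\<nabla>\<psi>\<parallel>\<close>. Finally
  \<open>\<parallel>w(\<cdot> - y) - w\<parallel>\<^sup>2 \<le> 8 \<bar>y\<bar>\<^sup>2 K\<^sub>t(w)\<close> with \<open>t = \<bar>y\<bar>\<^sup>-\<^sup>2\<close> bounds the Gagliardo seminorm of the limit by its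
  spectral form; the boundary of \<open>\<Omega>\<close> is a null set, so the values on it do not matter.
\<close>

subsection \<open>Square integrable functions\<close>

text \<open>The eigenfunctions of \<open>\<Omega>\<close> and of \<open>\<Omega>h h\<close> are
  unrelated, so the two spectral series cannot be compared term by term. For fixed t, however, K
  involves only a gradient norm and an L2 distance, and two domains can be compared by transporting
  one near-optimal test function. Since \<open>\<Omega>\<close> lies inside
  \<open>\<Omega>h h\<close>, extension by zero goes the wrong way: it bounds the value on the
  larger domain by the value on the smaller one. The required direction pushes a test function
  inward, at a cost that must vanish with the width 1/h of the collar. This is where the graph
  structure of the boundary enters, and why the leading constant of the gradient estimate has to be
  exactly 1: a larger one would survive the limit. The errors are relative to the norms of the
  near-optimal function, and these are bounded uniformly in h because K is at most t times a squared
  L2 norm. Taken at the scale t = |y|^-2, the same functional controls translations, so the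
  regularity of the limit is read off from the finiteness of its spectral form.\<close>

definition L2_norm :: "'a::euclidean_space set \<Rightarrow> ('a \<Rightarrow> 'b::euclidean_space) \<Rightarrow> real" where
  "L2_norm A f = sqrt (L2_inner A f f)"

lemma L2_inner_self: "L2_inner A f f = (LINT x|lebesgue_on A. (norm (f x))\<^sup>2)"
  by (simp add: L2_inner_def power2_norm_eq_inner)

lemma L2_inner_self_nonneg [simp]: "0 \<le> L2_inner A f f"
  unfolding L2_inner_self by simp

lemma L2_norm_nonneg [simp]: "0 \<le> L2_norm A f"
  by (simp add: L2_norm_def)

lemma L2_norm_power2: "(L2_norm A f)\<^sup>2 = L2_inner A f f"
  by (simp add: L2_norm_def)

lemma L2_inner_commute: "L2_inner A f g = L2_inner A g f"
  by (simp add: L2_inner_def inner_commute)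

lemma L2_on_dominated:
  fixes f :: "'a::euclidean_space \<Rightarrow> 'b::euclidean_space"
  assumes "f \<in> borel_measurable (lebesgue_on A)" "integrable (lebesgue_on A) g"
    and "\<And>x. (norm (f x))\<^sup>2 \<le> g x"
  shows "L2_on A f"
  unfolding L2_on_def
proof
  have 1: "(\<lambda>x. (norm (f x))\<^sup>2) \<in> borel_measurable (lebesgue_on A)"
    using assms(1) by measurable
  show "integrable (lebesgue_on A) (\<lambda>x. (norm (f x))\<^sup>2)"
    by (rule Bochner_Integration.integrable_bound[OF assms(2) 1])
       (use assms(3) in \<open>auto intro!: always_eventually intro: order_trans[OF _ abs_ge_self]\<close>)
qed (rule assms)

lemma L2_on_add [intro]:
  fixes f g :: "'a::euclidean_space \<Rightarrow> 'b::euclidean_space"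
  assumes "L2_on A f" "L2_on A g"
  shows "L2_on A (\<lambda>x. f x + g x)"
proof (rule L2_on_dominated)
  show "integrable (lebesgue_on A) (\<lambda>x. 2 * (norm (f x))\<^sup>2 + 2 * (norm (g x))\<^sup>2)"
    using assms by (simp add: L2_on_def)
  show "(norm (f x + g x))\<^sup>2 \<le> 2 * (norm (f x))\<^sup>2 + 2 * (norm (g x))\<^sup>2" for x
  proof -
    have "(norm (f x + g x))\<^sup>2 \<le> (norm (f x) + norm (g x))\<^sup>2"
      by (simp add: norm_triangle_ineq)
    also have "\<dots> \<le> 2 * (norm (f x))\<^sup>2 + 2 * (norm (g x))\<^sup>2"
      using sum_squares_bound[of "norm (f x)" "norm (g x)"] by (simp add: power2_sum)
    finally show ?thesis .
  qed
qed (use assms in \<open>auto simp: L2_on_def intro!: borel_measurable_add\<close>)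

lemma L2_on_scaleR [intro]:
  fixes f :: "'a::euclidean_space \<Rightarrow> 'b::euclidean_space"
  assumes "L2_on A f"
  shows "L2_on A (\<lambda>x. c *\<^sub>R f x)"
  using assms by (auto simp: L2_on_def power_mult_distrib)

lemma L2_on_cmult [intro]:
  fixes f :: "'a::euclidean_space \<Rightarrow> real"
  shows "L2_on A f \<Longrightarrow> L2_on A (\<lambda>x. c * f x)"
  using L2_on_scaleR[of A f c] by simp

lemma L2_on_uminus [intro]:
  fixes f :: "'a::euclidean_space \<Rightarrow> 'b::euclidean_space"
  shows "L2_on A f \<Longrightarrow> L2_on A (\<lambda>x. - f x)"
  using L2_on_scaleR[of A f "-1"] by simp

lemma L2_on_diff [intro]:
  fixes f g :: "'a::euclidean_space \<Rightarrow> 'b::euclidean_space"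
  assumes "L2_on A f" "L2_on A g"
  shows "L2_on A (\<lambda>x. f x - g x)"
  using L2_on_add[OF assms(1) L2_on_uminus[OF assms(2)]] by simp

lemma L2_on_zero [simp]: "L2_on A (\<lambda>x. 0)"
  by (simp add: L2_on_def)

lemma L2_on_sum [intro]:
  fixes f :: "'i \<Rightarrow> 'a::euclidean_space \<Rightarrow> 'b::euclidean_space"
  shows "(\<And>i. i \<in> I \<Longrightarrow> L2_on A (f i)) \<Longrightarrow> L2_on A (\<lambda>x. \<Sum>i\<in>I. f i x)"
  by (induction I rule: infinite_finite_induct) auto

lemma L2_on_inner [intro]:
  fixes f :: "'a::euclidean_space \<Rightarrow> 'b::euclidean_space"
  assumes "L2_on A f"
  shows "L2_on A (\<lambda>x. f x \<bullet> b)"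
proof (rule L2_on_dominated)
  show "integrable (lebesgue_on A) (\<lambda>x. (norm b)\<^sup>2 * (norm (f x))\<^sup>2)"
    using assms by (simp add: L2_on_def)
  show "(norm (f x \<bullet> b))\<^sup>2 \<le> (norm b)\<^sup>2 * (norm (f x))\<^sup>2" for x
    using Cauchy_Schwarz_ineq2[of "f x" b]
    by (metis abs_ge_zero mult.commute power_mono power_mult_distrib real_norm_def)
qed (use assms in \<open>auto simp: L2_on_def intro!: borel_measurable_inner\<close>)

lemma integrable_L2_inner:
  fixes f g :: "'a::euclidean_space \<Rightarrow> 'b::euclidean_space"
  assumes "L2_on A f" "L2_on A g"
  shows "integrable (lebesgue_on A) (\<lambda>x. f x \<bullet> g x)"
proof (rule Bochner_Integration.integrable_bound)
  show "integrable (lebesgue_on A) (\<lambda>x. (norm (f x))\<^sup>2 + (norm (g x))\<^sup>2)"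
    using assms by (simp add: L2_on_def)
  show "(\<lambda>x. f x \<bullet> g x) \<in> borel_measurable (lebesgue_on A)"
    using assms by (auto simp: L2_on_def intro!: borel_measurable_inner)
  have "norm (f x \<bullet> g x) \<le> (norm (f x))\<^sup>2 + (norm (g x))\<^sup>2" for x
  proof -
    have "\<bar>f x \<bullet> g x\<bar> \<le> norm (f x) * norm (g x)" by (rule Cauchy_Schwarz_ineq2)
    moreover have "2 * (norm (f x) * norm (g x)) \<le> (norm (f x))\<^sup>2 + (norm (g x))\<^sup>2"
      using sum_squares_bound[of "norm (f x)" "norm (g x)"] by simp
    moreover have "0 \<le> norm (f x) * norm (g x)" by simp
    ultimately show ?thesis by simp
  qed
  then show "AE x in lebesgue_on A. norm (f x \<bullet> g x) \<le> norm ((norm (f x))\<^sup>2 + (norm (g x))\<^sup>2)"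
    by (auto intro!: always_eventually)
qed

lemma L2_inner_add_left:
  fixes f g h :: "'a::euclidean_space \<Rightarrow> 'b::euclidean_space"
  assumes "L2_on A f" "L2_on A g" "L2_on A h"
  shows "L2_inner A (\<lambda>x. f x + g x) h = L2_inner A f h + L2_inner A g h"
  using assms by (simp add: L2_inner_def inner_add_left integrable_L2_inner)

lemma L2_inner_scaleR_left:
  fixes f h :: "'a::euclidean_space \<Rightarrow> 'b::euclidean_space"
  shows "L2_inner A (\<lambda>x. c *\<^sub>R f x) h = c * L2_inner A f h"
  by (simp add: L2_inner_def)

lemma L2_inner_cmult_left:
  fixes f h :: "'a::euclidean_space \<Rightarrow> real"
  shows "L2_inner A (\<lambda>x. c * f x) h = c * L2_inner A f h"
  by (simp add: L2_inner_def ac_simps)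

lemma L2_inner_diff_left:
  fixes f g h :: "'a::euclidean_space \<Rightarrow> 'b::euclidean_space"
  assumes "L2_on A f" "L2_on A g" "L2_on A h"
  shows "L2_inner A (\<lambda>x. f x - g x) h = L2_inner A f h - L2_inner A g h"
  using assms by (simp add: L2_inner_def inner_diff_left integrable_L2_inner)

lemma L2_inner_diff_right:
  fixes f g h :: "'a::euclidean_space \<Rightarrow> 'b::euclidean_space"
  assumes "L2_on A f" "L2_on A g" "L2_on A h"
  shows "L2_inner A h (\<lambda>x. f x - g x) = L2_inner A h f - L2_inner A h g"
  using L2_inner_diff_left[OF assms] by (simp add: L2_inner_commute)

lemma L2_inner_zero_left [simp]: "L2_inner A (\<lambda>x. 0) h = 0"
  by (simp add: L2_inner_def)

lemma L2_inner_sum_left: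
  fixes f :: "'i \<Rightarrow> 'a::euclidean_space \<Rightarrow> 'b::euclidean_space"
  assumes "\<And>i. i \<in> I \<Longrightarrow> L2_on A (f i)" "L2_on A h"
  shows "L2_inner A (\<lambda>x. \<Sum>i\<in>I. f i x) h = (\<Sum>i\<in>I. L2_inner A (f i) h)"
  using assms
  by (induction I rule: infinite_finite_induct) (auto simp: L2_inner_add_left L2_on_sum)

lemma L2_inner_lincomb_left:
  fixes f :: "'i \<Rightarrow> 'a::euclidean_space \<Rightarrow> 'b::euclidean_space"
  assumes "\<And>i. i \<in> I \<Longrightarrow> L2_on A (f i)" "L2_on A h"
  shows "L2_inner A (\<lambda>x. \<Sum>i\<in>I. a i *\<^sub>R f i x) h = (\<Sum>i\<in>I. a i * L2_inner A (f i) h)"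
  using L2_inner_sum_left[of I A "\<lambda>i x. a i *\<^sub>R f i x" h] assms
  by (simp add: L2_inner_scaleR_left L2_on_scaleR)

lemma L2_norm_power2_diff:
  fixes f g :: "'a::euclidean_space \<Rightarrow> 'b::euclidean_space"
  assumes "L2_on A f" "L2_on A g"
  shows "(L2_norm A (\<lambda>x. f x - g x))\<^sup>2 = L2_inner A f f - 2 * L2_inner A f g + L2_inner A g g"
  unfolding L2_norm_power2 using assms
  by (simp add: L2_inner_diff_left L2_inner_diff_right L2_on_diff L2_inner_commute[of A g f])

lemma L2_norm_uminus [simp]: "L2_norm A (\<lambda>x. - f x) = L2_norm A f"
  by (simp add: L2_norm_def L2_inner_def)

lemma L2_norm_minus_commute: "L2_norm A (\<lambda>x. f x - g x) = L2_norm A (\<lambda>x. g x - f x)"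
  using L2_norm_uminus[of A "\<lambda>x. f x - g x"] by simp

lemma L2_norm_scaleR [simp]: "L2_norm A (\<lambda>x. c *\<^sub>R f x) = \<bar>c\<bar> * L2_norm A f"
proof -
  have "L2_inner A (\<lambda>x. c *\<^sub>R f x) (\<lambda>x. c *\<^sub>R f x) = c\<^sup>2 * L2_inner A f f"
    by (simp add: L2_inner_def power2_eq_square ac_simps)
  then show ?thesis
    by (simp add: L2_norm_def real_sqrt_mult)
qed

lemma L2_Cauchy_Schwarz:
  fixes f g :: "'a::euclidean_space \<Rightarrow> 'b::euclidean_space"
  assumes f: "L2_on A f" and g: "L2_on A g"
  shows "\<bar>L2_inner A f g\<bar> \<le> L2_norm A f * L2_norm A g"
proof -
  let ?a = "L2_inner A f f" and ?b = "L2_inner A f g" and ?c = "L2_inner A g g"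
  have q: "0 \<le> ?a - 2 * t * ?b + t\<^sup>2 * ?c" for t
  proof -
    have "L2_inner A f (\<lambda>x. t *\<^sub>R g x) = t * ?b"
      "L2_inner A (\<lambda>x. t *\<^sub>R g x) (\<lambda>x. t *\<^sub>R g x) = t\<^sup>2 * ?c"
      by (simp_all add: L2_inner_def power2_eq_square ac_simps)
    then have "(L2_norm A (\<lambda>x. f x - t *\<^sub>R g x))\<^sup>2 = ?a - 2 * t * ?b + t\<^sup>2 * ?c"
      using f g by (subst L2_norm_power2_diff) auto
    then show ?thesis by (metis zero_le_power2)
  qed
  have "?b\<^sup>2 \<le> ?a * ?c"
  proof (cases "?c = 0")
    case True
    have "?b = 0"
    proof (rule ccontr)
      assume "?b \<noteq> 0"
      \<comment> \<open>The quadratic in \<open>t\<close> is affine when \<open>?c = 0\<close>; this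
        \<open>t\<close> is chosen to give it the value -1.\<close>
      then have "?a - 2 * ((?a + 1) / (2 * ?b)) * ?b + ((?a + 1) / (2 * ?b))\<^sup>2 * ?c = -1"
        using True by (simp add: field_simps)
      with q[of "(?a + 1) / (2 * ?b)"] show False by linarith
    qed
    then show ?thesis by simp
  next
    case False
    then have "0 < ?c" using L2_inner_self_nonneg[of A g] by linarith
    with q[of "?b / ?c"] show ?thesis
      by (simp add: field_simps power2_eq_square)
  qed
  then have "sqrt (?b\<^sup>2) \<le> sqrt (?a * ?c)" by (rule real_sqrt_le_mono)
  then show ?thesis by (simp add: L2_norm_def real_sqrt_mult)
qed

lemma L2_norm_triangle:
  fixes f g :: "'a::euclidean_space \<Rightarrow> 'b::euclidean_space"
  assumes f: "L2_on A f" and g: "L2_on A g"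
  shows "L2_norm A (\<lambda>x. f x + g x) \<le> L2_norm A f + L2_norm A g"
proof (rule power2_le_imp_le)
  have "(L2_norm A (\<lambda>x. f x + g x))\<^sup>2 = L2_inner A f f + 2 * L2_inner A f g + L2_inner A g g"
    using L2_norm_power2_diff[OF f L2_on_uminus[OF g]]
    by (simp add: L2_inner_def)
  also have "\<dots> \<le> (L2_norm A f)\<^sup>2 + 2 * (L2_norm A f * L2_norm A g) + (L2_norm A g)\<^sup>2"
    using L2_Cauchy_Schwarz[OF f g] by (simp add: L2_norm_power2)
  finally show "(L2_norm A (\<lambda>x. f x + g x))\<^sup>2 \<le> (L2_norm A f + L2_norm A g)\<^sup>2"
    by (simp add: power2_sum)
qed simp

lemma L2_norm_triangle_diff:
  fixes f g h :: "'a::euclidean_space \<Rightarrow> 'b::euclidean_space"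
  assumes "L2_on A f" "L2_on A g" "L2_on A h"
  shows "L2_norm A (\<lambda>x. f x - h x) \<le> L2_norm A (\<lambda>x. f x - g x) + L2_norm A (\<lambda>x. g x - h x)"
  using L2_norm_triangle[of A "\<lambda>x. f x - g x" "\<lambda>x. g x - h x"] assms by (simp add: L2_on_diff)

lemma L2_norm_sum:
  fixes f :: "'i \<Rightarrow> 'a::euclidean_space \<Rightarrow> 'b::euclidean_space"
  assumes "\<And>i. i \<in> I \<Longrightarrow> L2_on A (f i)"
  shows "L2_norm A (\<lambda>x. \<Sum>i\<in>I. f i x) \<le> (\<Sum>i\<in>I. L2_norm A (f i))"
  using assms
proof (induction I rule: infinite_finite_induct)
  case (insert i I)
  then have "L2_norm A (\<lambda>x. f i x + (\<Sum>i\<in>I. f i x)) \<le> L2_norm A (f i) + L2_norm A (\<lambda>x. \<Sum>i\<in>I. f i x)"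
    by (intro L2_norm_triangle) auto
  with insert show ?case by fastforce
qed (simp_all add: L2_norm_def)

lemma L2_converges_iff: "L2_converges A f g \<longleftrightarrow> (\<lambda>k. L2_norm A (\<lambda>x. f k x - g x)) \<longlonglongrightarrow> 0"
proof -
  have "L2_converges A f g \<longleftrightarrow> (\<lambda>k. (L2_norm A (\<lambda>x. f k x - g x))\<^sup>2) \<longlonglongrightarrow> 0"
    unfolding L2_converges_def L2_norm_power2 L2_inner_self ..
  also have "\<dots> \<longleftrightarrow> (\<lambda>k. L2_norm A (\<lambda>x. f k x - g x)) \<longlonglongrightarrow> 0"
    using tendsto_power[of _ 0 _ 2] tendsto_real_sqrt[of "\<lambda>k. (L2_norm A (\<lambda>x. f k x - g x))\<^sup>2" 0]
    by fastforce
  finally show ?thesis .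
qed

lemma L2_converges_inner:
  fixes f :: "nat \<Rightarrow> 'a::euclidean_space \<Rightarrow> 'b::euclidean_space"
  assumes "L2_converges A f g" "\<And>k. L2_on A (f k)" "L2_on A g" "L2_on A h"
  shows "(\<lambda>k. L2_inner A (f k) h) \<longlonglongrightarrow> L2_inner A g h"
proof (rule Lim_null[THEN iffD2], rule Lim_null_comparison)
  show "\<forall>\<^sub>F k in sequentially. norm (L2_inner A (f k) h - L2_inner A g h) \<le> L2_norm A (\<lambda>x. f k x - g x) * L2_norm A h"
    using L2_Cauchy_Schwarz[OF L2_on_diff[OF assms(2,3)] assms(4)] assms(2-)
    by (simp add: L2_inner_diff_left)
  show "(\<lambda>k. L2_norm A (\<lambda>x. f k x - g x) * L2_norm A h) \<longlonglongrightarrow> 0"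
    using assms(1) unfolding L2_converges_iff by (rule tendsto_mult_left_zero)
qed

lemma L2_converges_norm:
  fixes f :: "nat \<Rightarrow> 'a::euclidean_space \<Rightarrow> 'b::euclidean_space"
  assumes "L2_converges A f g" "\<And>k. L2_on A (f k)" "L2_on A g"
  shows "(\<lambda>k. L2_norm A (f k)) \<longlonglongrightarrow> L2_norm A g"
proof (rule Lim_null[THEN iffD2], rule Lim_null_comparison)
  have "\<bar>L2_norm A (f k) - L2_norm A g\<bar> \<le> L2_norm A (\<lambda>x. f k x - g x)" for k
    using L2_norm_triangle[OF L2_on_diff[OF assms(2,3)] assms(3), of k]
      L2_norm_triangle[OF L2_on_diff[OF assms(3,2)] assms(2), of k k]
    by (simp add: L2_norm_minus_commute[of A g])
  then show "\<forall>\<^sub>F k in sequentially. norm (L2_norm A (f k) - L2_norm A g) \<le> L2_norm A (\<lambda>x. f k x - g x)"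
    by simp
qed (use assms(1) L2_converges_iff in auto)

lemma L2_converges_lincomb:
  fixes f :: "'i \<Rightarrow> nat \<Rightarrow> 'a::euclidean_space \<Rightarrow> 'b::euclidean_space"
  assumes "\<And>i. i \<in> I \<Longrightarrow> L2_converges A (f i) (g i)"
    and "\<And>i k. i \<in> I \<Longrightarrow> L2_on A (f i k)" "\<And>i. i \<in> I \<Longrightarrow> L2_on A (g i)"
  shows "L2_converges A (\<lambda>k x. \<Sum>i\<in>I. a i *\<^sub>R f i k x) (\<lambda>x. \<Sum>i\<in>I. a i *\<^sub>R g i x)"
  unfolding L2_converges_iff
proof (rule Lim_null_comparison)
  have "L2_norm A (\<lambda>x. (\<Sum>i\<in>I. a i *\<^sub>R f i k x) - (\<Sum>i\<in>I. a i *\<^sub>R g i x))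
      \<le> (\<Sum>i\<in>I. \<bar>a i\<bar> * L2_norm A (\<lambda>x. f i k x - g i x))" for k
    using L2_norm_sum[of I A "\<lambda>i x. a i *\<^sub>R (f i k x - g i x)"] assms(2,3)
    by (simp add: sum_subtractf scaleR_diff_right[symmetric] L2_on_diff L2_on_scaleR)
       (simp add: sum_subtractf scaleR_diff_right)
  then show "\<forall>\<^sub>F k in sequentially. norm (L2_norm A (\<lambda>x. (\<Sum>i\<in>I. a i *\<^sub>R f i k x) - (\<Sum>i\<in>I. a i *\<^sub>R g i x)))
      \<le> (\<Sum>i\<in>I. \<bar>a i\<bar> * L2_norm A (\<lambda>x. f i k x - g i x))"
    by simp
  show "(\<lambda>k. \<Sum>i\<in>I. \<bar>a i\<bar> * L2_norm A (\<lambda>x. f i k x - g i x)) \<longlonglongrightarrow> 0"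
    using assms(1) unfolding L2_converges_iff
    by (intro tendsto_null_sum tendsto_mult_right_zero) auto
qed

lemma integrable_lebesgue_on_subset:
  fixes f :: "'a::euclidean_space \<Rightarrow> 'b::euclidean_space"
  assumes "integrable (lebesgue_on B) f" "A \<subseteq> B" "A \<in> sets lebesgue" "B \<in> sets lebesgue"
  shows "integrable (lebesgue_on A) f"
  using assms set_integrable_subset[of lebesgue B f A]
  by (simp add: integrable_restrict_space set_integrable_def)

lemma L2_on_subset:
  fixes f :: "'a::euclidean_space \<Rightarrow> 'b::euclidean_space"
  assumes "L2_on B f" "A \<subseteq> B" "A \<in> sets lebesgue" "B \<in> sets lebesgue"
  shows "L2_on A f"
  using assms unfolding L2_on_def
  by (auto intro: integrable_lebesgue_on_subset measurable_restrict_mono)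

lemma L2_norm_subset_le:
  fixes f :: "'a::euclidean_space \<Rightarrow> 'b::euclidean_space"
  assumes "L2_on B f" "A \<subseteq> B" "A \<in> sets lebesgue" "B \<in> sets lebesgue"
  shows "L2_norm A f \<le> L2_norm B f"
proof -
  have "L2_inner A f f \<le> L2_inner B f f"
    unfolding L2_inner_self
  proof -
    have i: "integrable (lebesgue_on C) (\<lambda>x. (norm (f x))\<^sup>2) \<longleftrightarrow> integrable lebesgue (\<lambda>x. indicator C x *\<^sub>R (norm (f x))\<^sup>2)"
      "(LINT x|lebesgue_on C. (norm (f x))\<^sup>2) = (LINT x|lebesgue. indicator C x *\<^sub>R (norm (f x))\<^sup>2)"
      if "C \<in> sets lebesgue" for C
      using that by (simp_all add: integrable_restrict_space integral_restrict_space)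
    show "(LINT x|lebesgue_on A. (norm (f x))\<^sup>2) \<le> (LINT x|lebesgue_on B. (norm (f x))\<^sup>2)"
      using L2_on_subset[OF assms] assms unfolding L2_on_def i(2)[OF assms(3)] i(2)[OF assms(4)]
      by (intro integral_mono) (auto simp: i indicator_def split: if_splits)
  qed
  then show ?thesis by (simp add: L2_norm_def)
qed

subsection \<open>Smooth functions\<close>

lemma partial_eq: "(f has_derivative D) (at x) \<Longrightarrow> partial i f x = D i"
  unfolding partial_def by (metis frechet_derivative_at)

lemma has_derivative_partial:
  assumes "f differentiable (at x)"
  shows "(f has_derivative (\<lambda>h. grad f x \<bullet> h)) (at x)"
proof -
  obtain D where D: "(f has_derivative D) (at x)"
    using assms by (auto simp: differentiable_def)
  then interpret D: bounded_linear D by (rule has_derivative_bounded_linear)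
  have "D = (\<lambda>h. grad f x \<bullet> h)"
  proof
    fix h
    have "D h = D (\<Sum>i\<in>Basis. (h \<bullet> i) *\<^sub>R i)" by (simp add: euclidean_representation)
    also have "\<dots> = (\<Sum>i\<in>Basis. (h \<bullet> i) * partial i f x)"
      by (simp add: D.sum D.scaleR partial_eq[OF D])
    also have "\<dots> = grad f x \<bullet> h"
      by (simp add: grad_def inner_sum_left inner_commute[of h] ac_simps)
    finally show "D h = grad f x \<bullet> h" .
  qed
  with D show ?thesis by simp
qed

lemma C_class_continuous: "C_class k f \<Longrightarrow> continuous_on UNIV f"
  by (cases k) (auto intro!: continuous_at_imp_continuous_on differentiable_imp_continuous_within)

lemma C_class_Suc_imp: "C_class (Suc k) f \<Longrightarrow> C_class k f"
proof (induction k arbitrary: f)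
  case 0
  then show ?case using C_class_continuous by fastforce
qed auto

lemma C_class_const: "C_class k (\<lambda>x::'a::euclidean_space. c)"
proof (induction k arbitrary: c)
  case (Suc k)
  have "partial i (\<lambda>x. c) = (\<lambda>x. 0)" for i :: 'a
    by (rule ext, rule partial_eq) (rule derivative_eq_intros | simp)+
  with Suc show ?case by simp
qed simp

lemma C_class_add: "C_class k f \<Longrightarrow> C_class k g \<Longrightarrow> C_class k (\<lambda>x. f x + g x)"
proof (induction k arbitrary: f g)
  case (Suc k)
  have "partial i (\<lambda>x. f x + g x) = (\<lambda>x. partial i f x + partial i g x)" for i
  proof
    fix x
    have "f differentiable (at x)" "g differentiable (at x)" using Suc.prems by auto
    note d = this[THEN has_derivative_partial]
    show "partial i (\<lambda>x. f x + g x) x = partial i f x + partial i g x"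
      using partial_eq[OF has_derivative_add[OF d], of i] by (simp add: partial_eq[OF d(1)] partial_eq[OF d(2)])
  qed
  with Suc show ?case by simp
qed (auto intro!: continuous_intros)

lemma C_class_mult: "C_class k f \<Longrightarrow> C_class k g \<Longrightarrow> C_class k (\<lambda>x. f x * g x)"
proof (induction k arbitrary: f g)
  case (Suc k)
  have "partial i (\<lambda>x. f x * g x) = (\<lambda>x. f x * partial i g x + partial i f x * g x)" for i
  proof
    fix x
    have "f differentiable (at x)" "g differentiable (at x)" using Suc.prems by auto
    note d = this[THEN has_derivative_partial]
    show "partial i (\<lambda>x. f x * g x) x = f x * partial i g x + partial i f x * g x"
      using partial_eq[OF has_derivative_mult[OF d], of i] by (simp add: partial_eq[OF d(1)] partial_eq[OF d(2)])
  qed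
  moreover have "C_class k f" "C_class k g" using Suc.prems C_class_Suc_imp by blast+
  ultimately show ?case
    using Suc by (auto intro!: C_class_add)
qed (auto intro!: continuous_intros)

lemma has_derivative_translate:
  assumes "f differentiable (at (x - a))"
  shows "((\<lambda>x. f (x - a)) has_derivative (\<lambda>h. grad f (x - a) \<bullet> h)) (at x)"
proof -
  have *: "((\<lambda>x. x - a) has_derivative (\<lambda>h. h)) (at x)"
    by (auto intro!: derivative_eq_intros)
  show ?thesis
    using has_derivative_compose[OF * has_derivative_partial[OF assms]] by simp
qed

lemma partial_translate:
  assumes "\<And>x. f differentiable (at x)"
  shows "partial i (\<lambda>x. f (x - a)) = (\<lambda>x. partial i f (x - a))"
  using partial_eq[OF has_derivative_translate[OF assms]] partial_eq[OF has_derivative_partial[OF assms]]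
  by fastforce

lemma C_class_translate: "C_class k f \<Longrightarrow> C_class k (\<lambda>x. f (x - a))"
proof (induction k arbitrary: f)
  case 0
  then show ?case by (auto intro!: continuous_on_compose2[of UNIV f] continuous_intros)
next
  case (Suc k)
  then have "(\<lambda>x. f (x - a)) differentiable (at x)" for x
    using has_derivative_translate[of f x a] by (meson C_class.simps(2) differentiable_def)
  with Suc show ?case by (simp add: partial_translate)
qed

text \<open>\<open>F n\<close> plays the n-th derivative of \<open>F 0\<close>. Keeping
  \<open>n\<close> arbitrary closes the induction, because a partial derivative of
  \<open>F n\<close> after \<open>g\<close> is \<open>F (Suc n)\<close> after \<open>g\<close> times
  a partial derivative of \<open>g\<close>.\<close>

lemma C_class_compose:
  fixes F :: "nat \<Rightarrow> real \<Rightarrow> real"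
  assumes F: "\<And>n t. (F n has_real_derivative F (Suc n) t) (at t)"
  shows "C_class k g \<Longrightarrow> C_class k (\<lambda>x. F n (g x))"
proof (induction k arbitrary: n g)
  case 0
  have "continuous_on UNIV (F n)"
    using F by (meson DERIV_continuous_on has_field_derivative_at_within)
  with 0 show ?case by (auto intro!: continuous_on_compose2[of UNIV "F n"])
next
  case (Suc k)
  have d: "((\<lambda>x. F n (g x)) has_derivative (\<lambda>h. F (Suc n) (g x) * (grad g x \<bullet> h))) (at x)" for x
    using has_derivative_compose[OF has_derivative_partial F[unfolded has_field_derivative_def], of g x] Suc.prems
    by simp
  have "partial i (\<lambda>x. F n (g x)) = (\<lambda>x. F (Suc n) (g x) * partial i g x)" for i
    using partial_eq[OF d] partial_eq[OF has_derivative_partial, of g] Suc.prems by auto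
  moreover have "C_class k (\<lambda>x. F (Suc n) (g x))"
    using Suc C_class_Suc_imp by blast
  moreover have "(\<lambda>x. F n (g x)) differentiable (at x)" for x
    using d by (auto simp: differentiable_def)
  ultimately show ?case using Suc.prems by (simp add: C_class_mult)
qed

definition smooth :: "('a::euclidean_space \<Rightarrow> real) \<Rightarrow> bool" where
  "smooth f \<longleftrightarrow> (\<forall>k. C_class k f)"

lemma smooth_const [intro]: "smooth (\<lambda>x. c)"
  by (simp add: smooth_def C_class_const)

lemma smooth_add [intro]: "smooth f \<Longrightarrow> smooth g \<Longrightarrow> smooth (\<lambda>x. f x + g x)"
  by (simp add: smooth_def C_class_add)

lemma smooth_mult [intro]: "smooth f \<Longrightarrow> smooth g \<Longrightarrow> smooth (\<lambda>x. f x * g x)"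
  by (simp add: smooth_def C_class_mult)

lemma smooth_diff [intro]: "smooth f \<Longrightarrow> smooth g \<Longrightarrow> smooth (\<lambda>x. f x - g x)"
  using smooth_add[of f "\<lambda>x. (-1) * g x"] smooth_mult[of "\<lambda>x. -1" g] by auto

lemma smooth_sum [intro]: "(\<And>i. i \<in> I \<Longrightarrow> smooth (f i)) \<Longrightarrow> smooth (\<lambda>x. \<Sum>i\<in>I. f i x)"
  by (induction I rule: infinite_finite_induct) auto

lemma smooth_translate: "smooth f \<Longrightarrow> smooth (\<lambda>x. f (x - a))"
  by (simp add: smooth_def C_class_translate)

lemma smooth_differentiable: "smooth f \<Longrightarrow> f differentiable (at x)"
  unfolding smooth_def by (metis C_class.simps(2))

lemma smooth_continuous_on: "smooth f \<Longrightarrow> continuous_on S f"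
  unfolding smooth_def by (meson C_class_continuous continuous_on_subset subset_UNIV)

lemma smooth_partial [intro]: "smooth f \<Longrightarrow> i \<in> Basis \<Longrightarrow> smooth (partial i f)"
  unfolding smooth_def by (metis C_class.simps(2))

lemma smooth_has_derivative: "smooth f \<Longrightarrow> (f has_derivative (\<lambda>h. grad f x \<bullet> h)) (at x)"
  by (simp add: has_derivative_partial smooth_differentiable)

lemma smooth_inner [intro]: "smooth (\<lambda>x. x \<bullet> b)"
  unfolding smooth_def
proof
  fix k
  have d: "((\<lambda>x. x \<bullet> b) has_derivative (\<lambda>h. h \<bullet> b)) (at x)" for x
    by (auto intro!: derivative_eq_intros)
  show "C_class k (\<lambda>x. x \<bullet> b)"
  proof (cases k)
    case (Suc k)
    have "partial i (\<lambda>x. x \<bullet> b) = (\<lambda>x. i \<bullet> b)" for i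
      using partial_eq[OF d] by auto
    with Suc d show ?thesis by (auto simp: C_class_const differentiable_def)
  qed (auto intro!: continuous_intros)
qed

lemma grad_eqI: "(f has_derivative (\<lambda>h. v \<bullet> h)) (at x) \<Longrightarrow> grad f x = v"
  by (simp add: grad_def partial_eq euclidean_representation)

lemma partial_eq_grad: "smooth f \<Longrightarrow> partial i f x = grad f x \<bullet> i"
  using partial_eq[OF smooth_has_derivative] by blast

lemma grad_eq_0_outside:
  assumes "closed K" "\<And>x. x \<notin> K \<Longrightarrow> f x = 0" "x \<notin> K"
  shows "grad f x = 0"
proof (rule grad_eqI, rule has_derivative_transform_within_open)
  show "((\<lambda>x. 0) has_derivative (\<bullet>) 0) (at x)"
    by (simp add: inner_zero_left[abs_def])
  show "open (- K)" using assms(1) by auto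
qed (use assms in auto)

lemma continuous_on_grad: "smooth f \<Longrightarrow> continuous_on S (grad f)"
  unfolding grad_def by (auto intro!: continuous_intros smooth_continuous_on)

lemma smooth_compose:
  fixes F :: "nat \<Rightarrow> real \<Rightarrow> real"
  assumes "\<And>n t. (F n has_real_derivative F (Suc n) t) (at t)" "smooth g"
  shows "smooth (\<lambda>x. F 0 (g x))"
  using C_class_compose[of F _ g 0] assms by (auto simp: smooth_def)

section \<open>Cut-off functions and partitions of unity\<close>

lemma smooth_dist_power2: "smooth (\<lambda>x. (dist x p)\<^sup>2)"
proof -
  have "(\<lambda>x. (dist x p)\<^sup>2) = (\<lambda>x. \<Sum>i\<in>Basis. (x \<bullet> i - p \<bullet> i) * (x \<bullet> i - p \<bullet> i))"
    unfolding dist_norm power2_norm_eq_inner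
    by (subst euclidean_inner) (simp add: inner_diff_left)
  moreover have "smooth (\<lambda>x. \<Sum>i\<in>Basis. (x \<bullet> i - p \<bullet> i) * (x \<bullet> i - p \<bullet> i))"
    by (intro smooth_sum smooth_mult smooth_diff smooth_inner smooth_const)
  ultimately show ?thesis by simp
qed

text \<open>The recursion comes from differentiating p(1/t) exp(-1/t): the result is t^-2 (p -
  p')(1/t) exp(-1/t), and t^-2 is \<open>[:0, 0, 1:]\<close> evaluated at 1/t.\<close>

primrec flat_poly :: "nat \<Rightarrow> real poly" where
  "flat_poly 0 = 1"
| "flat_poly (Suc n) = [:0, 0, 1:] * (flat_poly n - pderiv (flat_poly n))"

text \<open>The \<open>n\<close>-th derivative of \<open>exp (-1/t)\<close>, continued by \<open>0\<close> to \<open>t \<le> 0\<close>.\<close>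

definition flat :: "nat \<Rightarrow> real \<Rightarrow> real" where
  "flat n t = (if 0 < t then poly (flat_poly n) (inverse t) * exp (- inverse t) else 0)"

lemma poly_mult_exp_minus_tendsto_0:
  fixes p :: "real poly"
  shows "((\<lambda>y. poly p y * exp (- y)) \<longlongrightarrow> 0) at_top"
proof -
  have "((\<lambda>y. \<Sum>i\<le>degree p. coeff p i * (y ^ i / exp y)) \<longlongrightarrow> 0) at_top"
    by (intro tendsto_null_sum tendsto_mult_right_zero tendsto_power_div_exp_0)
  then show ?thesis
    by (simp add: poly_altdef exp_minus divide_inverse sum_distrib_right mult.assoc)
qed

text \<open>Away from 0 this is the recursion for \<open>flat_poly\<close>. At 0 the right
  difference quotient is again a polynomial in 1/t times exp(-1/t), and the exponential
  wins.\<close>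

lemma DERIV_flat: "(flat n has_real_derivative flat (Suc n) t) (at t)"
proof -
  consider "t > 0" | "t < 0" | "t = 0" by linarith
  then show ?thesis
  proof cases
    case 1
    have "((\<lambda>t. poly (flat_poly n) (inverse t) * exp (- inverse t)) has_real_derivative flat (Suc n) t) (at t)"
      using 1 unfolding flat_def
      by (auto intro!: derivative_eq_intros simp: algebra_simps power2_eq_square)
    then show ?thesis
      by (rule has_field_derivative_transform_within_open[where S="{0<..}"]) (use 1 in \<open>auto simp: flat_def\<close>)
  next
    case 2
    have "((\<lambda>t. 0) has_real_derivative flat (Suc n) t) (at t)"
      using 2 by (simp add: flat_def)
    then show ?thesis
      by (rule has_field_derivative_transform_within_open[where S="{..<0}"]) (use 2 in \<open>auto simp: flat_def\<close>)
  next
    case 3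
    have "((\<lambda>h. flat n h / h) \<longlongrightarrow> 0) (at 0)"
    proof (rule filterlim_split_at)
      show "((\<lambda>h. flat n h / h) \<longlongrightarrow> 0) (at_left 0)"
        by (rule tendsto_eventually) (auto simp: flat_def eventually_at_filter)
      \<comment> \<open>\<open>pCons 0\<close> multiplies the polynomial by its variable 1/h and so
        accounts for the division by \<open>h\<close>.\<close>
      have "((\<lambda>h. poly (pCons 0 (flat_poly n)) (inverse h) * exp (- inverse h)) \<longlongrightarrow> 0) (at_right 0)"
        by (rule filterlim_compose[OF poly_mult_exp_minus_tendsto_0 filterlim_inverse_at_top_right])
      then show "((\<lambda>h. flat n h / h) \<longlongrightarrow> 0) (at_right 0)"
        by (rule Lim_transform_eventually) (auto simp: flat_def eventually_at_filter field_simps)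
    qed
    with 3 show ?thesis
      by (simp add: has_field_derivative_iff flat_def)
  qed
qed

lemma flat_0_mono: "s \<le> t \<Longrightarrow> flat 0 s \<le> flat 0 t"
  by (auto simp: flat_def le_imp_inverse_le)

lemma flat_0_nonneg: "0 \<le> flat 0 t"
  by (simp add: flat_def)

lemma flat_0_pos: "0 < t \<Longrightarrow> 0 < flat 0 t"
  by (simp add: flat_def)

text \<open>Composing \<open>exp (-1/t)\<close> with \<open>1 - k exp (-1/t)\<close> makes the bump constant near the centre.\<close>

lemma smooth_bump_exists:
  fixes p :: "'a::euclidean_space"
  assumes "0 < r"
  obtains b :: "'a \<Rightarrow> real" where "smooth b" "\<And>x. 0 \<le> b x" "\<And>x. b x \<le> 1"
    "\<And>x. dist x p \<le> r \<Longrightarrow> b x = 1" "\<And>x. 2 * r \<le> dist x p \<Longrightarrow> b x = 0"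
proof
  define g where "g x = (dist x p)\<^sup>2 - r\<^sup>2" for x
  \<comment> \<open>\<open>g\<close> equals \<open>3 * r\<^sup>2\<close> at distance
    \<open>2 * r\<close> from \<open>p\<close>, so with this \<open>k\<close> the argument of the
    outer \<open>flat 0\<close> reaches 0 exactly there. The factor \<open>exp 1\<close> in
    \<open>b\<close> normalises the central value \<open>flat 0 1\<close>.\<close>
  define k where "k = 1 / flat 0 (3 * r\<^sup>2)"
  define b where "b x = exp 1 * flat 0 (1 - k * flat 0 (g x))" for x
  have k: "0 < k" using assms by (simp add: k_def flat_0_pos)
  have "smooth g" unfolding g_def[abs_def] by (intro smooth_diff smooth_dist_power2 smooth_const)
  then have "smooth (\<lambda>x. 1 - k * flat 0 (g x))"
    by (intro smooth_diff smooth_mult smooth_const smooth_compose[of flat] DERIV_flat)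
  then show "smooth b"
    unfolding b_def[abs_def] by (intro smooth_mult smooth_const smooth_compose[of flat] DERIV_flat)
  show "0 \<le> b x" for x by (simp add: b_def flat_0_nonneg)
  have 1: "exp 1 * flat 0 1 = 1" by (simp add: flat_def exp_minus)
  show "b x \<le> 1" for x
  proof -
    have "exp 1 * flat 0 (1 - k * flat 0 (g x)) \<le> exp 1 * flat 0 1"
      using k by (intro mult_left_mono flat_0_mono) (auto simp: flat_0_nonneg)
    with 1 show ?thesis by (simp add: b_def)
  qed
  show "b x = 1" if "dist x p \<le> r" for x
  proof -
    have "g x \<le> 0" using that by (simp add: g_def power_mono)
    then have "flat 0 (g x) = 0" by (simp add: flat_def)
    with 1 show ?thesis by (simp add: b_def)
  qed
  show "b x = 0" if "2 * r \<le> dist x p" for x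
  proof -
    have "(2 * r)\<^sup>2 \<le> (dist x p)\<^sup>2" using that assms by (intro power_mono) auto
    then have "3 * r\<^sup>2 \<le> g x" by (simp add: g_def power_mult_distrib)
    then have "flat 0 (3 * r\<^sup>2) \<le> flat 0 (g x)" by (rule flat_0_mono)
    then have "1 \<le> k * flat 0 (g x)" using assms by (simp add: k_def flat_0_pos)
    then show ?thesis by (simp add: b_def flat_def)
  qed
qed

text \<open>A newly inserted index takes its full bump, and the earlier functions are multiplied by
  one minus that bump; the sums then follow the product formula. There is no division by the sum of
  the bumps, the total never exceeds 1, and it equals 1 wherever some bump does.\<close>

lemma smooth_partition_exists:
  fixes b :: "'i \<Rightarrow> 'a::euclidean_space \<Rightarrow> real"
  assumes "finite I" "\<And>i. i \<in> I \<Longrightarrow> smooth (b i)"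
    and "\<And>i x. i \<in> I \<Longrightarrow> 0 \<le> b i x" "\<And>i x. i \<in> I \<Longrightarrow> b i x \<le> 1"
  shows "\<exists>\<eta>. (\<forall>i\<in>I. smooth (\<eta> i) \<and> (\<forall>x. 0 \<le> \<eta> i x) \<and> (\<forall>x. b i x = 0 \<longrightarrow> \<eta> i x = 0)) \<and>
    (\<forall>x. (\<Sum>i\<in>I. \<eta> i x) = 1 - (\<Prod>i\<in>I. 1 - b i x))"
  using assms
proof (induction I)
  case (insert j I)
  then obtain \<eta> where \<eta>: "\<forall>i\<in>I. smooth (\<eta> i) \<and> (\<forall>x. 0 \<le> \<eta> i x) \<and> (\<forall>x. b i x = 0 \<longrightarrow> \<eta> i x = 0)"
    "\<forall>x. (\<Sum>i\<in>I. \<eta> i x) = 1 - (\<Prod>i\<in>I. 1 - b i x)"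
    by auto
  define \<eta>' where "\<eta>' i = (if i = j then b j else (\<lambda>x. (1 - b j x) * \<eta> i x))" for i
  have "(\<Sum>i\<in>I. \<eta>' i x) = (1 - b j x) * (\<Sum>i\<in>I. \<eta> i x)" for x
    unfolding sum_distrib_left using insert(2) by (intro sum.cong) (auto simp: \<eta>'_def)
  then have "(\<Sum>i\<in>insert j I. \<eta>' i x) = 1 - (\<Prod>i\<in>insert j I. 1 - b i x)" for x
    using insert(1,2) \<eta>(2) by (simp add: algebra_simps) (simp add: \<eta>'_def)
  moreover have "smooth (\<eta>' i) \<and> (\<forall>x. 0 \<le> \<eta>' i x) \<and> (\<forall>x. b i x = 0 \<longrightarrow> \<eta>' i x = 0)" if "i \<in> insert j I" for i
    using that insert.prems \<eta>(1) unfolding \<eta>'_def by (auto intro!: smooth_mult smooth_diff)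
  ultimately show ?case by blast
qed simp

subsection \<open>Test functions\<close>

lemma borel_measurable_smooth: "smooth f \<Longrightarrow> f \<in> borel_measurable borel"
  by (intro borel_measurable_continuous_onI smooth_continuous_on)

lemma borel_measurable_grad: "smooth f \<Longrightarrow> grad f \<in> borel_measurable borel"
  by (intro borel_measurable_continuous_onI continuous_on_grad)

lemma integrable_lborel_compact_support:
  fixes f :: "'a::euclidean_space \<Rightarrow> 'b::{banach, second_countable_topology}"
  assumes "continuous_on UNIV f" "compact K" "\<And>x. x \<notin> K \<Longrightarrow> f x = 0"
  shows "integrable lborel f"
proof -
  have "integrable lborel (\<lambda>x. indicator K x *\<^sub>R f x)"
    by (rule borel_integrable_compact[OF assms(2) continuous_on_subset[OF assms(1)]]) simp
  moreover have "(\<lambda>x. indicator K x *\<^sub>R f x) = f"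
    using assms(3) by (auto simp: indicator_def)
  ultimately show ?thesis by simp
qed

lemma bounded_compact_support:
  fixes f :: "'a::topological_space \<Rightarrow> 'b::real_normed_vector"
  assumes "continuous_on UNIV f" "compact K" "\<And>x. x \<notin> K \<Longrightarrow> f x = 0"
  obtains M where "0 \<le> M" "\<And>x. norm (f x) \<le> M"
proof -
  have "bounded (f ` K)"
    using assms by (meson compact_continuous_image compact_imp_bounded continuous_on_subset subset_UNIV)
  then obtain M where "0 < M" "\<forall>y\<in>f ` K. norm y \<le> M"
    by (metis bounded_pos)
  then have "norm (f x) \<le> M" for x
    using assms(3)[of x] by (cases "x \<in> K") auto
  then show ?thesis using that[of M] \<open>0 < M\<close> by auto
qed

lemma smooth_lipschitz:
  assumes "smooth f" "\<And>x. norm (grad f x) \<le> M"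
  shows "\<bar>f x - f y\<bar> \<le> M * norm (x - y)"
proof -
  have "onorm (\<lambda>h. grad f z \<bullet> h) \<le> M" for z
  proof (rule onorm_le)
    fix h
    have "\<bar>grad f z \<bullet> h\<bar> \<le> norm (grad f z) * norm h" by (rule Cauchy_Schwarz_ineq2)
    also have "\<dots> \<le> M * norm h" by (intro mult_right_mono assms) simp
    finally show "norm (grad f z \<bullet> h) \<le> M * norm h" by simp
  qed
  then have "norm (f x - f y) \<le> M * norm (x - y)"
    by (intro differentiable_bound[of UNIV f "\<lambda>z h. grad f z \<bullet> h"] smooth_has_derivative assms) auto
  then show ?thesis by simp
qed

lemma L2_inner_UNIV:
  assumes "A \<in> sets lebesgue" "\<And>x. x \<notin> A \<Longrightarrow> f x \<bullet> g x = 0"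
  shows "L2_inner A f g = L2_inner UNIV f g"
proof -
  have "indicator A x *\<^sub>R (f x \<bullet> g x) = f x \<bullet> g x" for x
    using assms(2) by (auto simp: indicator_def)
  then show ?thesis
    using assms(1) by (simp add: L2_inner_def integral_restrict_space lebesgue_on_UNIV_eq del: real_scaleR_def)
qed

lemma L2_norm_UNIV:
  assumes "A \<in> sets lebesgue" "\<And>x. x \<notin> A \<Longrightarrow> f x = 0"
  shows "L2_norm A f = L2_norm UNIV f"
  using assms by (simp add: L2_norm_def L2_inner_UNIV)

lemma L2_inner_lborel:
  fixes f g :: "'a::euclidean_space \<Rightarrow> 'b::euclidean_space"
  assumes [measurable]: "f \<in> borel_measurable borel" "g \<in> borel_measurable borel"
  shows "L2_inner UNIV f g = (LINT x|lborel. f x \<bullet> g x)"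
  by (simp add: L2_inner_def lebesgue_on_UNIV_eq integral_completion)

lemma L2_on_compact_support:
  fixes f :: "'a::euclidean_space \<Rightarrow> 'b::euclidean_space"
  assumes "continuous_on UNIV f" "compact K" "\<And>x. x \<notin> K \<Longrightarrow> f x = 0" "A \<in> sets lebesgue"
  shows "L2_on A f"
proof (rule L2_on_subset)
  have "integrable lborel (\<lambda>x. (norm (f x))\<^sup>2)"
    by (rule integrable_lborel_compact_support) (use assms in \<open>auto intro!: continuous_intros\<close>)
  moreover have [measurable]: "f \<in> borel_measurable borel"
    using assms(1) by (rule borel_measurable_continuous_onI)
  ultimately show "L2_on UNIV f"
    by (simp add: L2_on_def lebesgue_on_UNIV_eq integrable_completion measurable_completion)
qed (use assms in auto)

lemma integral_lborel_translate:
  fixes f :: "'a::euclidean_space \<Rightarrow> real"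
  assumes [measurable]: "f \<in> borel_measurable borel"
  shows "(LINT x|lborel. f (x - a)) = (LINT x|lborel. f x)"
proof -
  have "(LINT x|lborel. f x) = (LINT x|distr lborel borel ((+) (- a)). f x)"
    by (simp add: lborel_distr_plus)
  also have "\<dots> = (LINT x|lborel. f (x - a))"
    by (subst integral_distr) auto
  finally show ?thesis ..
qed

lemma nn_integral_lborel_translate:
  fixes f :: "'a::euclidean_space \<Rightarrow> ennreal"
  assumes [measurable]: "f \<in> borel_measurable borel"
  shows "(\<integral>\<^sup>+x. f (x + a) \<partial>lborel) = (\<integral>\<^sup>+x. f x \<partial>lborel)"
proof -
  have "(\<integral>\<^sup>+x. f x \<partial>lborel) = (\<integral>\<^sup>+x. f x \<partial>distr lborel borel ((+) a))"
    by (simp add: lborel_distr_plus)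
  also have "\<dots> = (\<integral>\<^sup>+x. f (x + a) \<partial>lborel)"
    by (subst nn_integral_distr) (auto simp: add.commute)
  finally show ?thesis ..
qed

lemma L2_norm_translate:
  fixes f :: "'a::euclidean_space \<Rightarrow> 'b::euclidean_space"
  assumes [measurable]: "f \<in> borel_measurable borel"
  shows "L2_norm UNIV (\<lambda>x. f (x - a)) = L2_norm UNIV f"
  using integral_lborel_translate[of "\<lambda>x. f x \<bullet> f x" a]
  by (simp add: L2_norm_def L2_inner_lborel)

text \<open>The difference quotients of \<open>f\<close> have integral zero by translation
  invariance; they are uniformly bounded with supports in a fixed ball, so the limit
  \<open>partial i f\<close> inherits this.\<close>

lemma integral_partial_eq_0:
  fixes f :: "'a::euclidean_space \<Rightarrow> real"
  assumes f: "smooth f" and K: "compact K" "\<And>x. x \<notin> K \<Longrightarrow> f x = 0" and i: "i \<in> Basis"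
  shows "(LINT x|lborel. partial i f x) = 0"
proof -
  have [measurable]: "f \<in> borel_measurable borel" using f by (rule borel_measurable_smooth)
  have intf: "integrable lborel f"
    by (rule integrable_lborel_compact_support[OF smooth_continuous_on[OF f] K])
  obtain M where M: "0 \<le> M" "\<And>x. norm (grad f x) \<le> M"
    using bounded_compact_support[OF continuous_on_grad[OF f] K(1)] grad_eq_0_outside[of K f] K
    by (metis compact_imp_closed)
  obtain B where B: "K \<subseteq> ball 0 B"
    using K(1) by (meson bounded_subset_ballD compact_imp_bounded)
  define t where "t n = 1 / real (Suc n)" for n
  \<comment> \<open>The shift is written as subtraction of \<open>(- t n) *\<^sub>R i\<close> to fit
    the translation lemmas, which are stated for \<open>x - a\<close>.\<close>
  define s where "s n x = (f (x - (- t n) *\<^sub>R i) - f x) / t n" for n x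
  have t: "0 < t n" "t n \<le> 1" for n by (auto simp: t_def)
  have "(\<lambda>n. LINT x|lborel. s n x) \<longlonglongrightarrow> (LINT x|lborel. partial i f x)"
  proof (rule integral_dominated_convergence)
    show "partial i f \<in> borel_measurable lborel"
      using borel_measurable_smooth[OF smooth_partial[OF f i]] by simp
    show "s n \<in> borel_measurable lborel" for n unfolding s_def by measurable
    \<comment> \<open>\<open>M\<close> is a Lipschitz constant of \<open>f\<close>, and
      \<open>t n\<close> is at most 1, so every quotient vanishes outside the ball of radius
      \<open>B + 1\<close>.\<close>
    show "integrable lborel (\<lambda>x. indicator (cball (0::'a) (B + 1)) x *\<^sub>R M)"
      by (rule borel_integrable_compact) auto
    show "AE x in lborel. (\<lambda>n. s n x) \<longlonglongrightarrow> partial i f x"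
    proof (rule always_eventually, rule allI)
      fix x
      have 1: "((\<lambda>\<tau>. x + \<tau> *\<^sub>R i) has_derivative (\<lambda>\<tau>. \<tau> *\<^sub>R i)) (at 0)"
        by (auto intro!: derivative_eq_intros)
      have "(f has_derivative (\<lambda>h. grad f x \<bullet> h)) (at (x + 0 *\<^sub>R i))"
        using smooth_has_derivative[OF f] by simp
      from has_derivative_compose[OF 1 this]
      have "((\<lambda>\<tau>. f (x + \<tau> *\<^sub>R i)) has_real_derivative partial i f x) (at 0)"
        by (simp add: has_field_derivative_def partial_eq_grad[OF f] mult_commute_abs)
      then have "((\<lambda>\<tau>. (f (x + \<tau> *\<^sub>R i) - f x) / \<tau>) \<longlongrightarrow> partial i f x) (at 0)"
        by (simp add: DERIV_def)
      moreover have "filterlim t (at 0) sequentially"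
        unfolding filterlim_at using t(1) LIMSEQ_inverse_real_of_nat
        by (auto simp: t_def[abs_def] less_imp_neq[symmetric] inverse_eq_divide)
      ultimately show "(\<lambda>n. s n x) \<longlonglongrightarrow> partial i f x"
        unfolding s_def by (auto dest: filterlim_compose)
    qed
    show "AE x in lborel. norm (s n x) \<le> indicator (cball (0::'a) (B + 1)) x *\<^sub>R M" for n
    proof (rule always_eventually, rule allI)
      fix x
      have "\<bar>f (x - (- t n) *\<^sub>R i) - f x\<bar> \<le> M * t n"
        using smooth_lipschitz[OF f M(2), of "x - (- t n) *\<^sub>R i" x] t(1)[of n] i by simp
      then have *: "norm (s n x) \<le> M"
        using t(1)[of n] by (simp add: s_def field_simps)
      show "norm (s n x) \<le> indicator (cball (0::'a) (B + 1)) x *\<^sub>R M"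
      proof (cases "x \<in> cball 0 (B + 1)")
        case False
        have "x \<notin> K" using False B by auto
        moreover have "x - (- t n) *\<^sub>R i \<notin> K"
        proof
          assume "x - (- t n) *\<^sub>R i \<in> K"
          then have "norm (x + t n *\<^sub>R i) < B" using B by auto
          moreover have "norm x \<le> norm (x + t n *\<^sub>R i) + norm (t n *\<^sub>R i)"
            using norm_triangle_ineq4[of "x + t n *\<^sub>R i" "t n *\<^sub>R i"] by simp
          ultimately show False using False t[of n] i by simp
        qed
        ultimately have "s n x = 0" using K(2) by (simp add: s_def del: scaleR_minus_left)
        then show ?thesis using M by (simp add: indicator_def)
      qed (use * in simp)
    qed
  qed
  moreover have "(LINT x|lborel. s n x) = 0" for n
  proof -
    have "integrable lborel (\<lambda>x. f (x - (- t n) *\<^sub>R i))"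
    proof (rule integrable_lborel_compact_support)
      show "compact ((\<lambda>x. x + (- t n) *\<^sub>R i) ` K)"
        using K(1) by (intro compact_continuous_image continuous_intros)
      show "continuous_on UNIV (\<lambda>x. f (x - (- t n) *\<^sub>R i))"
        by (rule smooth_continuous_on[OF smooth_translate[OF f]])
      show "f (x - (- t n) *\<^sub>R i) = 0" if "x \<notin> (\<lambda>x. x + (- t n) *\<^sub>R i) ` K" for x
        using that K(2)[of "x - (- t n) *\<^sub>R i"] by force
    qed
    then show ?thesis
      unfolding s_def using intf integral_lborel_translate[of f "(- t n) *\<^sub>R i"]
      by (simp del: scaleR_minus_left)
  qed
  ultimately show ?thesis by (simp add: LIMSEQ_const_iff)
qed

lemma test_functionE:
  assumes "test_function A f"
  obtains K where "smooth f" "compact K" "K \<subseteq> A" "\<And>x. x \<notin> K \<Longrightarrow> f x = 0" "\<And>x. x \<notin> K \<Longrightarrow> grad f x = 0"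
proof -
  obtain K where K: "compact K" "K \<subseteq> A" "\<And>x. x \<notin> K \<Longrightarrow> f x = 0"
    using assms unfolding test_function_def by blast
  then have "\<And>x. x \<notin> K \<Longrightarrow> grad f x = 0"
    using grad_eq_0_outside[of K f] compact_imp_closed by blast
  then show ?thesis using that K assms by (auto simp: test_function_def smooth_def)
qed

lemma test_function_smooth: "test_function A f \<Longrightarrow> smooth f"
  by (simp add: test_function_def smooth_def)

lemma test_function_mono: "test_function A f \<Longrightarrow> A \<subseteq> B \<Longrightarrow> test_function B f"
  unfolding test_function_def by blast

lemma test_function_outside:
  assumes "test_function A f" "x \<notin> A"
  shows "f x = 0" "grad f x = 0"
proof -
  obtain K where K: "smooth f" "compact K" "K \<subseteq> A"
      "\<And>x. x \<notin> K \<Longrightarrow> f x = 0" "\<And>x. x \<notin> K \<Longrightarrow> grad f x = 0"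
    by (rule test_functionE[OF assms(1)]) (rule that)
  have "x \<notin> K" using K(3) assms(2) by blast
  then show "f x = 0" "grad f x = 0" using K(4,5) by auto
qed

lemma test_function_L2_on:
  assumes "test_function A f" "B \<in> sets lebesgue"
  shows "L2_on B f" "L2_on B (grad f)"
proof -
  obtain K where K: "smooth f" "compact K" "K \<subseteq> A"
      "\<And>x. x \<notin> K \<Longrightarrow> f x = 0" "\<And>x. x \<notin> K \<Longrightarrow> grad f x = 0"
    by (rule test_functionE[OF assms(1)]) (rule that)
  show "L2_on B f"
    by (rule L2_on_compact_support[OF smooth_continuous_on[OF K(1)] K(2,4) assms(2)])
  show "L2_on B (grad f)"
    by (rule L2_on_compact_support[OF continuous_on_grad[OF K(1)] K(2,5) assms(2)])
qed

lemma test_function_partial: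
  assumes "test_function A f" "i \<in> Basis"
  shows "test_function A (partial i f)"
proof -
  obtain K where K: "smooth f" "compact K" "K \<subseteq> A" "\<And>x. x \<notin> K \<Longrightarrow> grad f x = 0"
    using test_functionE[OF assms(1)] by metis
  then have "\<And>x. x \<notin> K \<Longrightarrow> partial i f x = 0" by (simp add: partial_eq_grad)
  moreover have "smooth (partial i f)" using K(1) assms(2) by blast
  ultimately show ?thesis using K unfolding test_function_def smooth_def by blast
qed

lemma test_function_lincomb:
  assumes "\<And>j. j \<in> I \<Longrightarrow> test_function A (f j)"
  shows "test_function A (\<lambda>x. \<Sum>j\<in>I. a j * f j x)"
    and "grad (\<lambda>x. \<Sum>j\<in>I. a j * f j x) = (\<lambda>x. \<Sum>j\<in>I. a j *\<^sub>R grad (f j) x)"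
proof -
  have s: "smooth (f j)" if "j \<in> I" for j by (rule test_function_smooth[OF assms[OF that]])
  show "test_function A (\<lambda>x. \<Sum>j\<in>I. a j * f j x)"
  proof (cases "finite I")
    case True
    obtain K where K: "\<And>j. j \<in> I \<Longrightarrow> compact (K j) \<and> K j \<subseteq> A \<and> (\<forall>x. x \<notin> K j \<longrightarrow> f j x = 0)"
      using assms unfolding test_function_def by metis
    have "smooth (\<lambda>x. \<Sum>j\<in>I. a j * f j x)"
      by (intro smooth_sum smooth_mult smooth_const s)
    moreover have "compact (\<Union>j\<in>I. K j)" using True K by auto
    moreover have "(\<Union>j\<in>I. K j) \<subseteq> A" using K by blast
    moreover have "x \<notin> (\<Union>j\<in>I. K j) \<longrightarrow> (\<Sum>j\<in>I. a j * f j x) = 0" for x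
      using K by (auto intro!: sum.neutral)
    ultimately show ?thesis unfolding test_function_def smooth_def by blast
  next
    case False
    then show ?thesis
      using smooth_const[of 0] by (auto simp: test_function_def smooth_def intro!: exI[of _ "{}"])
  qed
  show "grad (\<lambda>x. \<Sum>j\<in>I. a j * f j x) = (\<lambda>x. \<Sum>j\<in>I. a j *\<^sub>R grad (f j) x)"
  proof
    fix x
    have "((\<lambda>x. \<Sum>j\<in>I. a j * f j x) has_derivative (\<lambda>h. \<Sum>j\<in>I. a j * (grad (f j) x \<bullet> h))) (at x)"
      by (intro has_derivative_sum has_derivative_mult_right smooth_has_derivative s)
    then show "grad (\<lambda>x. \<Sum>j\<in>I. a j * f j x) x = (\<Sum>j\<in>I. a j *\<^sub>R grad (f j) x)"
      by (intro grad_eqI) (simp add: inner_sum_left)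
  qed
qed

lemma partial_mult:
  assumes "smooth f" "smooth g"
  shows "partial i (\<lambda>x. f x * g x) = (\<lambda>x. f x * partial i g x + partial i f x * g x)"
proof
  fix x
  note d = assms[THEN smooth_has_derivative]
  show "partial i (\<lambda>x. f x * g x) x = f x * partial i g x + partial i f x * g x"
    using partial_eq[OF has_derivative_mult[OF d], of i] assms by (simp add: partial_eq_grad)
qed

text \<open>Compact support of \<open>g\<close> alone makes the product compactly supported, so its
  derivative integrates to zero.\<close>

lemma integral_by_parts_partial:
  assumes f: "smooth f" and g: "test_function A g" and i: "i \<in> Basis"
  shows "(LINT x|lborel. f x * partial i g x) = - (LINT x|lborel. partial i f x * g x)"
proof -
  obtain K where K: "smooth g" "compact K" "\<And>x. x \<notin> K \<Longrightarrow> g x = 0" "\<And>x. x \<notin> K \<Longrightarrow> grad g x = 0"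
    using test_functionE[OF g] by metis
  have "(LINT x|lborel. partial i (\<lambda>x. f x * g x) x) = 0"
    by (rule integral_partial_eq_0[OF _ K(2) _ i]) (use f K in auto)
  moreover have "integrable lborel (\<lambda>x. f x * partial i g x)"
    by (rule integrable_lborel_compact_support[OF smooth_continuous_on[OF smooth_mult[OF f smooth_partial[OF K(1) i]]] K(2)])
       (simp add: partial_eq_grad K)
  moreover have "integrable lborel (\<lambda>x. partial i f x * g x)"
    by (rule integrable_lborel_compact_support[OF smooth_continuous_on[OF smooth_mult[OF smooth_partial[OF f i] K(1)]] K(2)])
       (simp add: K)
  ultimately show ?thesis by (simp add: partial_mult[OF f K(1)])
qed

lemma test_function_has_weak_gradient:
  assumes "open A" and f: "test_function A f"
  shows "has_weak_gradient A f (grad f)"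
proof -
  have A: "A \<in> sets lebesgue" using assms(1) by simp
  have "L2_inner A f (partial i \<psi>) = - L2_inner A (\<lambda>x. grad f x \<bullet> i) \<psi>"
    if \<psi>: "test_function A \<psi>" and i: "i \<in> Basis" for \<psi> i
  proof -
    have [measurable]: "f \<in> borel_measurable borel" "\<psi> \<in> borel_measurable borel"
      "partial i f \<in> borel_measurable borel" "partial i \<psi> \<in> borel_measurable borel"
      using f \<psi> i test_function_partial test_function_smooth borel_measurable_smooth by blast+
    have "(\<lambda>x. grad f x \<bullet> i) = partial i f"
      using partial_eq_grad[OF test_function_smooth[OF f]] by auto
    moreover have "L2_inner A f (partial i \<psi>) = (LINT x|lborel. f x * partial i \<psi> x)"
      using L2_inner_UNIV[OF A, of f "partial i \<psi>"] test_function_outside(1)[OF f]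
      by (simp add: L2_inner_lborel)
    moreover have "L2_inner A (partial i f) \<psi> = (LINT x|lborel. partial i f x * \<psi> x)"
      using L2_inner_UNIV[OF A, of "partial i f" \<psi>] test_function_outside(1)[OF \<psi>]
      by (simp add: L2_inner_lborel)
    ultimately show ?thesis
      using integral_by_parts_partial[OF test_function_smooth[OF f] \<psi> i] by simp
  qed
  then show ?thesis
    using test_function_L2_on[OF f A] by (simp add: has_weak_gradient_def)
qed

lemma test_function_in_H10:
  assumes "open A" "test_function A f"
  shows "f \<in> H10 A"
proof -
  show ?thesis
    using test_function_has_weak_gradient[OF assms] assms(2) unfolding H10_def
    by (intro CollectI exI[of _ "grad f"] conjI exI[of _ "\<lambda>k. f"]) (auto simp: L2_converges_def)
qed

text \<open>Cauchy-Schwarz on the unit interval in the form of a nonnegative variance: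
  \<open>m\<close> is the mean of \<open>g'\<close>, and expanding the integral of
  \<open>(g' t - m)\<^sup>2\<close> gives the bound.\<close>

lemma power2_FTC_le:
  fixes g :: "real \<Rightarrow> real"
  assumes "\<And>t. (g has_real_derivative g' t) (at t)" "continuous_on UNIV g'"
  shows "ennreal ((g 1 - g 0)\<^sup>2) \<le> (\<integral>\<^sup>+t. ennreal ((g' t)\<^sup>2) * indicator {0..1} t \<partial>lborel)"
proof -
  have c: "isCont g' t" for t using assms(2) by (simp add: continuous_on_eq_continuous_at)
  define m where "m = g 1 - g 0"
  have h: "has_bochner_integral lborel (\<lambda>t. g' t * indicator {0..1} t) m"
    unfolding m_def by (rule has_bochner_integral_FTC_Icc_real) (use assms c in auto)
  have i2: "integrable lborel (\<lambda>t. (g' t)\<^sup>2 * indicator {0..1} t)"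
    using borel_integrable_compact[of "{0..1}" "\<lambda>t. (g' t)\<^sup>2"] assms(2)
    by (auto intro!: continuous_intros continuous_on_subset[OF assms(2)] simp: mult.commute)
  have i0: "has_bochner_integral lborel (indicator {0..1::real} :: real \<Rightarrow> real) 1"
    using has_bochner_integral_real_indicator[of "{0..1::real}" lborel] by simp
  have "0 \<le> (LINT t|lborel. (g' t - m)\<^sup>2 * indicator {0..1} t)"
    by (rule Bochner_Integration.integral_nonneg) auto
  also have "\<dots> = (LINT t|lborel. (g' t)\<^sup>2 * indicator {0..1} t - (2 * m) * (g' t * indicator {0..1} t) + m\<^sup>2 * indicator {0..1} t)"
    by (rule Bochner_Integration.integral_cong) (auto simp: algebra_simps power2_eq_square)
  also have "\<dots> = (LINT t|lborel. (g' t)\<^sup>2 * indicator {0..1} t) - (2 * m) * m + m\<^sup>2 * 1"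
    using h i2 i0 by (simp add: has_bochner_integral_iff)
  finally have "m\<^sup>2 \<le> (LINT t|lborel. (g' t)\<^sup>2 * indicator {0..1} t)"
    by (simp add: power2_eq_square)
  then have "ennreal (m\<^sup>2) \<le> ennreal (LINT t|lborel. (g' t)\<^sup>2 * indicator {0..1} t)"
    by (rule ennreal_leI)
  also have "\<dots> = (\<integral>\<^sup>+t. ennreal ((g' t)\<^sup>2 * indicator {0..1} t) \<partial>lborel)"
    by (rule nn_integral_eq_integral[symmetric, OF i2]) auto
  also have "\<dots> = (\<integral>\<^sup>+t. ennreal ((g' t)\<^sup>2) * indicator {0..1} t \<partial>lborel)"
    by (intro nn_integral_cong) (auto simp: indicator_def)
  finally show ?thesis by (simp add: m_def)
qed

lemma ennreal_L2_norm_power2: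
  fixes f :: "'a::euclidean_space \<Rightarrow> 'b::euclidean_space"
  assumes "L2_on A f"
  shows "ennreal ((L2_norm A f)\<^sup>2) = (\<integral>\<^sup>+x. ennreal ((norm (f x))\<^sup>2) \<partial>lebesgue_on A)"
  using assms unfolding L2_norm_power2 L2_inner_self L2_on_def
  by (subst nn_integral_eq_integral) auto

text \<open>The difference is integrated along the segment from \<open>x\<close> to
  \<open>x - a\<close>; after exchanging the integrals, each point of the segment contributes the
  same amount by translation invariance. The estimate serves both the inward shifts and the
  Gagliardo seminorm.\<close>

lemma test_function_translate_L2:
  assumes \<psi>: "test_function A \<psi>"
  shows "L2_norm UNIV (\<lambda>x. \<psi> (x - a) - \<psi> x) \<le> norm a * L2_norm UNIV (grad \<psi>)"
proof -
  obtain K where K: "smooth \<psi>" "compact K" "\<And>x. x \<notin> K \<Longrightarrow> \<psi> x = 0"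
    using test_functionE[OF \<psi>] by metis
  have [measurable]: "\<psi> \<in> borel_measurable borel" "grad \<psi> \<in> borel_measurable borel"
    using K(1) borel_measurable_smooth borel_measurable_grad by auto
  define G where "G x = (grad \<psi> x \<bullet> a)\<^sup>2" for x
  have [measurable]: "G \<in> borel_measurable borel" unfolding G_def by measurable
  have FTC: "ennreal ((norm (\<psi> (x - a) - \<psi> x))\<^sup>2) \<le> (\<integral>\<^sup>+t. ennreal (G (x + (- t) *\<^sub>R a)) * indicator {0..1} t \<partial>lborel)" for x
  proof -
    have "((\<lambda>t. \<psi> (x + (- t) *\<^sub>R a)) has_real_derivative - (grad \<psi> (x + (- t) *\<^sub>R a) \<bullet> a)) (at t)" for t
    proof -
      have 1: "((\<lambda>t. x + (- t) *\<^sub>R a) has_derivative (\<lambda>h. (- h) *\<^sub>R a)) (at t)"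
        by (auto intro!: derivative_eq_intros)
      from has_derivative_compose[OF 1 smooth_has_derivative[OF K(1)]]
      moreover have "(\<lambda>h. grad \<psi> (x + (- t) *\<^sub>R a) \<bullet> ((- h) *\<^sub>R a)) = (*) (- (grad \<psi> (x + (- t) *\<^sub>R a) \<bullet> a))"
        by auto
      ultimately show ?thesis unfolding has_field_derivative_def by simp
    qed
    moreover have "continuous_on UNIV (\<lambda>t. - (grad \<psi> (x + (- t) *\<^sub>R a) \<bullet> a))"
      by (intro continuous_intros continuous_on_compose2[OF continuous_on_grad[OF K(1), of UNIV]]) auto
    ultimately show ?thesis
      using power2_FTC_le[of "\<lambda>t. \<psi> (x + (- t) *\<^sub>R a)" "\<lambda>t. - (grad \<psi> (x + (- t) *\<^sub>R a) \<bullet> a)"]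
      by (simp add: G_def)
  qed
  have t1: "L2_on UNIV (\<lambda>x. \<psi> (x - a))"
  proof (rule L2_on_compact_support)
    show "compact ((\<lambda>x. x + a) ` K)"
      using K(2) by (intro compact_continuous_image continuous_intros)
    show "continuous_on UNIV (\<lambda>x. \<psi> (x - a))"
      by (rule smooth_continuous_on[OF smooth_translate[OF K(1)]])
    show "\<psi> (x - a) = 0" if "x \<notin> (\<lambda>x. x + a) ` K" for x
      using that K(3)[of "x - a"] by force
  qed simp
  have t2: "L2_on UNIV (\<lambda>x. \<psi> (x - a) - \<psi> x)"
    using t1 test_function_L2_on(1)[OF \<psi>] by auto
  have "ennreal ((L2_norm UNIV (\<lambda>x. \<psi> (x - a) - \<psi> x))\<^sup>2) = (\<integral>\<^sup>+x. ennreal ((norm (\<psi> (x - a) - \<psi> x))\<^sup>2) \<partial>lborel)"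
    by (simp add: ennreal_L2_norm_power2[OF t2] lebesgue_on_UNIV_eq nn_integral_completion)
  also have "\<dots> \<le> (\<integral>\<^sup>+x. (\<integral>\<^sup>+t. ennreal (G (x + (- t) *\<^sub>R a)) * indicator {0..1} t \<partial>lborel) \<partial>lborel)"
    by (intro nn_integral_mono FTC)
  also have "\<dots> = (\<integral>\<^sup>+t. (\<integral>\<^sup>+x. ennreal (G (x + (- t) *\<^sub>R a)) * indicator {0..1} t \<partial>lborel) \<partial>lborel)"
    by (rule lborel_pair.Fubini'[symmetric]) measurable
  also have "\<dots> = (\<integral>\<^sup>+t. (\<integral>\<^sup>+x. ennreal (G x) \<partial>lborel) * indicator {0..1} (t::real) \<partial>lborel)"
    using nn_integral_lborel_translate[of "\<lambda>x. ennreal (G x)" "(- t) *\<^sub>R a" for t]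
    by (simp add: nn_integral_multc)
  also have "\<dots> = (\<integral>\<^sup>+x. ennreal (G x) \<partial>lborel)"
    by (simp add: nn_integral_cmult)
  also have "\<dots> \<le> (\<integral>\<^sup>+x. ennreal ((norm a)\<^sup>2) * ennreal ((norm (grad \<psi> x))\<^sup>2) \<partial>lborel)"
  proof (rule nn_integral_mono)
    fix x
    have "G x \<le> (norm a)\<^sup>2 * (norm (grad \<psi> x))\<^sup>2"
      unfolding G_def using Cauchy_Schwarz_ineq2[of "grad \<psi> x" a]
      by (metis abs_ge_zero mult.commute power2_abs power_mono power_mult_distrib)
    then show "ennreal (G x) \<le> ennreal ((norm a)\<^sup>2) * ennreal ((norm (grad \<psi> x))\<^sup>2)"
      by (simp add: ennreal_leI flip: ennreal_mult)
  qed
  also have "\<dots> = ennreal ((norm a)\<^sup>2) * ennreal ((L2_norm UNIV (grad \<psi>))\<^sup>2)"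
    using test_function_L2_on(2)[OF \<psi>, of UNIV]
    by (simp add: nn_integral_cmult ennreal_L2_norm_power2 lebesgue_on_UNIV_eq nn_integral_completion)
  finally have "(L2_norm UNIV (\<lambda>x. \<psi> (x - a) - \<psi> x))\<^sup>2 \<le> (norm a * L2_norm UNIV (grad \<psi>))\<^sup>2"
    by (simp add: power_mult_distrib flip: ennreal_mult)
  then show ?thesis by (rule power2_le_imp_le) simp
qed

subsection \<open>The Dirichlet eigensystem and the K-functional\<close>

text \<open>
  Uniqueness of weak gradients is not needed: against \<open>grad \<eta>\<close>, every weak gradient of \<open>\<phi> j\<close> gives
  \<open>- \<langle>\<phi> j, \<Delta>\<eta>\<rangle>\<close>, so the one approximated by test functions may replace the one in the eigenvalue equation.
\<close>

lemma dirichlet_eigensystem_gradients: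
  assumes A: "open A" and eig: "dirichlet_eigensystem A lam \<phi>"
  obtains G \<psi> where "\<And>j. L2_on A (G j)" "\<And>j k. test_function A (\<psi> j k)"
    "\<And>j. L2_converges A (\<psi> j) (\<phi> j)" "\<And>j. L2_converges A (\<lambda>k. grad (\<psi> j k)) (G j)"
    "\<And>j \<eta>. test_function A \<eta> \<Longrightarrow> L2_inner A (G j) (grad \<eta>) = lam j * L2_inner A (\<phi> j) \<eta>"
proof -
  have meas: "A \<in> sets lebesgue" using A by simp
  have "\<exists>G \<psi>. L2_on A G \<and> (\<forall>k. test_function A (\<psi> k)) \<and> L2_converges A \<psi> (\<phi> j) \<and>
    L2_converges A (\<lambda>k. grad (\<psi> k)) G \<and>
    (\<forall>\<eta>. test_function A \<eta> \<longrightarrow> L2_inner A G (grad \<eta>) = lam j * L2_inner A (\<phi> j) \<eta>)" for j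
  proof -
    have d: "dirichlet_laplacian A (\<phi> j) (\<lambda>x. lam j * \<phi> j x)"
      using eig by (simp add: dirichlet_eigensystem_def)
    obtain g where g: "has_weak_gradient A (\<phi> j) g"
      "\<And>v w. v \<in> H10 A \<Longrightarrow> has_weak_gradient A v w \<Longrightarrow> L2_inner A g w = L2_inner A (\<lambda>x. lam j * \<phi> j x) v"
      using d unfolding dirichlet_laplacian_def by blast
    obtain G \<psi> where G: "has_weak_gradient A (\<phi> j) G" "\<forall>k. test_function A (\<psi> k)"
      "L2_converges A \<psi> (\<phi> j)" "L2_converges A (\<lambda>k. grad (\<psi> k)) G"
      using d unfolding dirichlet_laplacian_def H10_def by blast
    have "L2_inner A G (grad \<eta>) = lam j * L2_inner A (\<phi> j) \<eta>" if \<eta>: "test_function A \<eta>" for \<eta>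
    proof -
      have split: "L2_inner A f (grad \<eta>) = (\<Sum>i\<in>Basis. L2_inner A (\<lambda>x. f x \<bullet> i) (partial i \<eta>))"
        if "L2_on A f" for f :: "'a \<Rightarrow> 'a"
      proof -
        have "L2_inner A f (grad \<eta>) = (LINT x|lebesgue_on A. (\<Sum>i\<in>Basis. (f x \<bullet> i) \<bullet> partial i \<eta> x))"
          unfolding L2_inner_def
          by (intro Bochner_Integration.integral_cong) (auto simp: grad_def inner_sum_right ac_simps)
        also have "\<dots> = (\<Sum>i\<in>Basis. L2_inner A (\<lambda>x. f x \<bullet> i) (partial i \<eta>))"
          unfolding L2_inner_def
          by (intro Bochner_Integration.integral_sum integrable_L2_inner L2_on_inner that
              test_function_L2_on(1)[OF test_function_partial[OF \<eta>] meas])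
        finally show ?thesis .
      qed
      have *: "L2_inner A (\<lambda>x. f x \<bullet> i) (partial i \<eta>) = - L2_inner A (\<phi> j) (partial i (partial i \<eta>))"
        if "has_weak_gradient A (\<phi> j) f" "i \<in> Basis" for f i
        using that test_function_partial[OF \<eta> that(2)] unfolding has_weak_gradient_def by simp
      have "L2_inner A G (grad \<eta>) = L2_inner A g (grad \<eta>)"
        using g(1) G(1) by (simp add: split * has_weak_gradient_def[of A _ g] has_weak_gradient_def[of A _ G])
      also have "\<dots> = L2_inner A (\<lambda>x. lam j * \<phi> j x) \<eta>"
        by (rule g(2)[OF test_function_in_H10[OF A \<eta>] test_function_has_weak_gradient[OF A \<eta>]])
      finally show ?thesis by (simp add: L2_inner_cmult_left)
    qed
    moreover have "L2_on A G" using G(1) by (simp add: has_weak_gradient_def)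
    ultimately show ?thesis using G by blast
  qed
  then have "\<forall>j. \<exists>G \<psi>. L2_on A G \<and> (\<forall>k. test_function A (\<psi> k)) \<and> L2_converges A \<psi> (\<phi> j) \<and>
    L2_converges A (\<lambda>k. grad (\<psi> k)) G \<and>
    (\<forall>\<eta>. test_function A \<eta> \<longrightarrow> L2_inner A G (grad \<eta>) = lam j * L2_inner A (\<phi> j) \<eta>)" ..
  from choice[OF this] obtain G where "\<forall>j. \<exists>\<psi>. L2_on A (G j) \<and> (\<forall>k. test_function A (\<psi> k)) \<and> L2_converges A \<psi> (\<phi> j) \<and>
    L2_converges A (\<lambda>k. grad (\<psi> k)) (G j) \<and>
    (\<forall>\<eta>. test_function A \<eta> \<longrightarrow> L2_inner A (G j) (grad \<eta>) = lam j * L2_inner A (\<phi> j) \<eta>)" ..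
  from choice[OF this] obtain \<psi> where "\<forall>j. L2_on A (G j) \<and> (\<forall>k. test_function A (\<psi> j k)) \<and> L2_converges A (\<psi> j) (\<phi> j) \<and>
    L2_converges A (\<lambda>k. grad (\<psi> j k)) (G j) \<and>
    (\<forall>\<eta>. test_function A \<eta> \<longrightarrow> L2_inner A (G j) (grad \<eta>) = lam j * L2_inner A (\<phi> j) \<eta>)" ..
  then show ?thesis by (intro that[of G \<psi>]) auto
qed

lemma dirichlet_eigensystemD:
  assumes "dirichlet_eigensystem A lam \<phi>"
  shows "L2_on A (\<phi> j)" "L2_inner A (\<phi> i) (\<phi> j) = (if i = j then 1 else 0)"
    "L2_on A u \<Longrightarrow> L2_converges A (\<lambda>N x. \<Sum>j<N. L2_inner A u (\<phi> j) * \<phi> j x) u"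
  using assms unfolding dirichlet_eigensystem_def L2_orthonormal_basis_def by blast+

text \<open>The weak equation for \<open>G i\<close> is available only against gradients of test
  functions, so it is applied to \<open>\<psi> j k\<close> and passed to the limit in
  \<open>k\<close>.\<close>

lemma gradient_orthogonality:
  assumes A: "open A" and eig: "dirichlet_eigensystem A lam \<phi>"
    and G: "\<And>j. L2_on A (G j)" "\<And>j k. test_function A (\<psi> j k)"
    "\<And>j. L2_converges A (\<psi> j) (\<phi> j)" "\<And>j. L2_converges A (\<lambda>k. grad (\<psi> j k)) (G j)"
    "\<And>j \<eta>. test_function A \<eta> \<Longrightarrow> L2_inner A (G j) (grad \<eta>) = lam j * L2_inner A (\<phi> j) \<eta>"
  shows "L2_inner A (G i) (G j) = (if i = j then lam i else 0)"
proof -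
  have meas: "A \<in> sets lebesgue" using A by simp
  note L2 = test_function_L2_on[OF G(2) meas] dirichlet_eigensystemD(1)[OF eig] G(1)
  have "(\<lambda>k. L2_inner A (grad (\<psi> j k)) (G i)) \<longlonglongrightarrow> L2_inner A (G j) (G i)"
    by (rule L2_converges_inner[OF G(4)]) (use L2 in auto)
  moreover have "L2_inner A (grad (\<psi> j k)) (G i) = lam i * L2_inner A (\<psi> j k) (\<phi> i)" for k
    using G(5)[OF G(2), of i j k] by (simp add: L2_inner_commute)
  moreover have "(\<lambda>k. lam i * L2_inner A (\<psi> j k) (\<phi> i)) \<longlonglongrightarrow> lam i * L2_inner A (\<phi> j) (\<phi> i)"
    by (intro tendsto_mult_left L2_converges_inner[OF G(3)]) (use L2 in auto)
  ultimately have "L2_inner A (G j) (G i) = lam i * L2_inner A (\<phi> j) (\<phi> i)"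
    using LIMSEQ_unique by fastforce
  then show ?thesis
    by (simp add: L2_inner_commute[of A "G i"] dirichlet_eigensystemD(2)[OF eig])
qed

text \<open>On the diagonal, \<open>lam j\<close> is the squared norm of the gradient of
  \<open>\<phi> j\<close>.\<close>

lemma eigenvalue_nonneg:
  assumes A: "open A" and eig: "dirichlet_eigensystem A lam \<phi>"
  shows "0 \<le> lam j"
proof -
  obtain G \<psi> where G: "\<And>j. L2_on A (G j)" "\<And>j k. test_function A (\<psi> j k)"
    "\<And>j. L2_converges A (\<psi> j) (\<phi> j)" "\<And>j. L2_converges A (\<lambda>k. grad (\<psi> j k)) (G j)"
    "\<And>j \<eta>. test_function A \<eta> \<Longrightarrow> L2_inner A (G j) (grad \<eta>) = lam j * L2_inner A (\<phi> j) \<eta>"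
    by (rule dirichlet_eigensystem_gradients[OF A eig]) (rule that)
  show ?thesis
    using gradient_orthogonality[OF A eig G, of j j] L2_inner_self_nonneg[of A "G j"] by simp
qed

text \<open>The weights \<open>\<mu>\<close> let one formula serve two orthogonal systems: the
  eigenfunctions with weight 1 and their gradients with weights \<open>lam j\<close>. With Fourier
  coefficients for \<open>a\<close> it yields Bessel's inequality.\<close>

lemma L2_norm_diff_orthogonal_sum:
  fixes e :: "nat \<Rightarrow> 'a::euclidean_space \<Rightarrow> 'b::euclidean_space"
  assumes "L2_on A f" "\<And>j. L2_on A (e j)"
    and orth: "\<And>i j. L2_inner A (e i) (e j) = (if i = j then \<mu> i else 0)"
  shows "(L2_norm A (\<lambda>x. f x - (\<Sum>j<N. a j *\<^sub>R e j x)))\<^sup>2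
    = L2_inner A f f - 2 * (\<Sum>j<N. a j * L2_inner A f (e j)) + (\<Sum>j<N. \<mu> j * (a j)\<^sup>2)"
proof -
  let ?S = "\<lambda>x. \<Sum>j<N. a j *\<^sub>R e j x"
  have S: "L2_on A ?S" using assms by (intro L2_on_sum L2_on_scaleR)
  have "L2_inner A ?S ?S = (\<Sum>i<N. a i * L2_inner A (e i) ?S)"
    using assms S by (intro L2_inner_lincomb_left)
  also have "\<dots> = (\<Sum>i<N. \<mu> i * (a i)\<^sup>2)"
  proof (rule sum.cong)
    fix i assume i: "i \<in> {..<N}"
    have "L2_inner A (e i) ?S = (\<Sum>j<N. a j * L2_inner A (e j) (e i))"
      using assms by (subst L2_inner_commute) (intro L2_inner_lincomb_left)
    also have "\<dots> = (\<Sum>j<N. if j = i then a i * \<mu> i else 0)"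
      by (intro sum.cong) (auto simp: orth)
    also have "\<dots> = a i * \<mu> i" using i by simp
    finally show "a i * L2_inner A (e i) ?S = \<mu> i * (a i)\<^sup>2" by (simp add: power2_eq_square)
  qed simp
  finally have 1: "L2_inner A ?S ?S = (\<Sum>i<N. \<mu> i * (a i)\<^sup>2)" .
  have "L2_inner A f ?S = (\<Sum>j<N. a j * L2_inner A (e j) f)"
    using assms by (subst L2_inner_commute) (intro L2_inner_lincomb_left)
  then have 2: "L2_inner A f ?S = (\<Sum>j<N. a j * L2_inner A f (e j))"
    by (simp add: L2_inner_commute)
  show ?thesis
    using L2_norm_power2_diff[OF assms(1) S] by (simp add: 1 2)
qed

text \<open>
  This is the minimum of \<open>\<parallel>\<nabla>v\<parallel>\<^sup>2 + t \<parallel>w - v\<parallel>\<^sup>2\<close> over \<open>v \<in> H\<^sup>1\<^sub>0(A)\<close>, computed in each eigenspace.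
\<close>

definition K_functional ::
    "'a::euclidean_space set \<Rightarrow> (nat \<Rightarrow> real) \<Rightarrow> (nat \<Rightarrow> 'a \<Rightarrow> real) \<Rightarrow> real \<Rightarrow> ('a \<Rightarrow> real) \<Rightarrow> ennreal"
  where
  "K_functional A lam \<phi> t w = (\<Sum>j. ennreal (t * lam j / (t + lam j) * (L2_inner A w (\<phi> j))\<^sup>2))"

text \<open>Bessel's inequality, for the gradient of \<open>\<eta>\<close> against \<open>G\<close>
  and for \<open>w - \<eta>\<close> against \<open>\<phi>\<close>, reduces the claim to a scalar
  minimisation in each mode.\<close>

lemma K_functional_le:
  assumes A: "open A" and eig: "dirichlet_eigensystem A lam \<phi>" and t: "0 < t"
    and w: "L2_on A w" and \<eta>: "test_function A \<eta>"
  shows "K_functional A lam \<phi> t w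
    \<le> ennreal ((L2_norm A (grad \<eta>))\<^sup>2 + t * (L2_norm A (\<lambda>x. w x - \<eta> x))\<^sup>2)"
proof -
  obtain G \<psi> where G: "\<And>j. L2_on A (G j)" "\<And>j k. test_function A (\<psi> j k)"
    "\<And>j. L2_converges A (\<psi> j) (\<phi> j)" "\<And>j. L2_converges A (\<lambda>k. grad (\<psi> j k)) (G j)"
    "\<And>j \<eta>. test_function A \<eta> \<Longrightarrow> L2_inner A (G j) (grad \<eta>) = lam j * L2_inner A (\<phi> j) \<eta>"
    by (rule dirichlet_eigensystem_gradients[OF A eig]) (rule that)
  note lam = eigenvalue_nonneg[OF A eig]
  have meas: "A \<in> sets lebesgue" using A by simp
  note L2 = test_function_L2_on[OF \<eta> meas] dirichlet_eigensystemD(1)[OF eig] G(1) w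
  define b c where "b j = L2_inner A \<eta> (\<phi> j)" and "c j = L2_inner A w (\<phi> j)" for j
  have "(\<Sum>j<N. t * lam j / (t + lam j) * (c j)\<^sup>2)
      \<le> (L2_norm A (grad \<eta>))\<^sup>2 + t * (L2_norm A (\<lambda>x. w x - \<eta> x))\<^sup>2" for N
  proof -
    \<comment> \<open>The L2 coefficients \<open>b j\<close> are also the right ones for the
      gradients, since the inner product of \<open>grad \<eta>\<close> with \<open>G j\<close> is
      \<open>lam j * b j\<close>.\<close>
    have "0 \<le> (L2_norm A (\<lambda>x. grad \<eta> x - (\<Sum>j<N. b j *\<^sub>R G j x)))\<^sup>2" by simp
    also have "\<dots> = L2_inner A (grad \<eta>) (grad \<eta>) - 2 * (\<Sum>j<N. b j * L2_inner A (grad \<eta>) (G j)) + (\<Sum>j<N. lam j * (b j)\<^sup>2)"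
      by (rule L2_norm_diff_orthogonal_sum[OF _ _ gradient_orthogonality[OF A eig G]]) (use L2 in auto)
    also have "\<dots> = (L2_norm A (grad \<eta>))\<^sup>2 - (\<Sum>j<N. lam j * (b j)\<^sup>2)"
    proof -
      have "b j * L2_inner A (grad \<eta>) (G j) = lam j * (b j)\<^sup>2" for j
        using G(5)[OF \<eta>, of j] L2_inner_commute[of A "grad \<eta>" "G j"] L2_inner_commute[of A "\<phi> j" \<eta>]
        by (simp add: b_def power2_eq_square)
      then show ?thesis by (simp add: L2_norm_power2)
    qed
    finally have 1: "(\<Sum>j<N. lam j * (b j)\<^sup>2) \<le> (L2_norm A (grad \<eta>))\<^sup>2" by simp
    have cb: "L2_inner A (\<lambda>x. w x - \<eta> x) (\<phi> j) = c j - b j" for j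
      using L2 by (simp add: L2_inner_diff_left b_def c_def)
    have "0 \<le> (L2_norm A (\<lambda>x. (w x - \<eta> x) - (\<Sum>j<N. (c j - b j) *\<^sub>R \<phi> j x)))\<^sup>2" by simp
    also have "\<dots> = L2_inner A (\<lambda>x. w x - \<eta> x) (\<lambda>x. w x - \<eta> x)
        - 2 * (\<Sum>j<N. (c j - b j) * L2_inner A (\<lambda>x. w x - \<eta> x) (\<phi> j)) + (\<Sum>j<N. 1 * (c j - b j)\<^sup>2)"
      by (rule L2_norm_diff_orthogonal_sum[OF _ _ dirichlet_eigensystemD(2)[OF eig]]) (use L2 in auto)
    also have "\<dots> = (L2_norm A (\<lambda>x. w x - \<eta> x))\<^sup>2 - (\<Sum>j<N. (c j - b j)\<^sup>2)"
      by (simp add: cb L2_norm_power2 flip: power2_eq_square)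
    finally have "(\<Sum>j<N. (c j - b j)\<^sup>2) \<le> (L2_norm A (\<lambda>x. w x - \<eta> x))\<^sup>2" by simp
    then have 2: "t * (\<Sum>j<N. (c j - b j)\<^sup>2) \<le> t * (L2_norm A (\<lambda>x. w x - \<eta> x))\<^sup>2"
      using t by simp
    have "t * lam j / (t + lam j) * (c j)\<^sup>2 \<le> lam j * (b j)\<^sup>2 + t * (c j - b j)\<^sup>2" for j
    proof -
      \<comment> \<open>The square is the defect in the scalar minimisation, multiplied by
        \<open>t + lam j\<close>; it vanishes at the minimising value of \<open>b j\<close>.\<close>
      have "0 \<le> (lam j * b j - t * (c j - b j))\<^sup>2" by simp
      also have "\<dots> = (t + lam j) * (lam j * (b j)\<^sup>2 + t * (c j - b j)\<^sup>2) - t * lam j * (c j)\<^sup>2"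
        by (simp add: power2_eq_square algebra_simps)
      finally show ?thesis using t lam[of j] by (simp add: field_simps)
    qed
    then have "(\<Sum>j<N. t * lam j / (t + lam j) * (c j)\<^sup>2) \<le> (\<Sum>j<N. lam j * (b j)\<^sup>2 + t * (c j - b j)\<^sup>2)"
      by (intro sum_mono)
    also have "\<dots> = (\<Sum>j<N. lam j * (b j)\<^sup>2) + t * (\<Sum>j<N. (c j - b j)\<^sup>2)"
      by (simp add: sum.distrib sum_distrib_left)
    finally show ?thesis using 1 2 by simp
  qed
  note partial_le = this
  show ?thesis
    unfolding K_functional_def c_def[symmetric] suminf_eq_SUP
  proof (rule SUP_least)
    fix N
    have "(\<Sum>j<N. ennreal (t * lam j / (t + lam j) * (c j)\<^sup>2)) = ennreal (\<Sum>j<N. t * lam j / (t + lam j) * (c j)\<^sup>2)"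
      using t lam by (intro sum_ennreal) simp
    also have "\<dots> \<le> ennreal ((L2_norm A (grad \<eta>))\<^sup>2 + t * (L2_norm A (\<lambda>x. w x - \<eta> x))\<^sup>2)"
      by (rule ennreal_leI[OF partial_le])
    finally show "(\<Sum>j<N. ennreal (t * lam j / (t + lam j) * (c j)\<^sup>2))
        \<le> ennreal ((L2_norm A (grad \<eta>))\<^sup>2 + t * (L2_norm A (\<lambda>x. w x - \<eta> x))\<^sup>2)" .
  qed
qed

text \<open>The modewise minimisers, truncated to finitely many modes, form a combination of
  eigenfunctions whose value is close to K; each eigenfunction is then replaced by one of its
  approximating test functions. Only the L2 tail of \<open>w\<close> has to be small.\<close>

lemma K_functional_approx:
  assumes A: "open A" and eig: "dirichlet_eigensystem A lam \<phi>" and t: "0 < t"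
    and w: "L2_on A w" and \<epsilon>: "0 < \<epsilon>"
  obtains \<eta> where "test_function A \<eta>"
    "ennreal ((L2_norm A (grad \<eta>))\<^sup>2 + t * (L2_norm A (\<lambda>x. w x - \<eta> x))\<^sup>2) \<le> K_functional A lam \<phi> t w + ennreal \<epsilon>"
proof -
  obtain G \<psi> where G: "\<And>j. L2_on A (G j)" "\<And>j k. test_function A (\<psi> j k)"
    "\<And>j. L2_converges A (\<psi> j) (\<phi> j)" "\<And>j. L2_converges A (\<lambda>k. grad (\<psi> j k)) (G j)"
    "\<And>j \<eta>. test_function A \<eta> \<Longrightarrow> L2_inner A (G j) (grad \<eta>) = lam j * L2_inner A (\<phi> j) \<eta>"
    by (rule dirichlet_eigensystem_gradients[OF A eig]) (rule that)
  note lam = eigenvalue_nonneg[OF A eig]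
  have meas: "A \<in> sets lebesgue" using A by simp
  note L2 = test_function_L2_on[OF G(2) meas] dirichlet_eigensystemD(1)[OF eig] G(1) w
  \<comment> \<open>\<open>a j\<close> is the value of x that minimises
    \<open>lam j * x\<^sup>2 + t * (c j - x)\<^sup>2\<close>.\<close>
  define c a where "c j = L2_inner A w (\<phi> j)" and "a j = t * c j / (t + lam j)" for j
  define r where "r N = (L2_norm A (\<lambda>x. w x - (\<Sum>j<N. c j *\<^sub>R \<phi> j x)))\<^sup>2" for N
  have expand: "(L2_norm A (\<lambda>x. w x - (\<Sum>j<N. d j *\<^sub>R \<phi> j x)))\<^sup>2
      = L2_inner A w w - 2 * (\<Sum>j<N. d j * c j) + (\<Sum>j<N. 1 * (d j)\<^sup>2)" for N d
    unfolding c_def by (rule L2_norm_diff_orthogonal_sum[OF _ _ dirichlet_eigensystemD(2)[OF eig]]) (use L2 in auto)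
  have "L2_converges A (\<lambda>N x. \<Sum>j<N. c j * \<phi> j x) w"
    unfolding c_def by (rule dirichlet_eigensystemD(3)[OF eig w])
  then have "(\<lambda>N. L2_norm A (\<lambda>x. w x - (\<Sum>j<N. c j *\<^sub>R \<phi> j x))) \<longlonglongrightarrow> 0"
    unfolding L2_converges_iff by (simp add: L2_norm_minus_commute[of A w])
  from tendsto_power[OF this, of 2] have "r \<longlonglongrightarrow> 0" unfolding r_def[abs_def] by simp
  then have "\<forall>\<^sub>F N in sequentially. r N < \<epsilon> / (2 * t)"
    using t \<epsilon> by (intro order_tendstoD) auto
  then obtain N where N: "r N < \<epsilon> / (2 * t)"
    by (auto simp: eventually_sequentially)
  define k where "k = (\<Sum>j<N. t * lam j / (t + lam j) * (c j)\<^sup>2)"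
  define V where "V x = (\<Sum>j<N. a j *\<^sub>R \<phi> j x)" for x
  define W where "W x = (\<Sum>j<N. a j *\<^sub>R G j x)" for x
  define \<eta> where "\<eta> m x = (\<Sum>j<N. a j * \<psi> j m x)" for m x
  have \<eta>: "test_function A (\<eta> m)" "grad (\<eta> m) = (\<lambda>x. \<Sum>j<N. a j *\<^sub>R grad (\<psi> j m) x)" for m
    unfolding \<eta>_def[abs_def] using test_function_lincomb[of "{..<N}" A "\<lambda>j. \<psi> j m" a] G(2) by auto
  have VW: "L2_on A V" "L2_on A W"
    unfolding V_def[abs_def] W_def[abs_def] using L2 by (auto intro!: L2_on_sum L2_on_scaleR)
  \<comment> \<open>The distance formula with \<open>f = 0\<close> computes the norm of a
    combination of the \<open>G j\<close>.\<close>
  have "(L2_norm A (\<lambda>x. 0 - (\<Sum>j<N. a j *\<^sub>R G j x)))\<^sup>2 = L2_inner A (\<lambda>x. 0::'a) (\<lambda>x. 0)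
      - 2 * (\<Sum>j<N. a j * L2_inner A (\<lambda>x. 0) (G j)) + (\<Sum>j<N. lam j * (a j)\<^sup>2)"
    by (rule L2_norm_diff_orthogonal_sum[OF _ _ gradient_orthogonality[OF A eig G]]) (use L2 in auto)
  then have nW: "(L2_norm A W)\<^sup>2 = (\<Sum>j<N. lam j * (a j)\<^sup>2)"
    by (simp add: W_def[abs_def])
  \<comment> \<open>Both sides come from \<open>expand\<close>, with \<open>r N\<close> the case of
    coefficients \<open>c\<close>; the part of \<open>w\<close> beyond the first \<open>N\<close>
    modes cancels.\<close>
  have "(L2_norm A (\<lambda>x. w x - V x))\<^sup>2 - r N = (\<Sum>j<N. (c j - a j)\<^sup>2)"
    unfolding V_def r_def expand
    by (simp add: sum_distrib_left sum_subtractf[symmetric] sum.distrib[symmetric])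
       (auto simp: sum_distrib_left sum_subtractf[symmetric] sum.distrib[symmetric] power2_eq_square algebra_simps intro!: sum.cong)
  then have "(L2_norm A W)\<^sup>2 + t * (L2_norm A (\<lambda>x. w x - V x))\<^sup>2
      = (\<Sum>j<N. lam j * (a j)\<^sup>2 + t * (c j - a j)\<^sup>2) + t * r N"
    by (simp add: nW sum.distrib sum_distrib_left[symmetric] algebra_simps)
  also have "(\<Sum>j<N. lam j * (a j)\<^sup>2 + t * (c j - a j)\<^sup>2) = k"
    unfolding k_def
  proof (rule sum.cong)
    fix j
    have "t + lam j \<noteq> 0" using t lam[of j] by linarith
    then have "c j - a j = lam j * c j / (t + lam j)" by (simp add: a_def field_simps)
    then have "lam j * (a j)\<^sup>2 + t * (c j - a j)\<^sup>2 = t * lam j * (t + lam j) * (c j)\<^sup>2 / (t + lam j)\<^sup>2"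
      by (simp add: a_def power_divide power_mult_distrib add_divide_distrib[symmetric])
         (simp add: algebra_simps power2_eq_square)
    then show "lam j * (a j)\<^sup>2 + t * (c j - a j)\<^sup>2 = t * lam j / (t + lam j) * (c j)\<^sup>2"
      using \<open>t + lam j \<noteq> 0\<close> by (simp add: power2_eq_square)
  qed simp
  \<comment> \<open>\<open>t * r N\<close> uses up less than half of \<open>\<epsilon>\<close>; the
    strict inequality leaves room for passing from \<open>V\<close> and \<open>W\<close> to test
    functions.\<close>
  finally have lim_less: "(L2_norm A W)\<^sup>2 + t * (L2_norm A (\<lambda>x. w x - V x))\<^sup>2 < k + \<epsilon>"
    using N t \<epsilon> by (simp add: field_simps)
  have conv: "L2_converges A \<eta> V" "L2_converges A (\<lambda>m. grad (\<eta> m)) W"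
    using L2_converges_lincomb[of "{..<N}" A \<psi> \<phi> a] L2_converges_lincomb[of "{..<N}" A "\<lambda>j m. grad (\<psi> j m)" G a] G L2
    by (simp_all add: V_def[abs_def] W_def[abs_def] \<eta>(2)) (simp add: \<eta>_def[abs_def])
  then have "L2_converges A (\<lambda>m x. w x - \<eta> m x) (\<lambda>x. w x - V x)"
    unfolding L2_converges_iff by (simp add: L2_norm_minus_commute[of A V])
  then have "(\<lambda>m. (L2_norm A (grad (\<eta> m)))\<^sup>2 + t * (L2_norm A (\<lambda>x. w x - \<eta> m x))\<^sup>2)
      \<longlonglongrightarrow> (L2_norm A W)\<^sup>2 + t * (L2_norm A (\<lambda>x. w x - V x))\<^sup>2"
    using VW w test_function_L2_on[OF \<eta>(1) meas]
    by (intro tendsto_intros L2_converges_norm conv) auto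
  from order_tendstoD(2)[OF this lim_less]
  obtain m where m: "(L2_norm A (grad (\<eta> m)))\<^sup>2 + t * (L2_norm A (\<lambda>x. w x - \<eta> m x))\<^sup>2 < k + \<epsilon>"
    by (auto simp: eventually_sequentially)
  have k0: "0 \<le> k" unfolding k_def using t lam by (intro sum_nonneg) simp
  have "ennreal k = (\<Sum>j<N. ennreal (t * lam j / (t + lam j) * (c j)\<^sup>2))"
    unfolding k_def using t lam by (simp add: sum_ennreal)
  also have "\<dots> \<le> K_functional A lam \<phi> t w"
    unfolding K_functional_def c_def[symmetric] by (rule sum_le_suminf) auto
  finally have "ennreal (k + \<epsilon>) \<le> K_functional A lam \<phi> t w + ennreal \<epsilon>"
    using k0 \<epsilon> by (simp add: add_right_mono)
  moreover have "ennreal ((L2_norm A (grad (\<eta> m)))\<^sup>2 + t * (L2_norm A (\<lambda>x. w x - \<eta> m x))\<^sup>2) \<le> ennreal (k + \<epsilon>)"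
    using m by (intro ennreal_leI) simp
  ultimately show ?thesis using that[OF \<eta>(1)] by (meson order_trans)
qed

subsection \<open>Pushing test functions into a Lipschitz domain\<close>

lemma infdist_less_imp_dist_less:
  assumes "infdist x A < d" "A \<noteq> {}"
  obtains a where "a \<in> A" "dist x a < d"
  using assms by (auto simp: infdist_def cInf_less_iff)

text \<open>The point shifted back from \<open>x\<close> lies within \<open>\<delta>\<close> of some
  \<open>z\<close> in \<open>\<Omega>\<close>, which is above the graph. From \<open>z\<close> to
  \<open>x\<close> the graph rises by at most \<open>L * \<delta>\<close>, and the height of
  \<open>z\<close> is off by less than \<open>\<delta>\<close>; moving up by
  \<open>(L + 1) * \<delta>\<close> pays for both. The bound on \<open>(L + 2) * \<delta>\<close>
  keeps \<open>z\<close> in the ball where the graph description holds.\<close>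

lemma lipschitz_graph_shift:
  fixes \<Omega> :: "'a::euclidean_space set"
  assumes lip: "L-lipschitz_on {y. y \<bullet> e = 0} \<gamma>" and e: "norm e = 1"
    and \<Omega>: "\<Omega> \<inter> ball p r = {x \<in> ball p r. \<gamma> (x - (x \<bullet> e) *\<^sub>R e) < x \<bullet> e}" "\<Omega> \<noteq> {}"
    and \<delta>: "0 < \<delta>" "(L + 2) * \<delta> \<le> r / 2"
    and x: "dist p x \<le> r / 2" "infdist (x - ((L + 1) * \<delta>) *\<^sub>R e) \<Omega> < \<delta>"
  shows "x \<in> \<Omega>"
proof -
  define y where "y = x - ((L + 1) * \<delta>) *\<^sub>R e"
  obtain z where z: "z \<in> \<Omega>" "dist y z < \<delta>"
    using infdist_less_imp_dist_less[OF x(2) \<Omega>(2)] unfolding y_def by blast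
  have L: "0 \<le> L" using lip by (rule lipschitz_on_nonneg)
  have ee: "e \<bullet> e = 1" using e by (simp add: dot_square_norm)
  have "0 < (L + 2) * \<delta>" using \<delta>(1) L by simp
  then have r: "0 < r" using \<delta>(2) by linarith
  define P where "P v = v - (v \<bullet> e) *\<^sub>R e" for v
  have P0: "P v \<in> {y. y \<bullet> e = 0}" for v
    by (simp add: P_def inner_diff_left ee)
  have normP: "norm (P v) \<le> norm v" for v
  proof (rule power2_le_imp_le)
    have "(norm (P v))\<^sup>2 = (norm v)\<^sup>2 - (v \<bullet> e)\<^sup>2"
      unfolding P_def power2_norm_eq_inner
      by (simp add: inner_diff_left inner_diff_right ee inner_commute[of e v] power2_eq_square)
    then show "(norm (P v))\<^sup>2 \<le> (norm v)\<^sup>2" by simp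
  qed simp
  have "dist y x = (L + 1) * \<delta>"
    using L \<delta>(1) by (simp add: y_def dist_norm e)
  then have "dist p z < r / 2 + (L + 1) * \<delta> + \<delta>"
    using dist_triangle[of p z x] dist_triangle[of x z y] x(1) z(2) by (simp add: dist_commute)
  then have "z \<in> ball p r" using \<delta>(2) by (simp add: algebra_simps)
  then have "\<gamma> (P z) < z \<bullet> e" using z(1) \<Omega>(1) unfolding P_def by blast
  \<comment> \<open>\<open>P\<close> annihilates \<open>e\<close>, so the shift leaves the
    projection unchanged.\<close>
  moreover have "P x - P z = P (y - z)"
    by (simp add: P_def y_def inner_diff_left ee algebra_simps scaleR_left_diff_distrib)
  then have "dist (P x) (P z) \<le> \<delta>"
    using normP[of "y - z"] z(2) by (simp add: dist_norm)
  then have "dist (\<gamma> (P x)) (\<gamma> (P z)) \<le> L * \<delta>"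
    using lipschitz_onD[OF lip P0 P0, of x z] L by (meson mult_left_mono order_trans)
  then have "\<gamma> (P x) \<le> \<gamma> (P z) + L * \<delta>" by (simp add: dist_real_def)
  moreover have "x \<bullet> e - z \<bullet> e = (y - z) \<bullet> e + (L + 1) * \<delta>"
    by (simp add: y_def inner_diff_left ee)
  moreover have "\<bar>(y - z) \<bullet> e\<bar> < \<delta>"
    using Cauchy_Schwarz_ineq2[of "y - z" e] z(2) e by (simp add: dist_norm)
  ultimately have "\<gamma> (P x) < x \<bullet> e" by (simp add: algebra_simps)
  moreover have "x \<in> ball p r" using x(1) r by simp
  ultimately show ?thesis using \<Omega>(1) unfolding P_def by blast
qed

text \<open>At boundary points this is the graph shift. At interior points a whole ball lies in
  \<open>\<Omega>\<close> and the direction 0 serves, which is why \<open>norm e\<close> is only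
  bounded by 1.\<close>

lemma lipschitz_domain_local_shift:
  fixes \<Omega> :: "'a::euclidean_space set"
  assumes "open \<Omega>" "\<Omega> \<noteq> {}" "lipschitz_boundary L r \<Omega>" "0 < r" and p: "p \<in> closure \<Omega>"
  shows "\<exists>\<rho>>0. \<exists>e. \<exists>\<delta>0>0. norm e \<le> 1 \<and>
    (\<forall>\<delta> x. 0 < \<delta> \<and> \<delta> < \<delta>0 \<and> dist p x \<le> 2 * \<rho> \<and> infdist (x - ((L + 1) * \<delta>) *\<^sub>R e) \<Omega> < \<delta> \<longrightarrow> x \<in> \<Omega>)"
proof (cases "p \<in> \<Omega>")
  case True
  then obtain \<epsilon> where "0 < \<epsilon>" "cball p \<epsilon> \<subseteq> \<Omega>"
    using assms(1) open_contains_cball by blast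
  then show ?thesis
    by (intro exI[of _ "\<epsilon> / 2"] exI[of _ 0] exI[of _ 1] conjI) auto
next
  case False
  then have "p \<in> frontier \<Omega>" using p assms(1) by (simp add: frontier_def interior_open)
  then obtain e \<gamma> where e: "norm e = 1" "L-lipschitz_on {y. y \<bullet> e = 0} \<gamma>"
    "\<Omega> \<inter> ball p r = {x \<in> ball p r. \<gamma> (x - (x \<bullet> e) *\<^sub>R e) < x \<bullet> e}"
    using assms(3) unfolding lipschitz_boundary_def by blast
  have L: "0 \<le> L" using e(2) by (rule lipschitz_on_nonneg)
  have "x \<in> \<Omega>" if "0 < \<delta>" "\<delta> < r / (2 * (L + 2))" "dist p x \<le> 2 * (r / 4)"
    "infdist (x - ((L + 1) * \<delta>) *\<^sub>R e) \<Omega> < \<delta>" for \<delta> x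
  proof (rule lipschitz_graph_shift[OF e(2,1,3) assms(2) that(1) _ _ that(4)])
    show "(L + 2) * \<delta> \<le> r / 2" using that(2) L by (simp add: field_simps)
    show "dist p x \<le> r / 2" using that(3) by simp
  qed
  \<comment> \<open>\<open>2 * (r / 4)\<close> is the radius allowed in the graph shift, and the
    threshold for \<open>\<delta>\<close> expresses
    \<open>(L + 2) * \<delta> < r / 2\<close>.\<close>
  then show ?thesis
    using assms(4) L e(1) by (intro exI[of _ "r / 4"] exI[of _ e] exI[of _ "r / (2 * (L + 2))"] conjI) auto
qed

text \<open>Compactness of the closure leaves finitely many local directions. The bump at
  \<open>p\<close> is 1 up to radius \<open>\<rho> p\<close> and vanishes from
  \<open>2 * \<rho> p\<close> on, so it lives where the local shift property holds.\<close>

lemma lipschitz_domain_partition: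
  fixes \<Omega> :: "'a::euclidean_space set"
  assumes "bounded_lipschitz_domain \<Omega>"
  obtains P :: "'a set" and \<eta> :: "'a \<Rightarrow> 'a \<Rightarrow> real" and K e c \<delta>0 where
    "finite P" "0 < \<delta>0" "0 \<le> c" "\<And>p. p \<in> P \<Longrightarrow> smooth (\<eta> p)" "\<And>p. p \<in> P \<Longrightarrow> compact (K p)"
    "\<And>p x. p \<in> P \<Longrightarrow> x \<notin> K p \<Longrightarrow> \<eta> p x = 0" "\<And>p x. p \<in> P \<Longrightarrow> 0 \<le> \<eta> p x"
    "\<And>p. p \<in> P \<Longrightarrow> norm (e p) \<le> 1" "\<And>x. (\<Sum>p\<in>P. \<eta> p x) \<le> 1"
    "\<And>x. infdist x \<Omega> < \<delta>0 \<Longrightarrow> (\<Sum>p\<in>P. \<eta> p x) = 1"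
    "\<And>p \<delta> x. p \<in> P \<Longrightarrow> 0 < \<delta> \<Longrightarrow> \<delta> < \<delta>0 \<Longrightarrow> x \<in> K p \<Longrightarrow> infdist (x - (c * \<delta>) *\<^sub>R e p) \<Omega> < \<delta> \<Longrightarrow> x \<in> \<Omega>"
proof -
  obtain L r where \<Omega>: "open \<Omega>" "\<Omega> \<noteq> {}" "lipschitz_boundary L r \<Omega>" "0 < r" "bounded \<Omega>"
    using assms unfolding bounded_lipschitz_domain_def domain_def by blast
  have "\<forall>p. \<exists>\<rho> e \<delta>. p \<in> closure \<Omega> \<longrightarrow> \<rho> > 0 \<and> \<delta> > 0 \<and> norm e \<le> 1 \<and>
      (\<forall>d x. 0 < d \<and> d < \<delta> \<and> dist p x \<le> 2 * \<rho> \<and> infdist (x - ((L + 1) * d) *\<^sub>R e) \<Omega> < d \<longrightarrow> x \<in> \<Omega>)"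
    using lipschitz_domain_local_shift[OF \<Omega>(1-4)] by blast
  then obtain \<rho> e \<delta> where loc: "\<And>p. p \<in> closure \<Omega> \<Longrightarrow> \<rho> p > 0 \<and> \<delta> p > 0 \<and> norm (e p) \<le> 1 \<and>
      (\<forall>d x. 0 < d \<and> d < \<delta> p \<and> dist p x \<le> 2 * \<rho> p \<and> infdist (x - ((L + 1) * d) *\<^sub>R e p) \<Omega> < d \<longrightarrow> x \<in> \<Omega>)"
    by metis
  have cpt: "compact (closure \<Omega>)" using \<Omega>(5) by (rule compact_closure[THEN iffD2])
  have "closure \<Omega> \<subseteq> (\<Union>p\<in>closure \<Omega>. ball p (\<rho> p))" using loc by force
  with cpt obtain P where P: "P \<subseteq> closure \<Omega>" "finite P" "closure \<Omega> \<subseteq> (\<Union>p\<in>P. ball p (\<rho> p))"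
    using compactE_image[of "closure \<Omega>" "closure \<Omega>" "\<lambda>p. ball p (\<rho> p)"] by (metis open_ball)
  have "open (\<Union>p\<in>P. ball p (\<rho> p))" by blast
  \<comment> \<open>The smaller balls still cover a neighbourhood of the closure, so the partition
    sums to 1 slightly beyond \<open>\<Omega>\<close>, where the test functions to be moved may
    live.\<close>
  then obtain \<delta>1 where \<delta>1: "0 < \<delta>1" "(\<Union>x\<in>closure \<Omega>. ball x \<delta>1) \<subseteq> (\<Union>p\<in>P. ball p (\<rho> p))"
    using compact_subset_open_imp_ball_epsilon_subset[OF cpt _ P(3)] by blast
  define \<delta>0 where "\<delta>0 = Min (insert \<delta>1 (\<delta> ` P))"
  have \<delta>0: "0 < \<delta>0" "\<delta>0 \<le> \<delta>1" "\<And>p. p \<in> P \<Longrightarrow> \<delta>0 \<le> \<delta> p"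
    using P(1,2) loc \<delta>1(1) by (auto simp: \<delta>0_def)
  have "\<forall>p. \<exists>b. p \<in> P \<longrightarrow> smooth b \<and> (\<forall>x. 0 \<le> b x) \<and> (\<forall>x. b x \<le> 1) \<and>
    (\<forall>x. dist x p \<le> \<rho> p \<longrightarrow> b x = 1) \<and> (\<forall>x. 2 * \<rho> p \<le> dist x p \<longrightarrow> b x = 0)"
  proof
    fix p
    show "\<exists>b. p \<in> P \<longrightarrow> smooth b \<and> (\<forall>x. 0 \<le> b x) \<and> (\<forall>x. b x \<le> 1) \<and>
      (\<forall>x. dist x p \<le> \<rho> p \<longrightarrow> b x = 1) \<and> (\<forall>x. 2 * \<rho> p \<le> dist x p \<longrightarrow> b x = 0)"
    proof (cases "p \<in> P")
      case True
      then have "0 < \<rho> p" using loc P(1) by blast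
      then show ?thesis using smooth_bump_exists[of "\<rho> p" p] by metis
    qed simp
  qed
  then obtain b where b: "\<And>p. p \<in> P \<Longrightarrow> smooth (b p) \<and> (\<forall>x. 0 \<le> b p x) \<and> (\<forall>x. b p x \<le> 1) \<and>
    (\<forall>x. dist x p \<le> \<rho> p \<longrightarrow> b p x = 1) \<and> (\<forall>x. 2 * \<rho> p \<le> dist x p \<longrightarrow> b p x = 0)"
    by metis
  obtain \<eta> where \<eta>: "\<forall>p\<in>P. smooth (\<eta> p) \<and> (\<forall>x. 0 \<le> \<eta> p x) \<and> (\<forall>x. b p x = 0 \<longrightarrow> \<eta> p x = 0)"
    "\<forall>x. (\<Sum>p\<in>P. \<eta> p x) = 1 - (\<Prod>p\<in>P. 1 - b p x)"
    using smooth_partition_exists[OF P(2), of b] b by blast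
  show ?thesis
  \<comment> \<open>Nonnegativity of \<open>L\<close> is known only through a Lipschitz function at
    a boundary point; the absolute value, with the sign moved into the direction, gives
    \<open>0 \<le> c\<close> in any case.\<close>
  proof (rule that[of P \<delta>0 "\<bar>L + 1\<bar>" \<eta> "\<lambda>p. cball p (2 * \<rho> p)" "\<lambda>p. sgn (L + 1) *\<^sub>R e p"])
    show "\<eta> p x = 0" if "p \<in> P" "x \<notin> cball p (2 * \<rho> p)" for p x
      using that \<eta>(1) b[OF that(1)] by (simp add: dist_commute)
    show "norm (sgn (L + 1) *\<^sub>R e p) \<le> 1" if "p \<in> P" for p
    proof -
      have "norm (e p) \<le> 1" using that loc P(1) by blast
      then show ?thesis by (simp add: sgn_if)
    qed
    show "(\<Sum>p\<in>P. \<eta> p x) \<le> 1" for x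
      using \<eta>(2) b by (simp add: prod_nonneg)
    show "(\<Sum>p\<in>P. \<eta> p x) = 1" if less: "infdist x \<Omega> < \<delta>0" for x
    proof -
      obtain z where "z \<in> \<Omega>" "dist x z < \<delta>0"
        using infdist_less_imp_dist_less[OF less \<Omega>(2)] by blast
      then have "x \<in> ball z \<delta>1" "z \<in> closure \<Omega>"
        using \<delta>0(2) closure_subset by (auto simp: dist_commute)
      then obtain p where p: "p \<in> P" "x \<in> ball p (\<rho> p)" using \<delta>1(2) by blast
      then have "b p x = 1" using b[OF p(1)] by (simp add: dist_commute)
      then have "(\<Prod>p\<in>P. 1 - b p x) = 0" using P(2) p(1) by (auto intro!: prod_zero)
      then show ?thesis using \<eta>(2) by simp
    qed
    show "x \<in> \<Omega>" if "p \<in> P" "0 < \<delta>'" "\<delta>' < \<delta>0" "x \<in> cball p (2 * \<rho> p)"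
      "infdist (x - (\<bar>L + 1\<bar> * \<delta>') *\<^sub>R sgn (L + 1) *\<^sub>R e p) \<Omega> < \<delta>'" for p \<delta>' x
    proof -
      have "(\<bar>L + 1\<bar> * \<delta>') *\<^sub>R sgn (L + 1) *\<^sub>R e p = ((L + 1) * \<delta>') *\<^sub>R e p"
        by (simp add: sgn_if)
      with that(5) have "infdist (x - ((L + 1) * \<delta>') *\<^sub>R e p) \<Omega> < \<delta>'" by (simp only:)
      moreover have "p \<in> closure \<Omega>" "\<delta>' < \<delta> p" "dist p x \<le> 2 * \<rho> p"
        using that P(1) \<delta>0(3)[of p] by auto
      ultimately show ?thesis using loc[of p] that(2) by blast
    qed
  qed (use P \<delta>0 \<eta> in auto)
qed

section \<open>Gluing the shifted copies of a test function\<close>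

lemma L2_norm_mono:
  fixes f :: "'a::euclidean_space \<Rightarrow> 'b::euclidean_space" and g :: "'a \<Rightarrow> 'c::euclidean_space"
  assumes "L2_on A f" "L2_on A g" "\<And>x. norm (f x) \<le> norm (g x)"
  shows "L2_norm A f \<le> L2_norm A g"
proof -
  have "L2_inner A f f \<le> L2_inner A g g"
    unfolding L2_inner_self using assms
    by (intro integral_mono) (auto simp: L2_on_def power_mono)
  then show ?thesis by (simp add: L2_norm_def)
qed

lemma test_function_UNIV_I:
  assumes "smooth f" "compact K" "\<And>x. x \<notin> K \<Longrightarrow> f x = 0"
  shows "test_function UNIV f"
  using assms unfolding test_function_def smooth_def by blast

lemma test_function_translate:
  assumes "test_function A f"
  shows "test_function UNIV (\<lambda>x. f (x - a))"
proof -
  obtain K where K: "compact K" "\<And>x. x \<notin> K \<Longrightarrow> f x = 0"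
    using assms unfolding test_function_def by blast
  have "compact ((\<lambda>x. x + a) ` K)"
    using K(1) by (intro compact_continuous_image continuous_intros)
  moreover have "f (x - a) = 0" if "x \<notin> (\<lambda>x. x + a) ` K" for x
    using that K(2)[of "x - a"] by force
  ultimately show ?thesis
    using test_function_UNIV_I smooth_translate[OF test_function_smooth[OF assms]] by blast
qed

text \<open>Cauchy-Schwarz with each weight split into two square roots. Convexity in place of the
  triangle inequality keeps the leading constant 1 in the gradient estimate.\<close>

lemma norm_convex_combination_power2_le:
  fixes v :: "'i \<Rightarrow> 'b::real_normed_vector"
  assumes "\<And>i. i \<in> I \<Longrightarrow> 0 \<le> a i" "(\<Sum>i\<in>I. a i) \<le> 1"
  shows "(norm (\<Sum>i\<in>I. a i *\<^sub>R v i))\<^sup>2 \<le> (\<Sum>i\<in>I. a i * (norm (v i))\<^sup>2)"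
proof -
  have "norm (\<Sum>i\<in>I. a i *\<^sub>R v i) \<le> (\<Sum>i\<in>I. norm (a i *\<^sub>R v i))" by (rule norm_sum)
  also have "\<dots> = (\<Sum>i\<in>I. sqrt (a i) * (sqrt (a i) * norm (v i)))"
    using assms(1) by (intro sum.cong) (auto simp: mult.assoc[symmetric])
  finally have "(norm (\<Sum>i\<in>I. a i *\<^sub>R v i))\<^sup>2 \<le> (\<Sum>i\<in>I. sqrt (a i) * (sqrt (a i) * norm (v i)))\<^sup>2"
    by (intro power_mono) auto
  also have "\<dots> \<le> (\<Sum>i\<in>I. (sqrt (a i))\<^sup>2) * (\<Sum>i\<in>I. (sqrt (a i) * norm (v i))\<^sup>2)"
    by (rule Cauchy_Schwarz_ineq_sum)
  also have "\<dots> = (\<Sum>i\<in>I. a i) * (\<Sum>i\<in>I. a i * (norm (v i))\<^sup>2)"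
    using assms(1) by (simp add: power_mult_distrib)
  also have "\<dots> \<le> 1 * (\<Sum>i\<in>I. a i * (norm (v i))\<^sup>2)"
    using assms by (intro mult_right_mono sum_nonneg) auto
  finally show ?thesis by simp
qed

text \<open>
  The function is \<open>w x = (\<Sum>p\<in>P. \<eta> p x * \<psi> (x - c \<delta> e p))\<close>. In its gradient the terms with \<open>grad (\<eta> p)\<close>
  are small because these sum to \<open>0\<close> on the support of \<open>\<psi>\<close>; the others have leading constant \<open>1\<close> by convexity.
\<close>

lemma lipschitz_domain_approximation:
  fixes \<Omega> :: "'a::euclidean_space set"
  assumes "bounded_lipschitz_domain \<Omega>"
  obtains C \<delta>0 where "0 \<le> C" "0 < \<delta>0"
    "\<And>\<delta> \<psi>. 0 < \<delta> \<Longrightarrow> \<delta> < \<delta>0 \<Longrightarrow> test_function {x. infdist x \<Omega> < \<delta>} \<psi> \<Longrightarrow>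
      \<exists>w. test_function \<Omega> w \<and> L2_norm UNIV (\<lambda>x. w x - \<psi> x) \<le> C * \<delta> * L2_norm UNIV (grad \<psi>) \<and>
        L2_norm UNIV (grad w) \<le> (1 + C * \<delta>) * L2_norm UNIV (grad \<psi>)"
proof -
  obtain P :: "'a set" and \<eta> :: "'a \<Rightarrow> 'a \<Rightarrow> real" and K e c \<delta>0 where
    P: "finite P" and \<delta>0: "0 < \<delta>0" and c: "0 \<le> c" and smooth: "\<And>p. p \<in> P \<Longrightarrow> smooth (\<eta> p)"
    and K: "\<And>p. p \<in> P \<Longrightarrow> compact (K p)" "\<And>p x. p \<in> P \<Longrightarrow> x \<notin> K p \<Longrightarrow> \<eta> p x = 0"
    and \<eta>0: "\<And>p x. p \<in> P \<Longrightarrow> 0 \<le> \<eta> p x" and e: "\<And>p. p \<in> P \<Longrightarrow> norm (e p) \<le> 1"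
    and \<eta>1: "\<And>x. (\<Sum>p\<in>P. \<eta> p x) \<le> 1" "\<And>x. infdist x \<Omega> < \<delta>0 \<Longrightarrow> (\<Sum>p\<in>P. \<eta> p x) = 1"
    and shift: "\<And>p \<delta> x. p \<in> P \<Longrightarrow> 0 < \<delta> \<Longrightarrow> \<delta> < \<delta>0 \<Longrightarrow> x \<in> K p \<Longrightarrow>
      infdist (x - (c * \<delta>) *\<^sub>R e p) \<Omega> < \<delta> \<Longrightarrow> x \<in> \<Omega>"
    by (rule lipschitz_domain_partition[OF assms]) (rule that)
  have \<eta>_le_1: "\<eta> p x \<le> 1" if "p \<in> P" for p x
  proof -
    have "\<eta> p x \<le> (\<Sum>p\<in>P. \<eta> p x)" using that P \<eta>0 by (intro member_le_sum) auto
    then show ?thesis using \<eta>1(1)[of x] by linarith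
  qed
  have gradK: "grad (\<eta> p) x = 0" if "p \<in> P" "x \<notin> K p" for p x
    using grad_eq_0_outside[OF compact_imp_closed[OF K(1)[OF that(1)]] K(2)[OF that(1)] that(2)] .
  have "\<exists>M. 0 \<le> M \<and> (\<forall>x. norm (grad (\<eta> p) x) \<le> M)" if "p \<in> P" for p
    by (rule bounded_compact_support[OF continuous_on_grad[OF smooth[OF that]] K(1)[OF that] gradK[OF that]]) auto
  then obtain M where M: "\<And>p. p \<in> P \<Longrightarrow> 0 \<le> M p" "\<And>p x. p \<in> P \<Longrightarrow> norm (grad (\<eta> p) x) \<le> M p"
    by metis
  \<comment> \<open>The first summand pays for the L2 distance, \<open>c * \<delta>\<close> for each
    shift. The second pays twice for \<open>q\<close> below: once for the gradients of the partition
    and once for translating its weights.\<close>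
  define C where "C = real (card P) * c + 2 * c * (\<Sum>p\<in>P. M p)"
  have M0: "0 \<le> (\<Sum>p\<in>P. M p)" using M(1) by (rule sum_nonneg)
  have "0 \<le> C" using c M0 by (simp add: C_def)
  moreover have "\<exists>w. test_function \<Omega> w \<and> L2_norm UNIV (\<lambda>x. w x - \<psi> x) \<le> C * \<delta> * L2_norm UNIV (grad \<psi>) \<and>
        L2_norm UNIV (grad w) \<le> (1 + C * \<delta>) * L2_norm UNIV (grad \<psi>)"
    if \<delta>: "0 < \<delta>" "\<delta> < \<delta>0" and \<psi>: "test_function {x. infdist x \<Omega> < \<delta>} \<psi>" for \<delta> \<psi>
  proof -
    define a where "a p = (c * \<delta>) *\<^sub>R e p" for p
    have a: "norm (a p) \<le> c * \<delta>" if "p \<in> P" for p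
      using e[OF that] c \<delta>(1) by (simp add: a_def mult_left_le)
    define g where "g = L2_norm UNIV (grad \<psi>)"
    have g0: "0 \<le> g" by (simp add: g_def)
    define d where "d p x = \<psi> (x - a p) - \<psi> x" for p x
    have s\<psi>: "smooth \<psi>" and s\<psi>a: "smooth (\<lambda>x. \<psi> (x - a p))" for p
      using test_function_smooth[OF \<psi>] smooth_translate by auto
    have grad_translate: "grad (\<lambda>x. \<psi> (x - a p)) x = grad \<psi> (x - a p)" for p x
      by (rule grad_eqI[OF has_derivative_translate[OF smooth_differentiable[OF s\<psi>]]])
    have d: "test_function UNIV (d p)" for p
    proof -
      \<comment> \<open>A sum over the two booleans presents the difference as a linear combination
        of test functions.\<close>
      have "test_function UNIV (\<lambda>x. \<Sum>b\<in>UNIV. (if b then 1 else -1) * (if b then \<lambda>x. \<psi> (x - a p) else \<psi>) x)"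
        by (rule test_function_lincomb(1))
           (use test_function_translate[OF \<psi>] test_function_mono[OF \<psi> subset_UNIV] in simp)
      then show ?thesis by (simp add: d_def[abs_def] UNIV_bool)
    qed
    have d_le: "L2_norm UNIV (d p) \<le> c * \<delta> * g" if "p \<in> P" for p
    proof -
      have "L2_norm UNIV (d p) \<le> norm (a p) * g"
        unfolding d_def[abs_def] g_def by (rule test_function_translate_L2[OF \<psi>])
      also have "\<dots> \<le> c * \<delta> * g" using a[OF that] g0 by (rule mult_right_mono)
      finally show ?thesis .
    qed
    define w where "w x = (\<Sum>p\<in>P. \<eta> p x * \<psi> (x - a p))" for x
    have sum1: "(\<Sum>p\<in>P. \<eta> p x) = 1" if "\<psi> x \<noteq> 0" for x
    proof -
      have "infdist x \<Omega> < \<delta>" using test_function_outside(1)[OF \<psi>, of x] that by auto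
      then show ?thesis using \<eta>1(2) \<delta>(2) by simp
    qed
    have sum_grad0: "(\<Sum>p\<in>P. grad (\<eta> p) x) = 0" if "\<psi> x \<noteq> 0" for x
    proof -
      have "infdist x \<Omega> < \<delta>" using test_function_outside(1)[OF \<psi>, of x] that by auto
      then have x: "infdist x \<Omega> < \<delta>0" using \<delta>(2) by linarith
      \<comment> \<open>The partition sum is constant on this open set around \<open>x\<close>, so
        its gradient vanishes at \<open>x\<close>.\<close>
      have "open {x. infdist x \<Omega> < \<delta>0}"
        by (rule open_Collect_less) (auto intro!: continuous_intros)
      then have "((\<lambda>x. \<Sum>p\<in>P. \<eta> p x) has_derivative (\<lambda>h. 0 \<bullet> h)) (at x)"
        by (rule has_derivative_transform_within_open[where f="\<lambda>x. 1", rotated]) (use x \<eta>1(2) in auto)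
      then have "grad (\<lambda>x. \<Sum>p\<in>P. \<eta> p x) x = 0" by (rule grad_eqI)
      moreover have "grad (\<lambda>x. \<Sum>p\<in>P. \<eta> p x) x = (\<Sum>p\<in>P. grad (\<eta> p) x)"
      proof (rule grad_eqI)
        have "((\<lambda>x. \<Sum>p\<in>P. \<eta> p x) has_derivative (\<lambda>h. \<Sum>p\<in>P. grad (\<eta> p) x \<bullet> h)) (at x)"
          by (intro has_derivative_sum smooth_has_derivative smooth)
        then show "((\<lambda>x. \<Sum>p\<in>P. \<eta> p x) has_derivative (\<lambda>h. (\<Sum>p\<in>P. grad (\<eta> p) x) \<bullet> h)) (at x)"
          by (simp add: inner_sum_left)
      qed
      ultimately show ?thesis by simp
    qed
    have w: "test_function \<Omega> w"
    proof -
      obtain K\<psi> where K\<psi>: "compact K\<psi>" "K\<psi> \<subseteq> {x. infdist x \<Omega> < \<delta>}" "\<And>x. x \<notin> K\<psi> \<Longrightarrow> \<psi> x = 0"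
        using \<psi> unfolding test_function_def by blast
      define S where "S = (\<Union>p\<in>P. K p \<inter> (\<lambda>x. x + a p) ` K\<psi>)"
      have "smooth w" unfolding w_def[abs_def] by (intro smooth_sum smooth_mult smooth s\<psi>a)
      moreover have "compact S" unfolding S_def
        using P K(1) K\<psi>(1) by (intro compact_UN compact_Int compact_continuous_image continuous_intros)
      \<comment> \<open>A point of \<open>K p\<close> whose shift by \<open>- a p\<close> lies
        within \<open>\<delta>\<close> of \<open>\<Omega>\<close> belongs to \<open>\<Omega>\<close>
        by the local shift property.\<close>
      moreover have "S \<subseteq> \<Omega>"
        unfolding S_def using shift[OF _ \<delta>] K\<psi>(2) by (auto simp: a_def)
      moreover have "w x = 0" if "x \<notin> S" for x
        unfolding w_def
      proof (rule sum.neutral, rule ballI)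
        fix p assume p: "p \<in> P"
        show "\<eta> p x * \<psi> (x - a p) = 0"
        proof (cases "x \<in> K p")
          case True
          then have "x - a p \<notin> K\<psi>" using that p unfolding S_def by force
          then show ?thesis using K\<psi>(3) by simp
        qed (use K(2)[OF p] in simp)
      qed
      ultimately show ?thesis unfolding test_function_def smooth_def by blast
    qed
    have "w x - \<psi> x = (\<Sum>p\<in>P. \<eta> p x * d p x)" for x
    proof -
      have "\<psi> x = (\<Sum>p\<in>P. \<eta> p x) * \<psi> x" using sum1[of x] by (cases "\<psi> x = 0") auto
      then show ?thesis
        by (simp add: w_def d_def right_diff_distrib sum_subtractf sum_distrib_right)
    qed
    then have "L2_norm UNIV (\<lambda>x. w x - \<psi> x) = L2_norm UNIV (\<lambda>x. \<Sum>p\<in>P. \<eta> p x * d p x)" by simp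
    also have "\<dots> \<le> (\<Sum>p\<in>P. L2_norm UNIV (\<lambda>x. \<eta> p x * d p x))"
    proof (rule L2_norm_sum)
      fix p assume "p \<in> P"
      then show "L2_on UNIV (\<lambda>x. \<eta> p x * d p x)"
        using K by (intro L2_on_compact_support[of _ "K p"] smooth_continuous_on smooth_mult smooth test_function_smooth[OF d]) auto
    qed
    also have "\<dots> \<le> (\<Sum>p\<in>P. c * \<delta> * g)"
    proof (rule sum_mono)
      fix p assume p: "p \<in> P"
      have "L2_norm UNIV (\<lambda>x. \<eta> p x * d p x) \<le> L2_norm UNIV (d p)"
      proof (rule L2_norm_mono)
        show "L2_on UNIV (\<lambda>x. \<eta> p x * d p x)"
          using K p by (intro L2_on_compact_support[of _ "K p"] smooth_continuous_on smooth_mult smooth test_function_smooth[OF d]) auto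
        show "norm (\<eta> p x * d p x) \<le> norm (d p x)" for x
          using \<eta>0[OF p] \<eta>_le_1[OF p] by (simp add: abs_mult mult_left_le_one_le)
      qed (use test_function_L2_on(1)[OF d] in auto)
      then show "L2_norm UNIV (\<lambda>x. \<eta> p x * d p x) \<le> c * \<delta> * g" using d_le[OF p] by linarith
    qed
    also have "\<dots> \<le> C * \<delta> * g"
      using c \<delta>(1) M0 g0 by (simp add: C_def algebra_simps)
    finally have 1: "L2_norm UNIV (\<lambda>x. w x - \<psi> x) \<le> C * \<delta> * g" .

    define V where "V x = (\<Sum>p\<in>P. \<eta> p x *\<^sub>R grad \<psi> (x - a p))" for x
    define W where "W x = (\<Sum>p\<in>P. d p x *\<^sub>R grad (\<eta> p) x)" for x
    have gw: "grad w x = V x + W x" for x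
    proof -
      have "(w has_derivative (\<lambda>h. \<Sum>p\<in>P. \<eta> p x * (grad \<psi> (x - a p) \<bullet> h) + (grad (\<eta> p) x \<bullet> h) * \<psi> (x - a p))) (at x)"
        unfolding w_def[abs_def]
        by (intro has_derivative_sum has_derivative_mult smooth_has_derivative smooth
            has_derivative_translate[OF smooth_differentiable[OF s\<psi>]])
      then have "grad w x = (\<Sum>p\<in>P. \<eta> p x *\<^sub>R grad \<psi> (x - a p) + \<psi> (x - a p) *\<^sub>R grad (\<eta> p) x)"
        by (intro grad_eqI) (simp add: inner_sum_left inner_add_left ac_simps)
      also have "\<dots> = V x + (\<Sum>p\<in>P. \<psi> (x - a p) *\<^sub>R grad (\<eta> p) x)"
        by (simp add: V_def sum.distrib)
      \<comment> \<open>Splitting off \<open>\<psi> x\<close> times the gradient of the partition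
        sum turns translated values into the small differences \<open>d p\<close>; the part split
        off is 0.\<close>
      also have "(\<Sum>p\<in>P. \<psi> (x - a p) *\<^sub>R grad (\<eta> p) x) = W x + \<psi> x *\<^sub>R (\<Sum>p\<in>P. grad (\<eta> p) x)"
        by (simp add: W_def d_def scaleR_left_diff_distrib sum_subtractf scaleR_sum_right)
      also have "\<psi> x *\<^sub>R (\<Sum>p\<in>P. grad (\<eta> p) x) = 0" using sum_grad0[of x] by auto
      finally show ?thesis by simp
    qed
    have L2W: "L2_on UNIV (\<lambda>x. d p x *\<^sub>R grad (\<eta> p) x)" if "p \<in> P" for p
      using gradK[OF that] K(1)[OF that] by (intro L2_on_compact_support[of _ "K p"] continuous_intros
          smooth_continuous_on[OF test_function_smooth[OF d]] continuous_on_grad smooth[OF that]) auto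
    have "L2_norm UNIV W \<le> (\<Sum>p\<in>P. L2_norm UNIV (\<lambda>x. d p x *\<^sub>R grad (\<eta> p) x))"
      unfolding W_def[abs_def] by (rule L2_norm_sum[OF L2W])
    also have "\<dots> \<le> (\<Sum>p\<in>P. M p * (c * \<delta> * g))"
    proof (rule sum_mono)
      fix p assume p: "p \<in> P"
      have "L2_norm UNIV (\<lambda>x. d p x *\<^sub>R grad (\<eta> p) x) \<le> L2_norm UNIV (\<lambda>x. M p *\<^sub>R d p x)"
      proof (rule L2_norm_mono[OF L2W[OF p]])
        show "L2_on UNIV (\<lambda>x. M p *\<^sub>R d p x)"
          by (intro L2_on_scaleR test_function_L2_on(1)[OF d]) simp
        show "norm (d p x *\<^sub>R grad (\<eta> p) x) \<le> norm (M p *\<^sub>R d p x)" for x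
          using mult_left_mono[OF M(2)[OF p, of x] abs_ge_zero[of "d p x"]] M(1)[OF p]
          by (simp add: abs_mult mult.commute[of "M p"])
      qed
      also have "\<dots> = M p * L2_norm UNIV (d p)" using M(1)[OF p] by (subst L2_norm_scaleR) simp
      also have "\<dots> \<le> M p * (c * \<delta> * g)" using d_le[OF p] M(1)[OF p] by (rule mult_left_mono)
      finally show "L2_norm UNIV (\<lambda>x. d p x *\<^sub>R grad (\<eta> p) x) \<le> M p * (c * \<delta> * g)" .
    qed
    also have "\<dots> = (c * \<delta> * (\<Sum>p\<in>P. M p)) * g" by (simp add: sum_distrib_left sum_distrib_right ac_simps)
    finally have W_le: "L2_norm UNIV W \<le> (c * \<delta> * (\<Sum>p\<in>P. M p)) * g" .

    define q where "q = c * \<delta> * (\<Sum>p\<in>P. M p)"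
    have q0: "0 \<le> q" using c \<delta>(1) M0 by (simp add: q_def)
    define G where "G x = (norm (grad \<psi> x))\<^sup>2" for x
    have contG: "continuous_on UNIV G"
      unfolding G_def by (intro continuous_intros continuous_on_grad s\<psi>)
    have [measurable]: "G \<in> borel_measurable borel" using contG by (rule borel_measurable_continuous_onI)
    have [measurable]: "p \<in> P \<Longrightarrow> \<eta> p \<in> borel_measurable borel" for p
      using smooth borel_measurable_smooth by blast
    obtain K\<psi> where K\<psi>: "compact K\<psi>" "\<And>x. x \<notin> K\<psi> \<Longrightarrow> G x = 0"
      using test_functionE[OF \<psi>] unfolding G_def by (metis norm_zero zero_power2)
    have contV: "continuous_on UNIV V"
      unfolding V_def by (intro continuous_intros smooth_continuous_on smooth
          continuous_on_compose2[OF continuous_on_grad[OF s\<psi>, of UNIV]]) auto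
    have KP: "compact (\<Union>p\<in>P. K p)" using P K(1) by auto
    have V0: "V x = 0" if "x \<notin> (\<Union>p\<in>P. K p)" for x
      unfolding V_def using that K(2) by (intro sum.neutral) auto
    have L2V: "L2_on UNIV V"
      by (rule L2_on_compact_support[OF contV KP V0]) auto
    have int1: "integrable lborel (\<lambda>x. \<eta> p x * G (x - a p))" if "p \<in> P" for p
      using K that by (intro integrable_lborel_compact_support[of _ "K p"] continuous_intros smooth_continuous_on smooth
          continuous_on_compose2[OF contG]) auto
    have int2: "integrable lborel (\<lambda>x. \<eta> p (x + a p) * G x)" if "p \<in> P" for p
    proof (rule integrable_lborel_compact_support[OF _ K\<psi>(1)])
      have "continuous_on UNIV (\<lambda>x. \<eta> p (x + a p))"
        by (rule continuous_on_compose2[OF smooth_continuous_on[OF smooth[OF that], of UNIV]])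
           (auto intro!: continuous_intros)
      then show "continuous_on UNIV (\<lambda>x. \<eta> p (x + a p) * G x)"
        using contG by (rule continuous_on_mult)
    qed (use K\<psi>(2) in simp)
    have "(L2_norm UNIV V)\<^sup>2 = (LINT x|lborel. (norm (V x))\<^sup>2)"
      using contV by (simp add: L2_norm_power2 L2_inner_lborel borel_measurable_continuous_onI power2_norm_eq_inner)
    also have "\<dots> \<le> (LINT x|lborel. (\<Sum>p\<in>P. \<eta> p x * G (x - a p)))"
    proof (rule integral_mono)
      show "integrable lborel (\<lambda>x. (norm (V x))\<^sup>2)"
        by (rule integrable_lborel_compact_support[OF _ KP]) (use V0 contV in \<open>auto intro!: continuous_intros\<close>)
      show "(norm (V x))\<^sup>2 \<le> (\<Sum>p\<in>P. \<eta> p x * G (x - a p))" for x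
        unfolding V_def G_def by (rule norm_convex_combination_power2_le) (use \<eta>0 \<eta>1 in auto)
    qed (use int1 in auto)
    also have "\<dots> = (\<Sum>p\<in>P. LINT x|lborel. \<eta> p x * G (x - a p))"
      using int1 by simp
    \<comment> \<open>Translating each integral moves the shift from the gradient of
      \<open>\<psi>\<close> to the weight, after which all summands share the factor
      \<open>G\<close>.\<close>
    also have "\<dots> = (\<Sum>p\<in>P. LINT x|lborel. \<eta> p (x + a p) * G x)"
    proof (rule sum.cong)
      fix p assume "p \<in> P"
      then show "(LINT x|lborel. \<eta> p x * G (x - a p)) = (LINT x|lborel. \<eta> p (x + a p) * G x)"
        using integral_lborel_translate[of "\<lambda>x. \<eta> p (x + a p) * G x" "a p"] by simp
    qed simp
    also have "\<dots> = (LINT x|lborel. (\<Sum>p\<in>P. \<eta> p (x + a p) * G x))"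
      using int2 by simp
    also have "\<dots> \<le> (LINT x|lborel. (1 + q) * G x)"
    proof (rule integral_mono)
      show "integrable lborel (\<lambda>x. (1 + q) * G x)"
        using integrable_lborel_compact_support[OF contG K\<psi>] by simp
      show "(\<Sum>p\<in>P. \<eta> p (x + a p) * G x) \<le> (1 + q) * G x" for x
      proof -
        \<comment> \<open>The shifted weights may sum to more than 1, but their Lipschitz constants
          bound the excess by \<open>q\<close>.\<close>
        have "\<eta> p (x + a p) \<le> \<eta> p x + M p * (c * \<delta>)" if "p \<in> P" for p
        proof -
          have "\<bar>\<eta> p (x + a p) - \<eta> p x\<bar> \<le> M p * norm (a p)"
            using smooth_lipschitz[OF smooth[OF that] M(2)[OF that], of "x + a p" x] by simp
          also have "\<dots> \<le> M p * (c * \<delta>)" using a[OF that] M(1)[OF that] by (rule mult_left_mono)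
          finally show ?thesis by linarith
        qed
        then have "(\<Sum>p\<in>P. \<eta> p (x + a p)) \<le> (\<Sum>p\<in>P. \<eta> p x) + (\<Sum>p\<in>P. M p * (c * \<delta>))"
          unfolding sum.distrib[symmetric] by (rule sum_mono)
        also have "(\<Sum>p\<in>P. M p * (c * \<delta>)) = q" by (simp add: q_def sum_distrib_left sum_distrib_right ac_simps)
        finally have "(\<Sum>p\<in>P. \<eta> p (x + a p)) \<le> 1 + q" using \<eta>1(1)[of x] by linarith
        then show ?thesis
          unfolding sum_distrib_right[symmetric] by (rule mult_right_mono) (simp add: G_def)
      qed
    qed (use int2 in auto)
    also have "\<dots> = (1 + q) * g\<^sup>2"
      using borel_measurable_grad[OF s\<psi>]
      by (simp add: g_def G_def L2_norm_power2 L2_inner_lborel power2_norm_eq_inner)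
    \<comment> \<open>Weakened to a perfect square, so that the norms can be compared without a
      root.\<close>
    also have "\<dots> \<le> (1 + q)\<^sup>2 * g\<^sup>2"
      using q0 by (intro mult_right_mono) (auto simp: power2_eq_square algebra_simps)
    finally have "(L2_norm UNIV V)\<^sup>2 \<le> ((1 + q) * g)\<^sup>2" by (simp add: power_mult_distrib)
    then have V_le: "L2_norm UNIV V \<le> (1 + q) * g"
      by (rule power2_le_imp_le) (use q0 g0 in simp)
    have "L2_norm UNIV (grad w) = L2_norm UNIV (\<lambda>x. V x + W x)" using gw by presburger
    also have "\<dots> \<le> L2_norm UNIV V + L2_norm UNIV W"
      using L2V L2_on_sum[OF L2W] by (intro L2_norm_triangle) (auto simp: W_def[abs_def])
    also have "\<dots> \<le> (1 + 2 * q) * g" using V_le W_le[folded q_def] by (simp add: algebra_simps)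
    also have "\<dots> \<le> (1 + C * \<delta>) * g"
      using c \<delta>(1) g0 by (intro mult_right_mono) (auto simp: C_def q_def algebra_simps)
    finally show ?thesis using 1 w unfolding g_def by blast
  qed
  ultimately show ?thesis using \<delta>0 that by blast
qed

subsection \<open>The lower limit of the K-functional\<close>

text \<open>The zero function is a competitor. This bounds the energy of near-minimisers on
  \<open>\<Omega>h h\<close> independently of \<open>h\<close>.\<close>

lemma K_functional_le_L2_norm:
  assumes A: "open A" and eig: "dirichlet_eigensystem A lam \<phi>" and t: "0 < t" and w: "L2_on A w"
  shows "K_functional A lam \<phi> t w \<le> ennreal (t * (L2_norm A w)\<^sup>2)"
proof -
  have z: "test_function A (\<lambda>x. 0)"
    using smooth_const[of 0] by (auto simp: test_function_def smooth_def intro!: exI[of _ "{}"])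
  have "grad (\<lambda>x::'a. 0) = (\<lambda>x. 0)"
    by (rule ext, rule grad_eqI) (simp add: inner_zero_left[abs_def])
  then show ?thesis
    using K_functional_le[OF A eig t w z] by (simp add: L2_norm_def)
qed

text \<open>A near-minimiser for \<open>uh h\<close> on \<open>\<Omega>h h\<close> is pushed into
  \<open>\<Omega>\<close>, with the collar width \<open>1 / real h\<close> as
  \<open>\<delta>\<close>, and becomes a competitor for \<open>u\<close>.\<close>

lemma K_functional_le_liminf:
  fixes \<Omega> B :: "'a::euclidean_space set" and \<Omega>h :: "nat \<Rightarrow> 'a set"
  assumes \<Omega>: "bounded_lipschitz_domain \<Omega>" and eig: "dirichlet_eigensystem \<Omega> lam \<phi>"
    and B: "open B"
    and \<Omega>h: "\<And>h. h \<ge> 1 \<Longrightarrow> open (\<Omega>h h)" "\<And>h. h \<ge> 1 \<Longrightarrow> \<Omega> \<subseteq> \<Omega>h h" "\<And>h. h \<ge> 1 \<Longrightarrow> \<Omega>h h \<subseteq> B"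
      "\<And>h. h \<ge> 1 \<Longrightarrow> \<Omega>h h \<subseteq> {x. infdist x \<Omega> < 1 / real h}"
    and eigh: "\<And>h. h \<ge> 1 \<Longrightarrow> dirichlet_eigensystem (\<Omega>h h) (lamh h) (\<phi>h h)"
    and L2: "\<And>h. h \<ge> 1 \<Longrightarrow> L2_on B (uh h)" "L2_on B u" and conv: "L2_converges B uh u"
    and t: "0 < t"
  shows "K_functional \<Omega> lam \<phi> t u \<le> liminf (\<lambda>h. K_functional (\<Omega>h h) (lamh h) (\<phi>h h) t (uh h))"
proof -
  let ?K = "\<lambda>h. K_functional (\<Omega>h h) (lamh h) (\<phi>h h) t (uh h)"
  obtain C \<delta>0 where C: "0 \<le> C" and \<delta>0: "0 < \<delta>0" and approx:
    "\<And>\<delta> \<psi>. 0 < \<delta> \<Longrightarrow> \<delta> < \<delta>0 \<Longrightarrow> test_function {x. infdist x \<Omega> < \<delta>} \<psi> \<Longrightarrow>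
      \<exists>w. test_function \<Omega> w \<and> L2_norm UNIV (\<lambda>x. w x - \<psi> x) \<le> C * \<delta> * L2_norm UNIV (grad \<psi>) \<and>
        L2_norm UNIV (grad w) \<le> (1 + C * \<delta>) * L2_norm UNIV (grad \<psi>)"
    by (rule lipschitz_domain_approximation[OF \<Omega>]) (rule that)
  have o\<Omega>: "open \<Omega>" using \<Omega> by (simp add: bounded_lipschitz_domain_def domain_def)
  have m\<Omega>: "\<Omega> \<in> sets lebesgue" and mB: "B \<in> sets lebesgue" using o\<Omega> B by auto
  have mh: "\<Omega>h h \<in> sets lebesgue" if "h \<ge> 1" for h using \<Omega>h(1)[OF that] by simp
  have \<Omega>B: "\<Omega> \<subseteq> B" using \<Omega>h(2,3)[of 1] by auto
  define d where "d h = L2_norm B (\<lambda>x. uh h x - u x)" for h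
  have d_lim: "d \<longlonglongrightarrow> 0" using conv unfolding L2_converges_iff d_def[abs_def] .
  have d0: "0 \<le> d h" for h by (simp add: d_def)
  \<comment> \<open>\<open>Q\<close> bounds \<open>?K h + 1 / h\<close> once \<open>d h < 1\<close>.
    Hence the near-minimiser has gradient norm at most \<open>\<alpha>\<close> and L2 distance at
    most \<open>\<beta>\<close> from \<open>uh h\<close>.\<close>
  define Q where "Q = t * (L2_norm B u + 1)\<^sup>2 + 1"
  define \<alpha> \<beta> where "\<alpha> = sqrt Q" and "\<beta> = sqrt (Q / t)"
  have Q0: "0 \<le> Q" using t by (simp add: Q_def)
  define \<epsilon> where "\<epsilon> h = C * (1 / real h)" for h
  define \<tau> where "\<tau> h = d h + \<epsilon> h * \<alpha>" for h
  \<comment> \<open>The three errors come from near-minimality, from the gradient factor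
    \<open>1 + \<epsilon> h\<close>, and from the L2 distance enlarged by \<open>\<tau> h\<close>;
    the last two enter squared.\<close>
  define s where "s h = 1 / real h + (2 * \<epsilon> h + (\<epsilon> h)\<^sup>2) * \<alpha>\<^sup>2 + t * (2 * \<beta> * \<tau> h + (\<tau> h)\<^sup>2)" for h
  have inv_lim: "(\<lambda>h. 1 / real h) \<longlonglongrightarrow> 0" by (rule lim_1_over_n)
  have \<epsilon>_lim: "\<epsilon> \<longlonglongrightarrow> 0" unfolding \<epsilon>_def[abs_def] by (rule tendsto_mult_right_zero[OF inv_lim])
  have \<tau>_lim: "\<tau> \<longlonglongrightarrow> 0" unfolding \<tau>_def[abs_def]
    using tendsto_add[OF d_lim tendsto_mult_left_zero[OF \<epsilon>_lim, of \<alpha>]] by simp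
  have "s \<longlonglongrightarrow> 0 + (2 * 0 + 0\<^sup>2) * \<alpha>\<^sup>2 + t * (2 * \<beta> * 0 + 0\<^sup>2)"
    unfolding s_def[abs_def] by (intro tendsto_intros inv_lim \<epsilon>_lim \<tau>_lim)
  then have s_lim: "s \<longlonglongrightarrow> 0" by simp
  have main: "K_functional \<Omega> lam \<phi> t u \<le> ?K h + ennreal (s h)"
    if h: "1 \<le> h" "1 / real h < \<delta>0" "d h < 1" for h
  proof -
    note L2h = L2_on_subset[OF L2(1)[OF h(1)] \<Omega>h(3)[OF h(1)] mh[OF h(1)] mB]
    have h0: "0 < 1 / real h" using h(1) by simp
    obtain \<psi> where \<psi>: "test_function (\<Omega>h h) \<psi>"
      "ennreal ((L2_norm (\<Omega>h h) (grad \<psi>))\<^sup>2 + t * (L2_norm (\<Omega>h h) (\<lambda>x. uh h x - \<psi> x))\<^sup>2) \<le> ?K h + ennreal (1 / real h)"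
      by (rule K_functional_approx[OF \<Omega>h(1)[OF h(1)] eigh[OF h(1)] t L2h h0]) (rule that)
    define a b where "a = L2_norm UNIV (grad \<psi>)" and "b = L2_norm (\<Omega>h h) (\<lambda>x. uh h x - \<psi> x)"
    have ab0: "0 \<le> a" "0 \<le> b" by (simp_all add: a_def b_def)
    have "L2_norm (\<Omega>h h) (grad \<psi>) = a"
      unfolding a_def by (rule L2_norm_UNIV[OF mh[OF h(1)] test_function_outside(2)[OF \<psi>(1)]])
    with \<psi>(2) have ab: "ennreal (a\<^sup>2 + t * b\<^sup>2) \<le> ?K h + ennreal (1 / real h)" by (simp add: b_def)
    have "L2_norm (\<Omega>h h) (uh h) \<le> L2_norm B (uh h)"
      by (rule L2_norm_subset_le[OF L2(1)[OF h(1)] \<Omega>h(3)[OF h(1)] mh[OF h(1)] mB])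
    also have "L2_norm B (uh h) \<le> d h + L2_norm B u"
      using L2_norm_triangle[OF L2_on_diff[OF L2(1)[OF h(1)] L2(2)] L2(2)] by (simp add: d_def)
    also have "\<dots> \<le> L2_norm B u + 1" using h(3) by simp
    finally have "t * (L2_norm (\<Omega>h h) (uh h))\<^sup>2 \<le> t * (L2_norm B u + 1)\<^sup>2"
      using t by (intro mult_left_mono power_mono) auto
    then have "?K h \<le> ennreal (t * (L2_norm B u + 1)\<^sup>2)"
      using K_functional_le_L2_norm[OF \<Omega>h(1)[OF h(1)] eigh[OF h(1)] t L2h] ennreal_leI order_trans by blast
    then have "?K h + ennreal (1 / real h) \<le> ennreal (t * (L2_norm B u + 1)\<^sup>2) + ennreal 1"
      using h(1) by (intro add_mono ennreal_leI) auto
    also have "\<dots> = ennreal Q"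
      unfolding Q_def using t by (intro ennreal_plus[symmetric]) auto
    finally have "ennreal (a\<^sup>2 + t * b\<^sup>2) \<le> ennreal Q"
      using ab by (rule order_trans[rotated])
    then have abQ: "a\<^sup>2 + t * b\<^sup>2 \<le> Q" using Q0 by simp
    have "a\<^sup>2 \<le> Q" using abQ t by (smt (verit) mult_nonneg_nonneg zero_le_power2)
    then have a\<alpha>: "a \<le> \<alpha>" unfolding \<alpha>_def using real_le_rsqrt by blast
    have "b\<^sup>2 \<le> Q / t" using abQ t by (simp add: field_simps) (smt (verit) zero_le_power2)
    then have b\<beta>: "b \<le> \<beta>" unfolding \<beta>_def using real_le_rsqrt by blast
    obtain w where w: "test_function \<Omega> w" "L2_norm UNIV (\<lambda>x. w x - \<psi> x) \<le> \<epsilon> h * a"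
      "L2_norm UNIV (grad w) \<le> (1 + \<epsilon> h) * a"
      using approx[OF h0 h(2) test_function_mono[OF \<psi>(1) \<Omega>h(4)[OF h(1)]]] unfolding \<epsilon>_def a_def by blast
    have \<epsilon>0: "0 \<le> \<epsilon> h" using C by (simp add: \<epsilon>_def)
    have \<tau>0: "0 \<le> \<tau> h" using \<epsilon>0 d0 Q0 by (simp add: \<tau>_def \<alpha>_def)
    have L2u: "L2_on \<Omega> u" "L2_on \<Omega> (uh h)"
      using L2_on_subset[OF L2(2) \<Omega>B m\<Omega> mB] L2_on_subset[OF L2(1)[OF h(1)] \<Omega>B m\<Omega> mB] by auto
    note L2t = test_function_L2_on(1)[OF w(1)] test_function_L2_on(1)[OF \<psi>(1)]
    have g: "L2_norm \<Omega> (grad w) \<le> (1 + \<epsilon> h) * a"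
      using L2_norm_UNIV[OF m\<Omega> test_function_outside(2)[OF w(1)]] w(3) by simp
    have 1: "L2_norm \<Omega> (\<lambda>x. u x - w x) \<le> L2_norm \<Omega> (\<lambda>x. u x - uh h x) + L2_norm \<Omega> (\<lambda>x. uh h x - w x)"
      by (rule L2_norm_triangle_diff[OF L2u L2t(1)[OF m\<Omega>]])
    have 2: "L2_norm \<Omega> (\<lambda>x. uh h x - w x) \<le> L2_norm \<Omega> (\<lambda>x. uh h x - \<psi> x) + L2_norm \<Omega> (\<lambda>x. \<psi> x - w x)"
      by (rule L2_norm_triangle_diff[OF L2u(2) L2t(2)[OF m\<Omega>] L2t(1)[OF m\<Omega>]])
    have 3: "L2_norm \<Omega> (\<lambda>x. u x - uh h x) \<le> d h"
      unfolding d_def L2_norm_minus_commute[of \<Omega> u]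
      by (rule L2_norm_subset_le[OF L2_on_diff[OF L2(1)[OF h(1)] L2(2)] \<Omega>B m\<Omega> mB])
    have 4: "L2_norm \<Omega> (\<lambda>x. uh h x - \<psi> x) \<le> b"
      unfolding b_def
      by (rule L2_norm_subset_le[OF L2_on_diff[OF L2h L2t(2)[OF mh[OF h(1)]]] \<Omega>h(2)[OF h(1)] m\<Omega> mh[OF h(1)]])
    have 5: "L2_norm \<Omega> (\<lambda>x. \<psi> x - w x) \<le> \<epsilon> h * a"
      unfolding L2_norm_minus_commute[of \<Omega> \<psi>]
      by (rule order_trans[OF L2_norm_subset_le[OF L2_on_diff[OF L2t] subset_UNIV m\<Omega>] w(2)]) auto
    have 6: "\<epsilon> h * a \<le> \<epsilon> h * \<alpha>" using a\<alpha> \<epsilon>0 by (rule mult_left_mono)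
    have f: "L2_norm \<Omega> (\<lambda>x. u x - w x) \<le> b + \<tau> h"
      using 1 2 3 4 5 6 unfolding \<tau>_def by linarith
    have "(L2_norm \<Omega> (grad w))\<^sup>2 + t * (L2_norm \<Omega> (\<lambda>x. u x - w x))\<^sup>2 \<le> ((1 + \<epsilon> h) * a)\<^sup>2 + t * (b + \<tau> h)\<^sup>2"
      using t by (intro add_mono mult_left_mono power_mono g f) auto
    also have "\<dots> = a\<^sup>2 + t * b\<^sup>2 + ((2 * \<epsilon> h + (\<epsilon> h)\<^sup>2) * a\<^sup>2 + t * (2 * b * \<tau> h + (\<tau> h)\<^sup>2))"
      by (simp add: power2_eq_square algebra_simps)
    also have "\<dots> \<le> a\<^sup>2 + t * b\<^sup>2 + ((2 * \<epsilon> h + (\<epsilon> h)\<^sup>2) * \<alpha>\<^sup>2 + t * (2 * \<beta> * \<tau> h + (\<tau> h)\<^sup>2))"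
      using t \<epsilon>0 \<tau>0 ab0 a\<alpha> b\<beta> by (intro add_mono mult_left_mono mult_right_mono power_mono) auto
    also have "\<dots> = a\<^sup>2 + t * b\<^sup>2 + (s h - 1 / real h)" by (simp add: s_def)
    finally have le: "(L2_norm \<Omega> (grad w))\<^sup>2 + t * (L2_norm \<Omega> (\<lambda>x. u x - w x))\<^sup>2
      \<le> a\<^sup>2 + t * b\<^sup>2 + (s h - 1 / real h)" .
    have sh: "0 \<le> s h - 1 / real h"
      using t \<epsilon>0 \<tau>0 ab0 b\<beta> by (simp add: s_def)
    have "K_functional \<Omega> lam \<phi> t u \<le> ennreal (a\<^sup>2 + t * b\<^sup>2 + (s h - 1 / real h))"
      using K_functional_le[OF o\<Omega> eig t L2u(1) w(1)] ennreal_leI[OF le] by (rule order_trans)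
    also have "\<dots> = ennreal (a\<^sup>2 + t * b\<^sup>2) + ennreal (s h - 1 / real h)"
      using t sh by (intro ennreal_plus) auto
    also have "\<dots> \<le> (?K h + ennreal (1 / real h)) + ennreal (s h - 1 / real h)"
      using ab by (rule add_right_mono)
    also have "\<dots> = ?K h + ennreal (s h)"
      using sh h0 by (simp add: add.assoc ennreal_plus[symmetric] del: ennreal_plus)
    finally show ?thesis .
  qed
  show ?thesis
  proof (rule ennreal_le_epsilon)
    fix e :: real assume e: "0 < e" and fin: "liminf ?K < top"
    have "\<forall>\<^sub>F h in sequentially. K_functional \<Omega> lam \<phi> t u - ennreal e \<le> ?K h"
      using eventually_ge_at_top[of "1::nat"] order_tendstoD(2)[OF inv_lim \<delta>0]
        order_tendstoD(2)[OF d_lim zero_less_one] order_tendstoD(2)[OF s_lim e]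
    proof eventually_elim
      case (elim h)
      have "K_functional \<Omega> lam \<phi> t u \<le> ?K h + ennreal (s h)" using elim by (intro main) auto
      also have "\<dots> \<le> ennreal e + ?K h"
        using elim by (subst add.commute) (intro add_right_mono ennreal_leI, simp)
      finally show ?case by (simp add: ennreal_minus_le_iff)
    qed
    then have "K_functional \<Omega> lam \<phi> t u - ennreal e \<le> liminf ?K" by (rule Liminf_bounded)
    then show "K_functional \<Omega> lam \<phi> t u \<le> liminf ?K + ennreal e"
      by (simp add: ennreal_minus_le_iff add.commute)
  qed
qed

subsection \<open>The spectral form as an integral of the K-functional\<close>

text \<open>
  The constant in \<open>\<mu>\<^sup>s = const \<integral> t\<^sup>s\<^sup>-\<^sup>2 (t\<mu> / (t + \<mu>)) dt\<close>; its value is irrelevant.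
\<close>

definition interp_const :: "real \<Rightarrow> ennreal" where
  "interp_const s = (\<integral>\<^sup>+t. ennreal (t powr (s - 2) * (t / (t + 1))) * indicator {0<..} t \<partial>lborel)"

text \<open>The integrand is dominated by \<open>t powr (s - 1)\<close> near 0 and by
  \<open>t powr (s - 2)\<close> at infinity; these are integrable there because \<open>0 < s\<close>
  and \<open>s < 1\<close>, respectively.\<close>

lemma interp_const_finite:
  assumes "0 < s" "s < 1"
  shows "interp_const s < top"
proof -
  have "interp_const s \<le> (\<integral>\<^sup>+t. ennreal (t powr (s - 1)) * indicator {0..1} t + ennreal (t powr (s - 2)) * indicator {1..} t \<partial>lborel)"
    unfolding interp_const_def
  proof (rule nn_integral_mono)
    fix t :: real
    show "ennreal (t powr (s - 2) * (t / (t + 1))) * indicator {0<..} t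
      \<le> ennreal (t powr (s - 1)) * indicator {0..1} t + ennreal (t powr (s - 2)) * indicator {1..} t"
    proof (cases "0 < t")
      case True
      have "t powr (s - 1) = t powr (s - 2) * t"
        using True powr_add[of t "s - 2" 1] by simp
      then have "t powr (s - 2) * (t / (t + 1)) \<le> t powr (s - 1)"
        using True by (auto simp: field_simps)
      moreover have "t powr (s - 2) * (t / (t + 1)) \<le> t powr (s - 2)"
        using True by (auto simp: field_simps)
      ultimately have "ennreal (t powr (s - 2) * (t / (t + 1))) \<le> ennreal (t powr (s - 1))"
        "ennreal (t powr (s - 2) * (t / (t + 1))) \<le> ennreal (t powr (s - 2))"
        by (auto intro: ennreal_leI)
      then show ?thesis
        using True by (cases t "1::real" rule: linorder_cases) (auto simp: add_increasing2 intro: order_trans[OF _ one_le_numeral])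
    qed simp
  qed
  also have "\<dots> = (\<integral>\<^sup>+t. ennreal (t powr (s - 1)) * indicator {0..1} t \<partial>lborel)
      + (\<integral>\<^sup>+t. ennreal (t powr (s - 2)) * indicator {1..} t \<partial>lborel)"
    by (rule nn_integral_add) auto
  also have "\<dots> < top"
    using nn_integral_has_integral_lebesgue'[OF _ has_integral_powr_from_0[of "s - 1" 1]]
      nn_integral_has_integral_lebesgue'[OF _ has_integral_powr_to_inf[of "s - 2" 1]] assms
    by simp
  finally show ?thesis .
qed

text \<open>Together with finiteness this permits division by the constant. On the interval from 1
  to 2 the integrand has a positive lower bound; the minimum of the end values covers both
  monotonicities of the power.\<close>

lemma interp_const_pos: "0 < interp_const s"
proof -
  have "0 < (\<integral>\<^sup>+t. ennreal (min (1 powr (s - 2)) (2 powr (s - 2)) / 3) * indicator {1..2::real} t \<partial>lborel)"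
    by (simp add: nn_integral_cmult)
  also have "\<dots> \<le> interp_const s"
    unfolding interp_const_def
  proof (rule nn_integral_mono)
    fix t :: real
    show "ennreal (min (1 powr (s - 2)) (2 powr (s - 2)) / 3) * indicator {1..2} t
      \<le> ennreal (t powr (s - 2) * (t / (t + 1))) * indicator {0<..} t"
    proof (cases "t \<in> {1..2}")
      case True
      have 1: "min (1 powr (s - 2)) (2 powr (s - 2)) \<le> t powr (s - 2)"
      proof (cases "s \<le> 2")
        case True
        then have "2 powr (s - 2) \<le> t powr (s - 2)"
          using \<open>t \<in> {1..2}\<close> by (intro powr_mono2') auto
        then show ?thesis by simp
      next
        case False
        then have "1 powr (s - 2) \<le> t powr (s - 2)"
          using \<open>t \<in> {1..2}\<close> by (intro powr_mono2) auto
        then show ?thesis by simp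
      qed
      have "1 / 3 \<le> t / (t + 1)" using True by (simp add: field_simps)
      with 1 have "min (1 powr (s - 2)) (2 powr (s - 2)) * (1 / 3) \<le> t powr (s - 2) * (t / (t + 1))"
        by (intro mult_mono) auto
      then show ?thesis using True by (simp add: ennreal_leI)
    qed simp
  qed
  finally show ?thesis .
qed

text \<open>Substituting \<open>\<mu> * t\<close> for \<open>t\<close> pulls out
  \<open>\<mu> * \<mu> powr (s - 1)\<close>. For \<open>\<mu> = 0\<close> both sides vanish, since
  \<open>0 powr s = 0\<close>.\<close>

lemma interp_const_powr:
  assumes "0 \<le> \<mu>"
  shows "(\<integral>\<^sup>+t. ennreal (t powr (s - 2) * (t * \<mu> / (t + \<mu>))) * indicator {0<..} t \<partial>lborel)
    = interp_const s * ennreal (\<mu> powr s)"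
proof (cases "\<mu> = 0")
  case False
  with assms have \<mu>: "0 < \<mu>" by simp
  have "(\<integral>\<^sup>+t. ennreal (t powr (s - 2) * (t * \<mu> / (t + \<mu>))) * indicator {0<..} t \<partial>lborel)
    = ennreal \<bar>\<mu>\<bar> * (\<integral>\<^sup>+t. ennreal ((0 + \<mu> * t) powr (s - 2) * ((0 + \<mu> * t) * \<mu> / ((0 + \<mu> * t) + \<mu>))) * indicator {0<..} (0 + \<mu> * t) \<partial>lborel)"
    using \<mu> by (intro nn_integral_real_affine) auto
  also have "\<dots> = ennreal \<mu> * (\<integral>\<^sup>+t. ennreal (\<mu> powr (s - 1)) * (ennreal (t powr (s - 2) * (t / (t + 1))) * indicator {0<..} t) \<partial>lborel)"
  proof -
    have "ennreal ((0 + \<mu> * t) powr (s - 2) * ((0 + \<mu> * t) * \<mu> / ((0 + \<mu> * t) + \<mu>))) * indicator {0<..} (0 + \<mu> * t)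
      = ennreal (\<mu> powr (s - 1)) * (ennreal (t powr (s - 2) * (t / (t + 1))) * indicator {0<..} t)" for t
    proof (cases "0 < t")
      case True
      have "\<mu> powr (s - 1) = \<mu> powr (s - 2) * \<mu>"
        using \<mu> powr_add[of \<mu> "s - 2" 1] by simp
      moreover have "\<mu> * t * \<mu> / (\<mu> * t + \<mu>) = \<mu> * (t / (t + 1))"
      proof -
        have "\<mu> * t * \<mu> / (\<mu> * t + \<mu>) = \<mu> * (\<mu> * t) / (\<mu> * (t + 1))" by (simp add: algebra_simps)
        also have "\<dots> = \<mu> * (t / (t + 1))" using \<mu> by simp
        finally show ?thesis .
      qed
      ultimately have "(\<mu> * t) powr (s - 2) * (\<mu> * t * \<mu> / (\<mu> * t + \<mu>)) = \<mu> powr (s - 1) * (t powr (s - 2) * (t / (t + 1)))"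
        using \<mu> True by (simp add: powr_mult)
      then show ?thesis using \<mu> True
        by (simp add: ennreal_mult'[symmetric] del: times_divide_eq_right times_divide_eq_left)
    next
      case False
      then have "\<not> 0 < \<mu> * t" using \<mu> by (simp add: zero_less_mult_iff)
      then show ?thesis using False by simp
    qed
    then show ?thesis using \<mu> by simp
  qed
  also have "\<dots> = ennreal \<mu> * (ennreal (\<mu> powr (s - 1)) * interp_const s)"
    unfolding interp_const_def by (subst nn_integral_cmult) auto
  also have "\<dots> = ennreal (\<mu> * \<mu> powr (s - 1)) * interp_const s"
    using \<mu> by (simp add: ennreal_mult' mult.assoc)
  also have "\<mu> * \<mu> powr (s - 1) = \<mu> powr s"
    using \<mu> powr_add[of \<mu> 1 "s - 1"] by simp
  finally show ?thesis by (simp add: mult.commute)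
qed simp

lemma borel_measurable_K_functional [measurable]:
  "(\<lambda>t. K_functional A lam \<phi> t w) \<in> borel_measurable borel"
  unfolding K_functional_def by measurable

text \<open>All terms are nonnegative, so the series and the integral over \<open>t\<close> may be
  exchanged, also when the form is infinite; each mode is then
  \<open>interp_const_powr\<close>.\<close>

lemma interp_const_navier_form:
  assumes lam: "\<And>j. 0 \<le> lam j"
  shows "interp_const s * navier_form s A lam \<phi> w
    = (\<integral>\<^sup>+t. ennreal (t powr (s - 2)) * indicator {0<..} t * K_functional A lam \<phi> t w \<partial>lborel)"
proof -
  define c where "c j = (L2_inner A w (\<phi> j))\<^sup>2" for j
  have "(\<integral>\<^sup>+t. ennreal (t powr (s - 2)) * indicator {0<..} t * K_functional A lam \<phi> t w \<partial>lborel)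
    = (\<integral>\<^sup>+t. (\<Sum>j. ennreal (t powr (s - 2) * (t * lam j / (t + lam j))) * indicator {0<..} t * ennreal (c j)) \<partial>lborel)"
  proof (rule nn_integral_cong)
    fix t :: real
    have "ennreal (t powr (s - 2)) * indicator {0<..} t * ennreal (t * lam j / (t + lam j) * c j)
      = ennreal (t powr (s - 2) * (t * lam j / (t + lam j))) * indicator {0<..} t * ennreal (c j)" for j
      using lam[of j] by (cases "0 < t") (auto simp: ennreal_mult'[symmetric] c_def mult.assoc ennreal_mult''[symmetric])
    then show "ennreal (t powr (s - 2)) * indicator {0<..} t * K_functional A lam \<phi> t w
      = (\<Sum>j. ennreal (t powr (s - 2) * (t * lam j / (t + lam j))) * indicator {0<..} t * ennreal (c j))"
      unfolding K_functional_def c_def[symmetric] ennreal_suminf_cmult[symmetric] by simp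
  qed
  also have "\<dots> = (\<Sum>j. \<integral>\<^sup>+t. ennreal (t powr (s - 2) * (t * lam j / (t + lam j))) * indicator {0<..} t * ennreal (c j) \<partial>lborel)"
    by (rule nn_integral_suminf) measurable
  also have "\<dots> = (\<Sum>j. interp_const s * ennreal (lam j powr s) * ennreal (c j))"
    by (subst nn_integral_multc, measurable) (simp only: interp_const_powr[OF lam])
  also have "\<dots> = interp_const s * navier_form s A lam \<phi> w"
    unfolding navier_form_def c_def[symmetric] ennreal_suminf_cmult[symmetric]
    by (simp add: ennreal_mult' mult.assoc)
  finally show ?thesis ..
qed

lemma navier_form_le_liminf:
  fixes A :: "'a::euclidean_space set" and Ah :: "nat \<Rightarrow> 'a set"
  assumes s: "0 < s" "s < 1" and lam: "\<And>j. 0 \<le> lam j" "\<And>h j. h \<ge> 1 \<Longrightarrow> 0 \<le> lamh h j"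
    and K: "\<And>t. 0 < t \<Longrightarrow> K_functional A lam \<phi> t w \<le> liminf (\<lambda>h. K_functional (Ah h) (lamh h) (\<phi>h h) t (wh h))"
  shows "navier_form s A lam \<phi> w \<le> liminf (\<lambda>h. navier_form s (Ah h) (lamh h) (\<phi>h h) (wh h))"
proof -
  obtain k where k: "interp_const s = ennreal k" "0 < k"
    using interp_const_finite[OF s] interp_const_pos[of s] by (cases "interp_const s") auto
  define \<kappa> where "\<kappa> t = ennreal (1 / k) * (ennreal (t powr (s - 2)) * indicator {0<..} t)" for t :: real
  have 1: "ennreal (1 / k) * ennreal k = 1" using k(2) by (simp add: ennreal_mult'[symmetric])
  have eq: "navier_form s A' lam' \<phi>' w' = (\<integral>\<^sup>+t. \<kappa> t * K_functional A' lam' \<phi>' t w' \<partial>lborel)"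
    if "\<And>j. 0 \<le> lam' j" for A' :: "'a set" and lam' \<phi>' w'
  proof -
    have "navier_form s A' lam' \<phi>' w' = ennreal (1 / k) * (interp_const s * navier_form s A' lam' \<phi>' w')"
      unfolding k mult.assoc[symmetric] 1 by simp
    then show ?thesis
      unfolding interp_const_navier_form[OF that] \<kappa>_def mult.assoc
      by (subst nn_integral_cmult) auto
  qed
  have "\<kappa> t * K_functional A lam \<phi> t w \<le> liminf (\<lambda>h. \<kappa> t * K_functional (Ah h) (lamh h) (\<phi>h h) t (wh h))" for t
  proof (cases "0 < t")
    case True
    then have \<kappa>: "\<kappa> t = ennreal (1 / k * t powr (s - 2))" using k(2) by (simp add: \<kappa>_def ennreal_mult'[symmetric])
    \<comment> \<open>Multiplication by a finite constant is continuous and monotone on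
      \<open>ennreal\<close>, hence commutes with the lower limit.\<close>
    have "continuous_on UNIV (\<lambda>x. \<kappa> t * x)"
      unfolding \<kappa> by (intro ennreal_continuous_on_cmult continuous_on_id) simp
    then have "liminf (\<lambda>h. \<kappa> t * K_functional (Ah h) (lamh h) (\<phi>h h) t (wh h))
      = \<kappa> t * liminf (\<lambda>h. K_functional (Ah h) (lamh h) (\<phi>h h) t (wh h))"
      by (rule Liminf_compose_continuous_mono) (auto simp: mono_def mult_left_mono)
    then show ?thesis using K[OF True] by (simp add: mult_left_mono)
  qed (simp add: \<kappa>_def)
  then have "navier_form s A lam \<phi> w \<le> (\<integral>\<^sup>+t. liminf (\<lambda>h. \<kappa> t * K_functional (Ah h) (lamh h) (\<phi>h h) t (wh h)) \<partial>lborel)"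
    unfolding eq[OF lam(1)] by (rule nn_integral_mono)
  also have "\<dots> \<le> liminf (\<lambda>h. \<integral>\<^sup>+t. \<kappa> t * K_functional (Ah h) (lamh h) (\<phi>h h) t (wh h) \<partial>lborel)"
    by (rule nn_integral_liminf) (simp add: \<kappa>_def)
  \<comment> \<open>Nonnegative eigenvalues are assumed from index 1 on, so the integral
    representation is used only eventually.\<close>
  also have "\<dots> = liminf (\<lambda>h. navier_form s (Ah h) (lamh h) (\<phi>h h) (wh h))"
    by (intro Liminf_eq eventually_sequentiallyI[of 1]) (rule eq[OF lam(2), symmetric])
  finally show ?thesis .
qed

subsection \<open>Vanishing outside the domain\<close>

text \<open>Near a boundary point the frontier lies on a graph, a Lipschitz image of a hyperplane.\<close>

lemma negligible_frontier_lipschitz: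
  fixes \<Omega> :: "'a::euclidean_space set"
  assumes "bounded_lipschitz_domain \<Omega>"
  shows "negligible (frontier \<Omega>)"
proof -
  obtain L r where \<Omega>: "open \<Omega>" "lipschitz_boundary L r \<Omega>" "0 < r" "bounded \<Omega>"
    using assms unfolding bounded_lipschitz_domain_def domain_def by blast
  have local: "negligible (frontier \<Omega> \<inter> ball p r)" if p: "p \<in> frontier \<Omega>" for p
  proof -
    obtain e \<gamma> where e: "norm e = 1" and lip: "L-lipschitz_on {y. y \<bullet> e = 0} \<gamma>"
      and graph: "\<Omega> \<inter> ball p r = {x \<in> ball p r. \<gamma> (x - (x \<bullet> e) *\<^sub>R e) < x \<bullet> e}"
      using \<Omega>(2) p unfolding lipschitz_boundary_def by blast
    have ee: "e \<bullet> e = 1" using e by (simp add: dot_square_norm)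
    define P where "P v = v - (v \<bullet> e) *\<^sub>R e" for v
    have P0: "P v \<in> {y. y \<bullet> e = 0}" for v by (simp add: P_def inner_diff_left ee)
    have "continuous_on UNIV (\<lambda>x. \<gamma> (P x))"
      by (rule continuous_on_compose2[OF lipschitz_on_continuous_on[OF lip], of UNIV P])
         (use P0 in \<open>auto simp: P_def intro!: continuous_intros\<close>)
    then have cont: "continuous_on UNIV (\<lambda>x. \<gamma> (P x) - x \<bullet> e)" by (intro continuous_intros)
    have "frontier \<Omega> \<inter> ball p r \<subseteq> (\<lambda>y. y + \<gamma> y *\<^sub>R e) ` {y. e \<bullet> y = 0}"
    proof
      fix x assume x: "x \<in> frontier \<Omega> \<inter> ball p r"
      then have xc: "x \<in> closure \<Omega>" "x \<notin> \<Omega>" using \<Omega>(1) by (auto simp: frontier_def interior_open)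
      \<comment> \<open>Outside \<open>\<Omega>\<close> means not strictly above the graph. Strictly
        below is impossible as well, since a neighbourhood of \<open>x\<close> would then miss
        \<open>\<Omega>\<close>.\<close>
      then have "x \<bullet> e \<le> \<gamma> (P x)" using graph x unfolding P_def by fastforce
      moreover have "\<not> x \<bullet> e < \<gamma> (P x)"
      proof
        assume "x \<bullet> e < \<gamma> (P x)"
        define U where "U = {x. 0 < \<gamma> (P x) - x \<bullet> e} \<inter> ball p r"
        have "open U" unfolding U_def
          by (intro open_Int open_ball open_Collect_less cont continuous_on_const)
        moreover have "x \<in> U" using \<open>x \<bullet> e < \<gamma> (P x)\<close> x by (simp add: U_def)
        ultimately obtain z where "z \<in> \<Omega>" "z \<in> U"
          using xc(1) by (meson closure_iff_nhds_not_empty disjoint_iff open_subset subset_refl)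
        then have "\<gamma> (P z) < z \<bullet> e" using graph unfolding U_def P_def by blast
        with \<open>z \<in> U\<close> show False by (simp add: U_def)
      qed
      ultimately have "x = P x + \<gamma> (P x) *\<^sub>R e" by (simp add: P_def)
      then show "x \<in> (\<lambda>y. y + \<gamma> y *\<^sub>R e) ` {y. e \<bullet> y = 0}" using P0[of x] by (auto simp: inner_commute)
    qed
    \<comment> \<open>The hyperplane is already null in the full space, and the graph map is
      Lipschitz on it.\<close>
    moreover have "negligible ((\<lambda>y. y + \<gamma> y *\<^sub>R e) ` {y. e \<bullet> y = 0})"
    proof (rule negligible_locally_Lipschitz_image)
      show "negligible {y. e \<bullet> y = 0}" using e by (intro negligible_hyperplane) auto
      fix x assume "x \<in> {y. e \<bullet> y = 0}"
      have "norm (y + \<gamma> y *\<^sub>R e - (x + \<gamma> x *\<^sub>R e)) \<le> (1 + L) * norm (y - x)" if "y \<in> {y. e \<bullet> y = 0}" for y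
      proof -
        have "norm (y + \<gamma> y *\<^sub>R e - (x + \<gamma> x *\<^sub>R e)) = norm ((y - x) + (\<gamma> y - \<gamma> x) *\<^sub>R e)"
          by (simp add: algebra_simps)
        also have "\<dots> \<le> norm (y - x) + \<bar>\<gamma> y - \<gamma> x\<bar>"
          using norm_triangle_ineq[of "y - x" "(\<gamma> y - \<gamma> x) *\<^sub>R e"] e by simp
        also have "\<bar>\<gamma> y - \<gamma> x\<bar> \<le> L * norm (y - x)"
          using lipschitz_onD[OF lip, of y x] that \<open>x \<in> _\<close> by (simp add: dist_norm inner_commute)
        finally show ?thesis by (simp add: algebra_simps)
      qed
      then show "\<exists>T B. open T \<and> x \<in> T \<and> (\<forall>y \<in> {y. e \<bullet> y = 0} \<inter> T. norm (y + \<gamma> y *\<^sub>R e - (x + \<gamma> x *\<^sub>R e)) \<le> B * norm (y - x))"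
        by (intro exI[of _ UNIV] exI[of _ "1 + L"]) auto
    qed simp
    ultimately show ?thesis by (rule negligible_subset[rotated])
  qed
  have "compact (frontier \<Omega>)" using \<Omega>(4) by (rule compact_frontier_bounded)
  moreover have "frontier \<Omega> \<subseteq> (\<Union>p\<in>frontier \<Omega>. ball p r)" using \<Omega>(3) by force
  ultimately obtain D where D: "D \<subseteq> frontier \<Omega>" "finite D" "frontier \<Omega> \<subseteq> (\<Union>p\<in>D. ball p r)"
    using compactE_image[of "frontier \<Omega>" "frontier \<Omega>" "\<lambda>p. ball p r"] by (metis open_ball)
  then have "frontier \<Omega> \<subseteq> (\<Union>p\<in>D. frontier \<Omega> \<inter> ball p r)" by blast
  moreover have "negligible (\<Union>p\<in>D. frontier \<Omega> \<inter> ball p r)"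
    using D(1,2) local by (intro negligible_Union) auto
  ultimately show ?thesis by (rule negligible_subset[rotated])
qed

lemma L2_norm_eq_0_AE:
  fixes f :: "'a::euclidean_space \<Rightarrow> real"
  assumes "L2_on A f" "L2_norm A f = 0" "A \<in> sets lebesgue"
  shows "AE x in lebesgue. x \<in> A \<longrightarrow> f x = 0"
proof -
  have "integrable (lebesgue_on A) (\<lambda>x. (f x)\<^sup>2)" "(LINT x|lebesgue_on A. (f x)\<^sup>2) = 0"
    using assms by (auto simp: L2_on_def L2_norm_def L2_inner_self)
  then have "AE x in lebesgue_on A. (f x)\<^sup>2 = 0"
    by (subst (asm) integral_nonneg_eq_0_iff_AE) auto
  then show ?thesis using assms(3) by (simp add: AE_restrict_space_iff)
qed

text \<open>The sets \<open>S m\<close> exhaust the points of \<open>B\<close> off the closure of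
  \<open>\<Omega>\<close>. From \<open>h = Suc m\<close> on, \<open>uh h\<close> vanishes almost
  everywhere on \<open>S m\<close>, so the L2 norm of \<open>u\<close> there is at most the distance
  from \<open>uh h\<close> to \<open>u\<close>.\<close>

lemma AE_eq_0_outside_closure:
  fixes \<Omega> B :: "'a::euclidean_space set" and \<Omega>h :: "nat \<Rightarrow> 'a set"
    and u :: "'a \<Rightarrow> real" and uh :: "nat \<Rightarrow> 'a \<Rightarrow> real"
  assumes B: "B \<in> sets lebesgue" and ne: "\<Omega> \<noteq> {}"
    and \<Omega>h: "\<And>h. h \<ge> 1 \<Longrightarrow> \<Omega>h h \<subseteq> {x. infdist x \<Omega> < 1 / real h}"
    and L2: "\<And>h. h \<ge> 1 \<Longrightarrow> L2_on B (uh h)" "L2_on B u" and conv: "L2_converges B uh u"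
    and zero: "\<And>h. h \<ge> 1 \<Longrightarrow> AE x in lebesgue. x \<notin> closure (\<Omega>h h) \<longrightarrow> uh h x = 0"
  shows "AE x in lebesgue. x \<in> B \<longrightarrow> x \<notin> closure \<Omega> \<longrightarrow> u x = 0"
proof -
  define S where "S m = B \<inter> {x. 1 / real (Suc m) < infdist x \<Omega>}" for m
  have S: "S m \<in> sets lebesgue" for m
  proof -
    have "open {x. 1 / real (Suc m) < infdist x \<Omega>}"
      by (rule open_Collect_less) (auto intro!: continuous_intros)
    then show ?thesis unfolding S_def using B by auto
  qed
  have sub: "S m \<subseteq> B" for m by (auto simp: S_def)
  have L2S: "L2_on (S m) u" for m by (rule L2_on_subset[OF L2(2) sub S B])
  have "L2_norm (S m) u \<le> L2_norm B (\<lambda>x. uh h x - u x)" if "h \<ge> Suc m" for m h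
  proof -
    have h1: "1 \<le> h" using that by simp
    \<comment> \<open>Passing to the closure loses strictness; the strict inequality in
      \<open>S m\<close> makes up for it.\<close>
    have "closure (\<Omega>h h) \<subseteq> {x. infdist x \<Omega> \<le> 1 / real h}"
      by (rule closure_minimal) (use \<Omega>h[OF h1] in \<open>auto intro!: closed_Collect_le continuous_intros\<close>)
    moreover have "1 / real h \<le> 1 / real (Suc m)" using that by (intro divide_left_mono) auto
    ultimately have out: "x \<notin> closure (\<Omega>h h)" if "x \<in> S m" for x
      using that unfolding S_def by fastforce
    have "AE x in lebesgue_on (S m). (norm (u x))\<^sup>2 = (norm (uh h x - u x))\<^sup>2"
      using zero[OF h1] out S[of m] by (auto simp: AE_restrict_space_iff)
    then have "L2_inner (S m) u u = L2_inner (S m) (\<lambda>x. uh h x - u x) (\<lambda>x. uh h x - u x)"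
      unfolding L2_inner_self
      using L2S L2_on_subset[OF L2_on_diff[OF L2(1)[OF h1] L2(2)] sub S B]
      by (intro integral_cong_AE) (auto simp: L2_on_def)
    then have "L2_norm (S m) u = L2_norm (S m) (\<lambda>x. uh h x - u x)" by (simp add: L2_norm_def)
    also have "\<dots> \<le> L2_norm B (\<lambda>x. uh h x - u x)"
      by (rule L2_norm_subset_le[OF L2_on_diff[OF L2(1)[OF h1] L2(2)] sub S B])
    finally show ?thesis .
  qed
  then have "L2_norm (S m) u \<le> 0" for m
    using conv unfolding L2_converges_iff by (intro LIMSEQ_le_const) auto
  then have "L2_norm (S m) u = 0" for m by (simp add: antisym)
  then have "AE x in lebesgue. x \<in> S m \<longrightarrow> u x = 0" for m
    using L2_norm_eq_0_AE[OF L2S] S by blast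
  then have "AE x in lebesgue. \<forall>m. x \<in> S m \<longrightarrow> u x = 0" by (subst AE_all_countable) blast
  then show ?thesis
  proof (rule AE_mp, intro always_eventually allI impI)
    fix x assume *: "\<forall>m. x \<in> S m \<longrightarrow> u x = 0" and x: "x \<in> B" "x \<notin> closure \<Omega>"
    then have "0 < infdist x \<Omega>"
      using in_closure_iff_infdist_zero[OF ne, of x] infdist_nonneg[of x \<Omega>] by linarith
    then obtain m where "1 / real (Suc m) < infdist x \<Omega>"
      using reals_Archimedean by (auto simp: inverse_eq_divide)
    then show "u x = 0" using * x(1) by (auto simp: S_def)
  qed
qed

subsection \<open>The Gagliardo seminorm\<close>

text \<open>
  The radial weight is written as \<open>\<bar>y\<bar>\<^sup>-\<^sup>n\<^sup>-\<^sup>2\<^sup>s = (n + 2s) \<integral> \<rho>\<^sup>-\<^sup>n\<^sup>-\<^sup>2\<^sup>s\<^sup>-\<^sup>1 d\<rho>\<close> over \<open>\<rho> \<ge> \<bar>y\<bar>\<close>; Fubini then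
  only needs the volume of balls, and no polar coordinates.
\<close>

lemma radial_kernel_bound:
  fixes s \<mu> :: real
  defines "n \<equiv> real DIM('a::euclidean_space)"
  assumes s: "0 < s" "s < 1" and \<mu>: "0 \<le> \<mu>"
  shows "(\<integral>\<^sup>+y. ennreal (norm y powr - (n + 2 * s) * (\<mu> * (norm y)\<^sup>2 / (1 + \<mu> * (norm y)\<^sup>2))) \<partial>(lborel :: 'a measure))
    \<le> ennreal ((n + 2 * s) * unit_ball_vol n * (1 / (2 - 2 * s) + 1 / (2 * s)) * \<mu> powr s)"
proof (cases "\<mu> = 0")
  case False
  with \<mu> have \<mu>0: "0 < \<mu>" by simp
  have n: "0 < n" by (simp add: n_def)
  define p where "p = n + 2 * s"
  have p: "0 < p" using n s by (simp add: p_def)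
  define F where "F \<rho> = \<mu> * \<rho>\<^sup>2 / (1 + \<mu> * \<rho>\<^sup>2)" for \<rho> :: real
  have den: "0 < 1 + \<mu> * \<rho>\<^sup>2" for \<rho> :: real using \<mu> by (simp add: add_pos_nonneg)
  have F0: "0 \<le> F \<rho>" for \<rho> using \<mu> den[of \<rho>] by (simp add: F_def)
  have F1: "F \<rho> \<le> 1" for \<rho> using den[of \<rho>] by (simp add: F_def)
  have F2: "F \<rho> \<le> \<mu> * \<rho>\<^sup>2" for \<rho>
    using den[of \<rho>] \<mu> by (simp add: F_def divide_le_eq algebra_simps)
  \<comment> \<open>Monotonicity allows \<open>F (norm y)\<close> to be replaced by
    \<open>F \<rho>\<close> inside the integral over \<open>\<rho> \<ge> norm y\<close>.\<close>
  have F_mono: "F \<rho> \<le> F \<rho>'" if "0 \<le> \<rho>" "\<rho> \<le> \<rho>'" for \<rho> \<rho>'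
  proof -
    have "\<mu> * \<rho>\<^sup>2 \<le> \<mu> * \<rho>'\<^sup>2" using that \<mu> by (intro mult_left_mono power_mono)
    then have "1 - 1 / (1 + \<mu> * \<rho>\<^sup>2) \<le> 1 - 1 / (1 + \<mu> * \<rho>'\<^sup>2)"
      using den[of \<rho>] by (intro diff_left_mono divide_left_mono) (auto intro: mult_pos_pos den)
    moreover have "F \<rho> = 1 - 1 / (1 + \<mu> * \<rho>\<^sup>2)" for \<rho>
      using den[of \<rho>] by (simp add: F_def field_simps)
    ultimately show ?thesis by simp
  qed
  define g where "g \<rho> = p * (\<rho> powr (- p - 1) * F \<rho>)" for \<rho>
  have g0: "0 \<le> g \<rho>" for \<rho> using p F0 by (simp add: g_def)
  have [measurable]: "F \<in> borel_measurable borel" "g \<in> borel_measurable borel"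
    unfolding F_def[abs_def] g_def[abs_def] by measurable
  have pointwise: "ennreal (norm y powr - p * F (norm y)) \<le> (\<integral>\<^sup>+\<rho>. (if norm y \<le> \<rho> then ennreal (g \<rho>) else 0) \<partial>lborel)"
    for y :: 'a
  \<comment> \<open>At \<open>y = 0\<close> the left-hand side is 0, because a power of 0 is 0 also
    for a negative exponent.\<close>
  proof (cases "y = 0")
    case False
    have "ennreal (norm y powr - p * F (norm y)) = ennreal (p * F (norm y)) * ennreal (- (norm y powr (- p - 1 + 1)) / (- p - 1 + 1))"
      using p F0[of "norm y"] by (simp add: ennreal_mult'[symmetric])
    also have "\<dots> = ennreal (p * F (norm y)) * (\<integral>\<^sup>+\<rho>. ennreal (\<rho> powr (- p - 1)) * indicator {norm y..} \<rho> \<partial>lborel)"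
      using False p by (subst nn_integral_has_integral_lebesgue'[OF _ has_integral_powr_to_inf]) auto
    also have "\<dots> = (\<integral>\<^sup>+\<rho>. ennreal (p * F (norm y)) * (ennreal (\<rho> powr (- p - 1)) * indicator {norm y..} \<rho>) \<partial>lborel)"
      by (rule nn_integral_cmult[symmetric]) measurable
    also have "\<dots> \<le> (\<integral>\<^sup>+\<rho>. (if norm y \<le> \<rho> then ennreal (g \<rho>) else 0) \<partial>lborel)"
    proof (rule nn_integral_mono)
      fix \<rho> :: real
      show "ennreal (p * F (norm y)) * (ennreal (\<rho> powr (- p - 1)) * indicator {norm y..} \<rho>)
        \<le> (if norm y \<le> \<rho> then ennreal (g \<rho>) else 0)"
      proof (cases "norm y \<le> \<rho>")
        case True
        have "p * F (norm y) * \<rho> powr (- p - 1) \<le> p * F \<rho> * \<rho> powr (- p - 1)"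
          using F_mono[OF norm_ge_zero True] p by (intro mult_right_mono mult_left_mono) auto
        then have "ennreal (p * F (norm y) * \<rho> powr (- p - 1)) \<le> ennreal (g \<rho>)"
          by (intro ennreal_leI) (simp add: g_def ac_simps)
        then show ?thesis using True p F0 by (simp add: ennreal_mult'')
      qed simp
    qed
    finally show ?thesis .
  qed (use p in simp)
  define v where "v = unit_ball_vol n"
  have v0: "0 \<le> v" using n by (simp add: v_def)
  have "(\<integral>\<^sup>+y. ennreal (norm y powr - p * F (norm y)) \<partial>(lborel :: 'a measure))
    \<le> (\<integral>\<^sup>+(y::'a). (\<integral>\<^sup>+\<rho>. (if norm y \<le> \<rho> then ennreal (g \<rho>) else 0) \<partial>lborel) \<partial>lborel)"
    by (intro nn_integral_mono pointwise)
  also have "\<dots> = (\<integral>\<^sup>+\<rho>. (\<integral>\<^sup>+(y::'a). (if norm y \<le> \<rho> then ennreal (g \<rho>) else 0) \<partial>lborel) \<partial>lborel)"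
    by (rule lborel_pair.Fubini'[symmetric]) measurable
  \<comment> \<open>\<open>\<mu> powr (- 1 / 2)\<close> is where the two bounds on \<open>F\<close>,
    namely \<open>\<mu> * \<rho>\<^sup>2\<close> and 1, coincide; the first gives an integrable
    majorant near 0, the second near infinity.\<close>
  also have "\<dots> \<le> (\<integral>\<^sup>+\<rho>. ennreal (p * v) * (ennreal (\<mu> * \<rho> powr (1 - 2 * s)) * indicator {0..\<mu> powr (- 1 / 2)} \<rho>
      + ennreal (\<rho> powr (- 2 * s - 1)) * indicator {\<mu> powr (- 1 / 2)..} \<rho>) \<partial>lborel)"
  proof (rule nn_integral_mono)
    fix \<rho> :: real
    have "(\<integral>\<^sup>+(y::'a). (if norm y \<le> \<rho> then ennreal (g \<rho>) else 0) \<partial>lborel)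
      = (\<integral>\<^sup>+(y::'a). ennreal (g \<rho>) * indicator (cball 0 \<rho>) y \<partial>lborel)"
      by (rule nn_integral_cong) (auto simp: indicator_def)
    also have "\<dots> = ennreal (g \<rho>) * emeasure lborel (cball (0::'a) \<rho>)"
      by (rule nn_integral_cmult_indicator) simp
    also have "\<dots> \<le> ennreal (p * v) * (ennreal (\<mu> * \<rho> powr (1 - 2 * s)) * indicator {0..\<mu> powr (- 1 / 2)} \<rho>
      + ennreal (\<rho> powr (- 2 * s - 1)) * indicator {\<mu> powr (- 1 / 2)..} \<rho>)"
    proof (cases "0 < \<rho>")
      case True
      have "emeasure lborel (cball (0::'a) \<rho>) = ennreal (v * \<rho> ^ DIM('a))"
        using True by (simp add: emeasure_cball v_def n_def)
      also have "\<rho> ^ DIM('a) = \<rho> powr n" using True by (simp add: n_def powr_realpow)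
      finally have "ennreal (g \<rho>) * emeasure lborel (cball (0::'a) \<rho>) = ennreal (g \<rho> * (v * \<rho> powr n))"
        using g0 by (simp add: ennreal_mult'[symmetric])
      also have "g \<rho> * (v * \<rho> powr n) = p * v * (\<rho> powr (- 2 * s - 1) * F \<rho>)"
      proof -
        have "\<rho> powr (- p - 1) * \<rho> powr n = \<rho> powr (- 2 * s - 1)"
          by (simp add: powr_add[symmetric] p_def)
        moreover have "g \<rho> * (v * \<rho> powr n) = p * v * ((\<rho> powr (- p - 1) * \<rho> powr n) * F \<rho>)"
          by (simp add: g_def ac_simps)
        ultimately show ?thesis by simp
      qed
      also have "ennreal \<dots> = ennreal (p * v) * ennreal (\<rho> powr (- 2 * s - 1) * F \<rho>)"
        using p v0 by (intro ennreal_mult') simp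
      also have "\<dots> \<le> ennreal (p * v) * (ennreal (\<mu> * \<rho> powr (1 - 2 * s)) * indicator {0..\<mu> powr (- 1 / 2)} \<rho>
        + ennreal (\<rho> powr (- 2 * s - 1)) * indicator {\<mu> powr (- 1 / 2)..} \<rho>)"
      proof (rule mult_left_mono)
        have "\<rho> powr (- 2 * s - 1) * F \<rho> \<le> \<rho> powr (- 2 * s - 1) * (\<mu> * \<rho>\<^sup>2)"
          by (intro mult_left_mono F2) simp
        also have "\<dots> = \<mu> * \<rho> powr (1 - 2 * s)"
          using True powr_add[of \<rho> "- 2 * s - 1" 2] by (simp add: powr_numeral algebra_simps)
        finally have 1: "ennreal (\<rho> powr (- 2 * s - 1) * F \<rho>) \<le> ennreal (\<mu> * \<rho> powr (1 - 2 * s))"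
          by (rule ennreal_leI)
        have "\<rho> powr (- 2 * s - 1) * F \<rho> \<le> \<rho> powr (- 2 * s - 1) * 1"
          by (intro mult_left_mono F1) simp
        then have 2: "ennreal (\<rho> powr (- 2 * s - 1) * F \<rho>) \<le> ennreal (\<rho> powr (- 2 * s - 1))"
          by (intro ennreal_leI) simp
        show "ennreal (\<rho> powr (- 2 * s - 1) * F \<rho>) \<le> ennreal (\<mu> * \<rho> powr (1 - 2 * s)) * indicator {0..\<mu> powr (- 1 / 2)} \<rho>
          + ennreal (\<rho> powr (- 2 * s - 1)) * indicator {\<mu> powr (- 1 / 2)..} \<rho>"
        proof (cases "\<rho> \<le> \<mu> powr (- 1 / 2)")
          case True
          then have "ennreal (\<rho> powr (- 2 * s - 1) * F \<rho>) \<le> ennreal (\<mu> * \<rho> powr (1 - 2 * s)) * indicator {0..\<mu> powr (- 1 / 2)} \<rho>"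
            using 1 \<open>0 < \<rho>\<close> by simp
          then show ?thesis by (rule add_increasing2[rotated]) simp
        next
          case False
          then have "ennreal (\<rho> powr (- 2 * s - 1) * F \<rho>) \<le> ennreal (\<rho> powr (- 2 * s - 1)) * indicator {\<mu> powr (- 1 / 2)..} \<rho>"
            using 2 by simp
          then show ?thesis by (rule add_increasing[rotated]) simp
        qed
      qed simp
      finally show ?thesis .
    next
      case False
      then have "g \<rho> = 0 \<or> cball (0::'a) \<rho> = {}"
        by (cases "\<rho> = 0") (auto simp: g_def)
      then show ?thesis by auto
    qed
    finally show "(\<integral>\<^sup>+(y::'a). (if norm y \<le> \<rho> then ennreal (g \<rho>) else 0) \<partial>lborel)
      \<le> ennreal (p * v) * (ennreal (\<mu> * \<rho> powr (1 - 2 * s)) * indicator {0..\<mu> powr (- 1 / 2)} \<rho>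
      + ennreal (\<rho> powr (- 2 * s - 1)) * indicator {\<mu> powr (- 1 / 2)..} \<rho>)" .
  qed
  also have "\<dots> = ennreal (p * v) * ((\<integral>\<^sup>+\<rho>. ennreal (\<mu> * \<rho> powr (1 - 2 * s)) * indicator {0..\<mu> powr (- 1 / 2)} \<rho> \<partial>lborel)
      + (\<integral>\<^sup>+\<rho>. ennreal (\<rho> powr (- 2 * s - 1)) * indicator {\<mu> powr (- 1 / 2)..} \<rho> \<partial>lborel))"
    by (subst nn_integral_cmult, measurable) (subst nn_integral_add, auto)
  also have "(\<integral>\<^sup>+\<rho>. ennreal (\<mu> * \<rho> powr (1 - 2 * s)) * indicator {0..\<mu> powr (- 1 / 2)} \<rho> \<partial>lborel)
      = ennreal (\<mu> * ((\<mu> powr (- 1 / 2)) powr (1 - 2 * s + 1) / (1 - 2 * s + 1)))"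
    using s \<mu> by (intro nn_integral_has_integral_lebesgue' has_integral_mult_right has_integral_powr_from_0) auto
  also have "(\<mu> powr (- 1 / 2)) powr (1 - 2 * s + 1) = \<mu> powr (s - 1)" by (simp add: powr_powr algebra_simps)
  also have "\<mu> * (\<mu> powr (s - 1) / (1 - 2 * s + 1)) = \<mu> powr s / (2 - 2 * s)"
    using \<mu>0 powr_add[of \<mu> 1 "s - 1"] by simp
  also have "(\<integral>\<^sup>+\<rho>. ennreal (\<rho> powr (- 2 * s - 1)) * indicator {\<mu> powr (- 1 / 2)..} \<rho> \<partial>lborel)
      = ennreal (- ((\<mu> powr (- 1 / 2)) powr (- 2 * s - 1 + 1)) / (- 2 * s - 1 + 1))"
    using s \<mu>0 by (intro nn_integral_has_integral_lebesgue' has_integral_powr_to_inf) auto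
  also have "- ((\<mu> powr (- 1 / 2)) powr (- 2 * s - 1 + 1)) / (- 2 * s - 1 + 1) = \<mu> powr s / (2 * s)"
    using s by (simp add: powr_powr)
  also have "ennreal (p * v) * (ennreal (\<mu> powr s / (2 - 2 * s)) + ennreal (\<mu> powr s / (2 * s)))
      = ennreal (p * v * (1 / (2 - 2 * s) + 1 / (2 * s)) * \<mu> powr s)"
  proof -
    have "ennreal (\<mu> powr s / (2 - 2 * s)) + ennreal (\<mu> powr s / (2 * s)) = ennreal (\<mu> powr s / (2 - 2 * s) + \<mu> powr s / (2 * s))"
      using s by (intro ennreal_plus[symmetric]) auto
    also have "ennreal (p * v) * \<dots> = ennreal (p * v * (\<mu> powr s / (2 - 2 * s) + \<mu> powr s / (2 * s)))"
      using p v0 by (intro ennreal_mult'[symmetric]) simp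
    finally show ?thesis by (simp add: algebra_simps)
  qed
  finally show ?thesis unfolding F_def p_def v_def .
qed simp

section \<open>Borel representatives and translation differences\<close>

lemma L2_norm_cong_AE:
  fixes f g :: "'a::euclidean_space \<Rightarrow> 'b::euclidean_space"
  assumes "f \<in> borel_measurable lebesgue" "g \<in> borel_measurable lebesgue" "AE x in lebesgue. f x = g x"
  shows "L2_norm UNIV f = L2_norm UNIV g"
proof -
  have "L2_inner UNIV f f = L2_inner UNIV g g"
    unfolding L2_inner_def lebesgue_on_UNIV_eq
  proof (rule integral_cong_AE)
    show "AE x in lebesgue. f x \<bullet> f x = g x \<bullet> g x" using assms(3) by eventually_elim simp
  qed (use assms in \<open>auto intro!: borel_measurable_inner\<close>)
  then show ?thesis by (simp add: L2_norm_def)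
qed

lemma L2_on_zero_extension:
  assumes "L2_on A w" "A \<in> sets lebesgue"
  shows "L2_on UNIV (zero_extension A w)"
proof -
  have "(norm (zero_extension A w x))\<^sup>2 = indicator A x *\<^sub>R (norm (w x))\<^sup>2" for x
    by (simp add: zero_extension_def)
  then show ?thesis
    using assms unfolding L2_on_def lebesgue_on_UNIV_eq
    by (simp add: integrable_restrict_space zero_extension_def borel_measurable_if)
qed

lemma L2_on_cong_AE:
  fixes f g :: "'a::euclidean_space \<Rightarrow> 'b::euclidean_space"
  assumes "L2_on UNIV f" "g \<in> borel_measurable lebesgue" "AE x in lebesgue. f x = g x"
  shows "L2_on UNIV g"
proof -
  have f: "f \<in> borel_measurable lebesgue" "integrable lebesgue (\<lambda>x. (norm (f x))\<^sup>2)"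
    using assms(1) by (simp_all add: L2_on_def lebesgue_on_UNIV_eq)
  have "integrable lebesgue (\<lambda>x. (norm (f x))\<^sup>2) \<longleftrightarrow> integrable lebesgue (\<lambda>x. (norm (g x))\<^sup>2)"
  proof (rule integrable_cong_AE)
    show "AE x in lebesgue. (norm (f x))\<^sup>2 = (norm (g x))\<^sup>2" using assms(3) by eventually_elim simp
  qed (use f assms(2) in auto)
  then show ?thesis using f assms(2) by (simp add: L2_on_def lebesgue_on_UNIV_eq)
qed

lemma L2_on_translate:
  fixes f :: "'a::euclidean_space \<Rightarrow> 'b::euclidean_space"
  assumes [measurable]: "f \<in> borel_measurable borel" and "L2_on UNIV f"
  shows "L2_on UNIV (\<lambda>x. f (x - y))"
proof -
  have "integrable lborel (\<lambda>x. (norm (f x))\<^sup>2)"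
    using assms by (simp add: L2_on_def lebesgue_on_UNIV_eq integrable_completion)
  then have "integrable (distr lborel borel ((+) (- y))) (\<lambda>x. (norm (f x))\<^sup>2)"
    by (simp add: lborel_distr_plus)
  then have "integrable lborel (\<lambda>x. (norm (f (x - y)))\<^sup>2)"
    by (subst (asm) integrable_distr_eq) auto
  then show ?thesis
    by (simp add: L2_on_def lebesgue_on_UNIV_eq integrable_completion measurable_completion)
qed

text \<open>A near-minimiser \<open>\<eta>\<close> is inserted twice: \<open>W\<close> and its
  translate each differ from the corresponding \<open>\<eta>\<close> by \<open>b\<close>, and
  \<open>\<eta>\<close> differs from its own translate by at most \<open>norm y * a\<close>. The
  choice of t weighs \<open>a\<close> and \<open>b\<close> exactly as K does. \<open>W\<close> is a
  Borel representative, so that translation preserves measurability.\<close>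

lemma K_functional_translate:
  assumes A: "open A" and eig: "dirichlet_eigensystem A lam \<phi>" and w: "L2_on A w" and y: "y \<noteq> 0"
    and Wb [measurable]: "W \<in> borel_measurable borel" and W: "AE x in lebesgue. zero_extension A w x = W x"
  shows "ennreal ((L2_norm UNIV (\<lambda>x. W (x - y) - W x))\<^sup>2)
    \<le> ennreal (8 * (norm y)\<^sup>2) * K_functional A lam \<phi> (1 / (norm y)\<^sup>2) w"
proof -
  let ?t = "1 / (norm y)\<^sup>2"
  have t: "0 < ?t" using y by simp
  have mA: "A \<in> sets lebesgue" using A by simp
  have L2W0: "L2_on UNIV (zero_extension A w)" by (rule L2_on_zero_extension[OF w mA])
  then have mW0: "zero_extension A w \<in> borel_measurable lebesgue"
    by (simp add: L2_on_def lebesgue_on_UNIV_eq)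
  have mW: "W \<in> borel_measurable lebesgue" by (rule measurable_completion) simp
  have L2W: "L2_on UNIV W"
    by (rule L2_on_cong_AE[OF L2W0 mW W])
  show ?thesis
  proof (rule ennreal_le_epsilon)
    fix \<epsilon> :: real assume \<epsilon>: "0 < \<epsilon>"
    \<comment> \<open>This slack becomes \<open>\<epsilon>\<close> after the final multiplication by
      \<open>8 * (norm y)\<^sup>2\<close>.\<close>
    have e: "0 < \<epsilon> / (8 * (norm y)\<^sup>2)" using \<epsilon> y by simp
    obtain \<eta> where \<eta>: "test_function A \<eta>"
      "ennreal ((L2_norm A (grad \<eta>))\<^sup>2 + ?t * (L2_norm A (\<lambda>x. w x - \<eta> x))\<^sup>2)
        \<le> K_functional A lam \<phi> ?t w + ennreal (\<epsilon> / (8 * (norm y)\<^sup>2))"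
      by (rule K_functional_approx[OF A eig t w e]) (rule that)
    have \<eta>b [measurable]: "\<eta> \<in> borel_measurable borel"
      using borel_measurable_smooth[OF test_function_smooth[OF \<eta>(1)]] .
    have L2\<eta>: "L2_on UNIV \<eta>" by (rule test_function_L2_on(1)[OF \<eta>(1)]) simp
    define a b where "a = L2_norm UNIV (grad \<eta>)" and "b = L2_norm UNIV (\<lambda>x. W x - \<eta> x)"
    have ab0: "0 \<le> a" "0 \<le> b" by (simp_all add: a_def b_def)
    have a: "L2_norm A (grad \<eta>) = a"
      unfolding a_def by (rule L2_norm_UNIV[OF mA test_function_outside(2)[OF \<eta>(1)]])
    have "L2_norm A (\<lambda>x. w x - \<eta> x) = L2_norm A (\<lambda>x. zero_extension A w x - \<eta> x)"
      unfolding L2_norm_def L2_inner_def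
      by (intro arg_cong[where f=sqrt] Bochner_Integration.integral_cong) (auto simp: zero_extension_def)
    also have "\<dots> = L2_norm UNIV (\<lambda>x. zero_extension A w x - \<eta> x)"
      by (rule L2_norm_UNIV[OF mA]) (simp add: zero_extension_def test_function_outside(1)[OF \<eta>(1)])
    also have "\<dots> = b"
      unfolding b_def
    proof (rule L2_norm_cong_AE)
      show "AE x in lebesgue. zero_extension A w x - \<eta> x = W x - \<eta> x" using W by eventually_elim simp
    qed (use mW0 mW measurable_completion[of \<eta> lborel borel] in auto)
    finally have b: "L2_norm A (\<lambda>x. w x - \<eta> x) = b" .
    have 1: "L2_norm UNIV (\<lambda>x. W (x - y) - W x)
      \<le> L2_norm UNIV (\<lambda>x. W (x - y) - \<eta> (x - y)) + L2_norm UNIV (\<lambda>x. \<eta> (x - y) - W x)"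
      by (rule L2_norm_triangle_diff) (use L2_on_translate[OF Wb L2W] L2_on_translate[OF \<eta>b L2\<eta>] L2W L2\<eta> in auto)
    have 2: "L2_norm UNIV (\<lambda>x. \<eta> (x - y) - W x)
      \<le> L2_norm UNIV (\<lambda>x. \<eta> (x - y) - \<eta> x) + L2_norm UNIV (\<lambda>x. \<eta> x - W x)"
      by (rule L2_norm_triangle_diff) (use L2_on_translate[OF Wb L2W] L2_on_translate[OF \<eta>b L2\<eta>] L2W L2\<eta> in auto)
    have 3: "L2_norm UNIV (\<lambda>x. W (x - y) - \<eta> (x - y)) = b"
      unfolding b_def by (rule L2_norm_translate[of "\<lambda>x. W x - \<eta> x" y]) simp
    have 4: "L2_norm UNIV (\<lambda>x. \<eta> x - W x) = b"
      unfolding b_def by (rule L2_norm_minus_commute)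
    have 5: "L2_norm UNIV (\<lambda>x. \<eta> (x - y) - \<eta> x) \<le> norm y * a"
      unfolding a_def by (rule test_function_translate_L2[OF \<eta>(1)])
    have "L2_norm UNIV (\<lambda>x. W (x - y) - W x) \<le> 2 * b + norm y * a"
      using 1 2 3 4 5 by linarith
    then have "(L2_norm UNIV (\<lambda>x. W (x - y) - W x))\<^sup>2 \<le> (2 * b + norm y * a)\<^sup>2"
      by (intro power_mono) auto
    \<comment> \<open>8 is twice the square of the coefficient 2 of \<open>b\<close>.\<close>
    also have "\<dots> \<le> 8 * ((norm y * a)\<^sup>2 + b\<^sup>2)"
    proof -
      have "(2 * b + norm y * a)\<^sup>2 \<le> 2 * ((2 * b)\<^sup>2 + (norm y * a)\<^sup>2)"
        using sum_squares_bound[of "2 * b" "norm y * a"] by (simp add: power2_sum)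
      also have "\<dots> \<le> 8 * ((norm y * a)\<^sup>2 + b\<^sup>2)" by simp
      finally show ?thesis .
    qed
    also have "\<dots> = 8 * (norm y)\<^sup>2 * (a\<^sup>2 + ?t * b\<^sup>2)"
      using y by (simp add: power_mult_distrib algebra_simps)
    finally have "ennreal ((L2_norm UNIV (\<lambda>x. W (x - y) - W x))\<^sup>2) \<le> ennreal (8 * (norm y)\<^sup>2 * (a\<^sup>2 + ?t * b\<^sup>2))"
      by (rule ennreal_leI)
    also have "\<dots> = ennreal (8 * (norm y)\<^sup>2) * ennreal (a\<^sup>2 + ?t * b\<^sup>2)"
      by (rule ennreal_mult') simp
    also have "\<dots> \<le> ennreal (8 * (norm y)\<^sup>2) * (K_functional A lam \<phi> ?t w + ennreal (\<epsilon> / (8 * (norm y)\<^sup>2)))"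
      using \<eta>(2) unfolding a b by (rule mult_left_mono) simp
    also have "\<dots> = ennreal (8 * (norm y)\<^sup>2) * K_functional A lam \<phi> ?t w
        + ennreal (8 * (norm y)\<^sup>2) * ennreal (\<epsilon> / (8 * (norm y)\<^sup>2))"
      by (rule distrib_left)
    also have "ennreal (8 * (norm y)\<^sup>2) * ennreal (\<epsilon> / (8 * (norm y)\<^sup>2)) = ennreal \<epsilon>"
      using y by (subst ennreal_mult'[symmetric]) auto
    finally show "ennreal ((L2_norm UNIV (\<lambda>x. W (x - y) - W x))\<^sup>2)
      \<le> ennreal (8 * (norm y)\<^sup>2) * K_functional A lam \<phi> ?t w + ennreal \<epsilon>" .
  qed
qed

text \<open>The substitution \<open>x = z + y\<close> in the inner integral, between two exchanges
  of the order of integration, leaves for each \<open>z\<close> the squared L2 norm of a translation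
  difference.\<close>

lemma nn_integral_gagliardo_shift:
  fixes W :: "'a::euclidean_space \<Rightarrow> real"
  assumes [measurable]: "W \<in> borel_measurable borel" and L2: "L2_on UNIV W"
  shows "(\<integral>\<^sup>+x. \<integral>\<^sup>+y. ennreal ((W x - W y)\<^sup>2 / norm (x - y) powr p) \<partial>lborel \<partial>lborel)
    = (\<integral>\<^sup>+z. ennreal (norm z powr - p) * ennreal ((L2_norm UNIV (\<lambda>x. W (x - z) - W x))\<^sup>2) \<partial>lborel)"
proof -
  have "(\<integral>\<^sup>+x. \<integral>\<^sup>+y. ennreal ((W x - W y)\<^sup>2 / norm (x - y) powr p) \<partial>lborel \<partial>lborel)
    = (\<integral>\<^sup>+y. \<integral>\<^sup>+x. ennreal ((W x - W y)\<^sup>2 / norm (x - y) powr p) \<partial>lborel \<partial>lborel)"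
    by (rule lborel_pair.Fubini') measurable
  also have "\<dots> = (\<integral>\<^sup>+y. \<integral>\<^sup>+z. ennreal ((W (z + y) - W y)\<^sup>2 / norm z powr p) \<partial>lborel \<partial>lborel)"
  proof (rule nn_integral_cong)
    fix y
    show "(\<integral>\<^sup>+x. ennreal ((W x - W y)\<^sup>2 / norm (x - y) powr p) \<partial>lborel)
      = (\<integral>\<^sup>+z. ennreal ((W (z + y) - W y)\<^sup>2 / norm z powr p) \<partial>lborel)"
      using nn_integral_lborel_translate[of "\<lambda>x. ennreal ((W x - W y)\<^sup>2 / norm (x - y) powr p)" y] by simp
  qed
  also have "\<dots> = (\<integral>\<^sup>+z. \<integral>\<^sup>+y. ennreal ((W (z + y) - W y)\<^sup>2 / norm z powr p) \<partial>lborel \<partial>lborel)"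
    by (rule lborel_pair.Fubini') measurable
  also have "\<dots> = (\<integral>\<^sup>+z. ennreal (norm z powr - p) * (\<integral>\<^sup>+y. ennreal ((norm (W (y + z) - W y))\<^sup>2) \<partial>lborel) \<partial>lborel)"
    by (subst nn_integral_cmult[symmetric], measurable)
       (simp add: ennreal_mult'[symmetric] powr_minus divide_inverse mult.commute add.commute)
  also have "\<dots> = (\<integral>\<^sup>+z. ennreal (norm z powr - p) * ennreal ((L2_norm UNIV (\<lambda>x. W (x - z) - W x))\<^sup>2) \<partial>lborel)"
  proof (rule nn_integral_cong)
    fix z
    have "ennreal ((L2_norm UNIV (\<lambda>x. W (x - z) - W x))\<^sup>2) = (\<integral>\<^sup>+x. ennreal ((norm (W (x - z) - W x))\<^sup>2) \<partial>lborel)"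
      using L2_on_diff[OF L2_on_translate[OF assms] L2] by (simp add: ennreal_L2_norm_power2 lebesgue_on_UNIV_eq nn_integral_completion)
    also have "\<dots> = (\<integral>\<^sup>+y. ennreal ((norm (W y - W (y + z)))\<^sup>2) \<partial>lborel)"
      using nn_integral_lborel_translate[of "\<lambda>x. ennreal ((norm (W (x - z) - W x))\<^sup>2)" z] by simp
    finally show "ennreal (norm z powr - p) * (\<integral>\<^sup>+y. ennreal ((norm (W (y + z) - W y))\<^sup>2) \<partial>lborel)
      = ennreal (norm z powr - p) * ennreal ((L2_norm UNIV (\<lambda>x. W (x - z) - W x))\<^sup>2)"
      by (simp add: power2_commute)
  qed
  finally show ?thesis .
qed

text \<open>The translation bound at t = |z|^-2 turns the seminorm into a series over the modes;
  \<open>radial_kernel_bound\<close> integrates each summand to a multiple of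
  \<open>lam j powr s\<close>, and the spectral form reappears.\<close>

lemma zero_extension_in_Hs:
  fixes A :: "'a::euclidean_space set"
  assumes s: "0 < s" "s < 1" and A: "open A" and eig: "dirichlet_eigensystem A lam \<phi>" and w: "L2_on A w"
    and fin: "navier_form s A lam \<phi> w < \<infinity>"
  shows "zero_extension A w \<in> Hs s"
proof -
  let ?u = "zero_extension A w"
  define p where "p = real DIM('a) + 2 * s"
  define C where "C = p * unit_ball_vol (real DIM('a)) * (1 / (2 - 2 * s) + 1 / (2 * s))"
  have C0: "0 \<le> C" using s by (simp add: C_def p_def)
  note lam = eigenvalue_nonneg[OF A eig]
  have L2u: "L2_on UNIV ?u" by (rule L2_on_zero_extension[OF w]) (use A in simp)
  then have "?u \<in> borel_measurable lebesgue" by (simp add: L2_on_def lebesgue_on_UNIV_eq)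
  \<comment> \<open>The exchange of integrals is done for Borel functions on the product, so a Borel
    function equal almost everywhere takes the place of the Lebesgue measurable one.\<close>
  then obtain W where W[measurable]: "W \<in> borel_measurable borel" and AE: "AE x in lborel. ?u x = W x"
    using completion_ex_borel_measurable_real[of ?u lborel] by auto
  have AE': "AE x in lebesgue. ?u x = W x" using AE by (rule AE_completion)
  have L2W: "L2_on UNIV W"
    by (rule L2_on_cong_AE[OF L2u measurable_completion AE']) simp
  define c where "c j = (L2_inner A w (\<phi> j))\<^sup>2" for j
  have K: "ennreal (norm z powr - p) * ennreal ((L2_norm UNIV (\<lambda>x. W (x - z) - W x))\<^sup>2)
    \<le> (\<Sum>j. ennreal (8 * c j) * ennreal (norm z powr - p * (lam j * (norm z)\<^sup>2 / (1 + lam j * (norm z)\<^sup>2))))" for z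
  proof (cases "z = 0")
    case False
    have "ennreal (norm z powr - p) * ennreal ((L2_norm UNIV (\<lambda>x. W (x - z) - W x))\<^sup>2)
      \<le> ennreal (norm z powr - p) * (ennreal (8 * (norm z)\<^sup>2) * K_functional A lam \<phi> (1 / (norm z)\<^sup>2) w)"
      by (intro mult_left_mono K_functional_translate[OF A eig w False W AE']) simp
    also have "\<dots> = (\<Sum>j. ennreal (norm z powr - p) * (ennreal (8 * (norm z)\<^sup>2) *
        ennreal (1 / (norm z)\<^sup>2 * lam j / (1 / (norm z)\<^sup>2 + lam j) * c j)))"
      by (simp add: K_functional_def c_def)
    also have "\<dots> = (\<Sum>j. ennreal (8 * c j) * ennreal (norm z powr - p * (lam j * (norm z)\<^sup>2 / (1 + lam j * (norm z)\<^sup>2))))"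
    proof (rule suminf_cong)
      fix j
      have z: "0 < (norm z)\<^sup>2" using False by simp
      have E: "1 / (norm z)\<^sup>2 * lam j / (1 / (norm z)\<^sup>2 + lam j) = lam j / (1 + lam j * (norm z)\<^sup>2)"
      proof -
        have "1 / (norm z)\<^sup>2 + lam j = (1 + lam j * (norm z)\<^sup>2) / (norm z)\<^sup>2" using z by (simp add: field_simps)
        then show ?thesis using z by simp
      qed
      have "0 \<le> c j" by (simp add: c_def)
      then show "ennreal (norm z powr - p) * (ennreal (8 * (norm z)\<^sup>2) *
          ennreal (1 / (norm z)\<^sup>2 * lam j / (1 / (norm z)\<^sup>2 + lam j) * c j))
        = ennreal (8 * c j) * ennreal (norm z powr - p * (lam j * (norm z)\<^sup>2 / (1 + lam j * (norm z)\<^sup>2)))"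
        unfolding E using lam[of j] by (simp add: ennreal_mult'[symmetric] ac_simps)
    qed
    finally show ?thesis .
  qed simp
  have "(\<integral>\<^sup>+x. \<integral>\<^sup>+y. ennreal ((?u x - ?u y)\<^sup>2 / norm (x - y) powr p) \<partial>lebesgue \<partial>lebesgue)
    = (\<integral>\<^sup>+x. \<integral>\<^sup>+y. ennreal ((?u x - ?u y)\<^sup>2 / norm (x - y) powr p) \<partial>lborel \<partial>lborel)"
    by (simp add: nn_integral_completion)
  also have "\<dots> = (\<integral>\<^sup>+x. \<integral>\<^sup>+y. ennreal ((W x - W y)\<^sup>2 / norm (x - y) powr p) \<partial>lborel \<partial>lborel)"
  proof (rule nn_integral_cong_AE)
    show "AE x in lborel. (\<integral>\<^sup>+y. ennreal ((?u x - ?u y)\<^sup>2 / norm (x - y) powr p) \<partial>lborel)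
      = (\<integral>\<^sup>+y. ennreal ((W x - W y)\<^sup>2 / norm (x - y) powr p) \<partial>lborel)"
      using AE
    proof eventually_elim
      case (elim x)
      show ?case
        by (rule nn_integral_cong_AE) (use AE in eventually_elim, simp add: elim)
    qed
  qed
  also have "\<dots> = (\<integral>\<^sup>+z. ennreal (norm z powr - p) * ennreal ((L2_norm UNIV (\<lambda>x. W (x - z) - W x))\<^sup>2) \<partial>lborel)"
    by (rule nn_integral_gagliardo_shift[OF W L2W])
  also have "\<dots> \<le> (\<integral>\<^sup>+(z::'a). (\<Sum>j. ennreal (8 * c j) * ennreal (norm z powr - p * (lam j * (norm z)\<^sup>2 / (1 + lam j * (norm z)\<^sup>2)))) \<partial>lborel)"
    by (rule nn_integral_mono) (rule K)
  also have "\<dots> = (\<Sum>j. \<integral>\<^sup>+(z::'a). ennreal (8 * c j) * ennreal (norm z powr - p * (lam j * (norm z)\<^sup>2 / (1 + lam j * (norm z)\<^sup>2))) \<partial>lborel)"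
    by (rule nn_integral_suminf) measurable
  also have "\<dots> \<le> (\<Sum>j. ennreal (8 * C) * ennreal (lam j powr s * c j))"
  proof (rule suminf_le)
    fix j
    have "(\<integral>\<^sup>+(z::'a). ennreal (8 * c j) * ennreal (norm z powr - p * (lam j * (norm z)\<^sup>2 / (1 + lam j * (norm z)\<^sup>2))) \<partial>lborel)
      = ennreal (8 * c j) * (\<integral>\<^sup>+(z::'a). ennreal (norm z powr - p * (lam j * (norm z)\<^sup>2 / (1 + lam j * (norm z)\<^sup>2))) \<partial>lborel)"
      by (rule nn_integral_cmult) measurable
    also have "\<dots> \<le> ennreal (8 * c j) * ennreal (C * lam j powr s)"
      unfolding p_def C_def by (intro mult_left_mono radial_kernel_bound[OF s lam]) simp
    also have "\<dots> = ennreal (8 * C) * ennreal (lam j powr s * c j)"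
      using C0 by (simp add: ennreal_mult'[symmetric] c_def ac_simps)
    finally show "(\<integral>\<^sup>+(z::'a). ennreal (8 * c j) * ennreal (norm z powr - p * (lam j * (norm z)\<^sup>2 / (1 + lam j * (norm z)\<^sup>2))) \<partial>lborel)
      \<le> ennreal (8 * C) * ennreal (lam j powr s * c j)" .
  qed auto
  also have "\<dots> = ennreal (8 * C) * navier_form s A lam \<phi> w"
    by (simp add: navier_form_def c_def)
  also have "\<dots> < \<infinity>" using fin by (simp add: ennreal_mult_less_top)
  finally show ?thesis using L2u by (simp add: Hs_def p_def)
qed

lemma Hs_cong_AE:
  fixes f g :: "'a::euclidean_space \<Rightarrow> real"
  assumes f: "f \<in> Hs s" and g: "g \<in> borel_measurable lebesgue" and AE: "AE x in lebesgue. f x = g x"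
  shows "g \<in> Hs s"
proof -
  have "(\<integral>\<^sup>+x. \<integral>\<^sup>+y. ennreal ((f x - f y)\<^sup>2 / norm (x - y) powr (real DIM('a) + 2 * s)) \<partial>lebesgue \<partial>lebesgue)
    = (\<integral>\<^sup>+x. \<integral>\<^sup>+y. ennreal ((g x - g y)\<^sup>2 / norm (x - y) powr (real DIM('a) + 2 * s)) \<partial>lebesgue \<partial>lebesgue)"
  proof (rule nn_integral_cong_AE)
    show "AE x in lebesgue. (\<integral>\<^sup>+y. ennreal ((f x - f y)\<^sup>2 / norm (x - y) powr (real DIM('a) + 2 * s)) \<partial>lebesgue)
      = (\<integral>\<^sup>+y. ennreal ((g x - g y)\<^sup>2 / norm (x - y) powr (real DIM('a) + 2 * s)) \<partial>lebesgue)"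
      using AE
    proof eventually_elim
      case (elim x)
      show ?case
        by (rule nn_integral_cong_AE) (use AE in eventually_elim, simp add: elim)
    qed
  qed
  then show ?thesis using f L2_on_cong_AE[OF _ g AE] by (simp add: Hs_def)
qed

theorem lemma2p2:
  fixes s :: real
    and \<Omega> :: "'a::euclidean_space set" and \<Omega>h :: "nat \<Rightarrow> 'a set"
    and c :: 'a and R :: real
    and lam :: "nat \<Rightarrow> real" and \<phi> :: "nat \<Rightarrow> 'a \<Rightarrow> real"
    and lamh :: "nat \<Rightarrow> nat \<Rightarrow> real" and \<phi>h :: "nat \<Rightarrow> nat \<Rightarrow> 'a \<Rightarrow> real"
    and u :: "'a \<Rightarrow> real" and uh :: "nat \<Rightarrow> 'a \<Rightarrow> real"
  assumes "0 < s" and "s < 1"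
    and "bounded_lipschitz_domain \<Omega>"
    and "uniformly_lipschitz_domains {1..} \<Omega>h"
    and "\<And>h. h \<ge> 1 \<Longrightarrow> closure \<Omega> \<subseteq> \<Omega>h h"
    and "\<And>h. h \<ge> 1 \<Longrightarrow> \<Omega>h h \<subseteq> {x. infdist x \<Omega> < 1 / real h}"
    and "\<And>h. h \<ge> 1 \<Longrightarrow> closure (\<Omega>h h) \<subseteq> ball c R"
    and "dirichlet_eigensystem \<Omega> lam \<phi>"
    and "\<And>h. h \<ge> 1 \<Longrightarrow> dirichlet_eigensystem (\<Omega>h h) (lamh h) (\<phi>h h)"
    and "\<And>h. h \<ge> 1 \<Longrightarrow> uh h \<in> Hs_tilde s (\<Omega>h h)"
    and "(SUP h\<in>{1..}. navier_form s (\<Omega>h h) (lamh h) (\<phi>h h) (uh h)) < \<infinity>"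
    and "L2_on (ball c R) u"
    and "L2_converges (ball c R) uh u"
  shows "zero_extension (ball c R) u \<in> Hs_tilde s \<Omega> \<and>
    navier_form s \<Omega> lam \<phi> (zero_extension (ball c R) u)
      \<le> liminf (\<lambda>h. navier_form s (\<Omega>h h) (lamh h) (\<phi>h h) (uh h))"
proof -
  let ?B = "ball c R" and ?U = "zero_extension (ball c R) u"
  let ?N = "\<lambda>h. navier_form s (\<Omega>h h) (lamh h) (\<phi>h h) (uh h)"
  have \<Omega>: "open \<Omega>" "\<Omega> \<noteq> {}"
    using assms(3) by (auto simp: bounded_lipschitz_domain_def domain_def)
  have o\<Omega>h: "open (\<Omega>h h)" if "h \<ge> 1" for h
    using assms(4) that by (auto simp: uniformly_lipschitz_domains_def domain_def)
  have sub: "\<Omega> \<subseteq> \<Omega>h h" "\<Omega>h h \<subseteq> ?B" if "h \<ge> 1" for h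
    using assms(5,7)[OF that] closure_subset by blast+
  have mB: "?B \<in> sets lebesgue" and m\<Omega>: "\<Omega> \<in> sets lebesgue" using \<Omega> by auto
  have clB: "closure \<Omega> \<subseteq> ?B" using assms(5)[of 1] sub(2)[of 1] by auto
  have L2uh: "L2_on ?B (uh h)" if "h \<ge> 1" for h
    by (rule L2_on_subset[of UNIV]) (use assms(10)[OF that] in \<open>auto simp: Hs_tilde_def Hs_def\<close>)
  have L2U': "L2_on UNIV ?U" by (rule L2_on_zero_extension[OF assms(12) mB])
  have L2U: "L2_on ?B ?U" by (rule L2_on_subset[OF L2U']) auto
  have "L2_converges ?B uh ?U \<longleftrightarrow> L2_converges ?B uh u"
    unfolding L2_converges_def
    by (intro arg_cong2[where f="\<lambda>f g. f \<longlonglongrightarrow> g"] ext Bochner_Integration.integral_cong)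
       (auto simp: zero_extension_def)
  with assms(13) have conv: "L2_converges ?B uh ?U" by simp
  have le: "navier_form s \<Omega> lam \<phi> ?U \<le> liminf ?N"
  proof (rule navier_form_le_liminf[OF assms(1,2)])
    show "0 \<le> lam j" for j by (rule eigenvalue_nonneg[OF \<Omega>(1) assms(8)])
    show "0 \<le> lamh h j" if "h \<ge> 1" for h j by (rule eigenvalue_nonneg[OF o\<Omega>h[OF that] assms(9)[OF that]])
    show "K_functional \<Omega> lam \<phi> t ?U \<le> liminf (\<lambda>h. K_functional (\<Omega>h h) (lamh h) (\<phi>h h) t (uh h))"
      if "0 < t" for t
      by (rule K_functional_le_liminf[OF assms(3,8) open_ball o\<Omega>h sub assms(6,9) L2uh L2U conv that])
  qed
  \<comment> \<open>The uniform bound makes the form of the limit finite, which is the input for its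
    regularity.\<close>
  have "liminf ?N \<le> (SUP h\<in>{1..}. ?N h)"
  proof (rule Liminf_le)
    show "\<forall>\<^sub>F h in sequentially. ?N h \<le> (SUP h\<in>{1..}. ?N h)"
      by (rule eventually_sequentiallyI[of 1]) (auto intro: SUP_upper)
  qed simp
  with le assms(11) have fin: "navier_form s \<Omega> lam \<phi> ?U < \<infinity>" by (meson le_less_trans)
  \<comment> \<open>The spectral form on \<open>\<Omega>\<close> only sees values there, so
    regularity is first obtained for \<open>?U\<close> cut off to \<open>\<Omega>\<close>.\<close>
  have "L2_on \<Omega> ?U" by (rule L2_on_subset[OF L2U' _ m\<Omega>]) auto
  then have Hs: "zero_extension \<Omega> ?U \<in> Hs s"
    by (rule zero_extension_in_Hs[OF assms(1,2) \<Omega>(1) assms(8) _ fin])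
  have "AE x in lebesgue. x \<in> ?B \<longrightarrow> x \<notin> closure \<Omega> \<longrightarrow> ?U x = 0"
  proof (rule AE_eq_0_outside_closure[OF mB \<Omega>(2) assms(6) L2uh L2U conv])
    show "AE x in lebesgue. x \<notin> closure (\<Omega>h h) \<longrightarrow> uh h x = 0" if "h \<ge> 1" for h
      using assms(10)[OF that] by (simp add: Hs_tilde_def)
  qed
  then have out: "AE x in lebesgue. x \<notin> closure \<Omega> \<longrightarrow> ?U x = 0"
    by eventually_elim (auto simp: zero_extension_def)
  \<comment> \<open>\<open>?U\<close> is known to vanish off the closure only; the cut-off could
    still alter it on the frontier, which is null.\<close>
  have "frontier \<Omega> \<in> null_sets lebesgue"
    using negligible_frontier_lipschitz[OF assms(3)] by (simp add: negligible_iff_null_sets)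
  then have "AE x in lebesgue. x \<notin> frontier \<Omega>" by (rule AE_not_in)
  with out have "AE x in lebesgue. zero_extension \<Omega> ?U x = ?U x"
    by eventually_elim (use \<Omega>(1) in \<open>auto simp: zero_extension_def[of \<Omega>] frontier_def interior_open\<close>)
  then have "?U \<in> Hs s"
    using Hs_cong_AE[OF Hs] L2U' by (simp add: L2_on_def lebesgue_on_UNIV_eq)
  with out le show ?thesis by (simp add: Hs_tilde_def)
qed

end
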